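(* Let $n\ge 3$ and let $m_1<\cdots<m_n$ be a generalized arithmetic sequence of positive integers, i.e. there exist $h,d\in\mathbb{Z}^+$ such that $m_i=h\,m_1+(i-1)d$ for all $i\in\{2,\ldots,n\}$. Then $K[\mathcal{C}]$ is Cohen-Macaulay if and only if $m_1<\cdots<m_n$ is an arithmetic sequence.
   Context: $K$ is an infinite field and $R=K[x_1,\ldots,x_{n+1}]$. For positive integers $m_1<\cdots<m_n$, the associated projective monomial curve $\mathcal{C}\subset\mathbb{P}^n_K$ is parametrically defined by $x_i=u^{m_i}v^{m_n-m_i}$ for $1\le i\le n$ and $x_{n+1}=v^{m_n}$. Its vanishing ideal $I(\mathcal{C})\subset R$ is the kernel of the $K$-algebra homomorphism $R\to K[u,v]$, $x_i\mapsto u^{m_i}v^{m_n-m_i}$ ($1\le i\le n$), $x_{n+1}\mapsto v^{m_n}$, and $K[\mathcal{C}]=R/I(\mathcal{C})$. *)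

theory Defs
  imports
    "HOL-Algebra.Algebra"
    "HOL-Library.Poly_Mapping"
    "HOL-Library.Extended_Nat"
begin

section \<open>Polynomial rings\<close>

text \<open>
  A polynomial in variables of type \<^typ>\<open>'v\<close> over \<^typ>\<open>'k\<close> is a finitely supported
  function from exponent vectors to coefficients, with the convolution product of
  \<^theory>\<open>HOL-Library.Poly_Mapping\<close>.
\<close>

type_synonym ('v, 'k) mpol = "('v \<Rightarrow>\<^sub>0 nat) \<Rightarrow>\<^sub>0 'k"

definition mpol_ring :: "'v set \<Rightarrow> ('v, 'k::field) mpol ring" where
  "mpol_ring V =
     \<lparr>carrier = {p. \<forall>\<mu> \<in> Poly_Mapping.keys p. Poly_Mapping.keys \<mu> \<subseteq> V},
      monoid.mult = (*), one = 1, ring.zero = 0, add = (+)\<rparr>"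

definition mpol_var :: "'v \<Rightarrow> ('v, 'k::field) mpol" where
  "mpol_var i = Poly_Mapping.single (Poly_Mapping.single i 1) 1"

definition mpol_const :: "'k \<Rightarrow> ('v, 'k::field) mpol" where
  "mpol_const c = Poly_Mapping.single 0 c"

definition mpol_subst :: "('v \<Rightarrow> ('w, 'k::field) mpol) \<Rightarrow> ('v, 'k) mpol \<Rightarrow> ('w, 'k) mpol" where
  "mpol_subst t p =
     (\<Sum>\<mu> \<in> Poly_Mapping.keys p. mpol_const (Poly_Mapping.lookup p \<mu>) *
        (\<Prod>i \<in> Poly_Mapping.keys \<mu>. t i ^ Poly_Mapping.lookup \<mu> i))"


section \<open>Cohen-Macaulay rings\<close>

definition frac_rel :: "('a, 'm) ring_scheme \<Rightarrow> 'a set \<Rightarrow> (('a \<times> 'a) \<times> ('a \<times> 'a)) set" where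
  "frac_rel A S =
     {((a, s), (b, t)). a \<in> carrier A \<and> s \<in> S \<and> b \<in> carrier A \<and> t \<in> S \<and>
        (\<exists>w \<in> S. w \<otimes>\<^bsub>A\<^esub> (t \<otimes>\<^bsub>A\<^esub> a) = w \<otimes>\<^bsub>A\<^esub> (s \<otimes>\<^bsub>A\<^esub> b))}"

text \<open>The ring of fractions $S^{-1}A$, for a multiplicative subset $S$ of $A$; the factor \<open>w\<close> in \<open>frac_rel\<close> accounts for zero divisors.\<close>

definition localization :: "('a, 'm) ring_scheme \<Rightarrow> 'a set \<Rightarrow> ('a \<times> 'a) set ring" where
  "localization A S =
     \<lparr>carrier = (carrier A \<times> S) // frac_rel A S,
      monoid.mult = (\<lambda>p q. \<Union>(a, s) \<in> p. \<Union>(b, t) \<in> q.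
                frac_rel A S `` {(a \<otimes>\<^bsub>A\<^esub> b, s \<otimes>\<^bsub>A\<^esub> t)}),
      one = frac_rel A S `` {(\<one>\<^bsub>A\<^esub>, \<one>\<^bsub>A\<^esub>)},
      ring.zero = frac_rel A S `` {(\<zero>\<^bsub>A\<^esub>, \<one>\<^bsub>A\<^esub>)},
      add = (\<lambda>p q. \<Union>(a, s) \<in> p. \<Union>(b, t) \<in> q.
                frac_rel A S `` {(t \<otimes>\<^bsub>A\<^esub> a \<oplus>\<^bsub>A\<^esub> s \<otimes>\<^bsub>A\<^esub> b, s \<otimes>\<^bsub>A\<^esub> t)})\<rparr>"

definition krull_dim :: "('a, 'm) ring_scheme \<Rightarrow> enat" where
  "krull_dim A =
     (SUP k \<in> {k. \<exists>P :: nat \<Rightarrow> 'a set. (\<forall>i\<le>k. primeideal (P i) A) \<and> (\<forall>i<k. P i \<subset> P (Suc i))}.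
        enat k)"

text \<open>
  The second conjunct says that \<open>xs ! i\<close> is a nonzerodivisor modulo the ideal generated by its
  predecessors.
\<close>

definition regular_sequence :: "('a, 'm) ring_scheme \<Rightarrow> 'a list \<Rightarrow> bool" where
  "regular_sequence A xs \<longleftrightarrow>
     set xs \<subseteq> carrier A \<and>
     (\<forall>i < length xs. \<forall>a \<in> carrier A.
        xs ! i \<otimes>\<^bsub>A\<^esub> a \<in> Idl\<^bsub>A\<^esub> (set (take i xs)) \<longrightarrow> a \<in> Idl\<^bsub>A\<^esub> (set (take i xs))) \<and>
     Idl\<^bsub>A\<^esub> (set xs) \<noteq> carrier A"

text \<open>For a local ring, the set of nonunits is the maximal ideal.\<close>

definition local_depth :: "('a, 'm) ring_scheme \<Rightarrow> enat" where
  "local_depth A =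
     (SUP xs \<in> {xs. regular_sequence A xs \<and> set xs \<subseteq> carrier A - Units A}. enat (length xs))"

definition cohen_macaulay :: "('a, 'm) ring_scheme \<Rightarrow> bool" where
  "cohen_macaulay A \<longleftrightarrow>
     cring A \<and> noetherian_ring A \<and>
     (\<forall>M. maximalideal M A \<longrightarrow>
        local_depth (localization A (carrier A - M)) = krull_dim (localization A (carrier A - M)))"


section \<open>Projective monomial curves\<close>

text \<open>
  The variables $x_1, \dots, x_{n+1}$ have indices \<open>1, \<dots>, n + 1\<close>. The ring $K[u, v]$ uses index
  \<open>0\<close> for $u$ and index \<open>1\<close> for $v$. As \<open>m\<close> is increasing on \<open>{1..n}\<close>, the subtraction
  \<open>m n - m i\<close> is not truncated there.
\<close>

definition curve_param :: "nat \<Rightarrow> (nat \<Rightarrow> nat) \<Rightarrow> nat \<Rightarrow> (nat, 'k::field) mpol" where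
  "curve_param n m i =
     (if i = n + 1 then mpol_var 1 ^ m n
      else mpol_var 0 ^ m i * mpol_var 1 ^ (m n - m i))"

definition vanishing_ideal :: "nat \<Rightarrow> (nat \<Rightarrow> nat) \<Rightarrow> (nat, 'k::field) mpol set" where
  "vanishing_ideal n m =
     a_kernel (mpol_ring {1..n + 1}) (mpol_ring {0, 1}) (mpol_subst (curve_param n m))"

definition coordinate_ring :: "nat \<Rightarrow> (nat \<Rightarrow> nat) \<Rightarrow> (nat, 'k::field) mpol set ring" where
  "coordinate_ring n m = mpol_ring {1..n + 1} Quot vanishing_ideal n m"

definition arithmetic_sequence :: "nat \<Rightarrow> (nat \<Rightarrow> nat) \<Rightarrow> bool" where
  "arithmetic_sequence n m \<longleftrightarrow> (\<exists>d>0. \<forall>i \<in> {1..n}. m i = m 1 + (i - 1) * d)"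

definition generalized_arithmetic_sequence :: "nat \<Rightarrow> (nat \<Rightarrow> nat) \<Rightarrow> bool" where
  "generalized_arithmetic_sequence n m \<longleftrightarrow>
     (\<exists>h>0. \<exists>d>0. \<forall>i \<in> {2..n}. m i = h * m 1 + (i - 1) * d)"

end

theory Submission
  imports Defs "HOL-Computational_Algebra.Polynomial"
begin

text \<open>
  The coordinate ring is the semigroup ring \<open>K[S]\<close> of the plane semigroup \<open>S\<close> generated by the
  exponents \<open>(m\<^sub>i, m\<^sub>n - m\<^sub>i)\<close> and \<open>(0, m\<^sub>n)\<close>; put \<open>\<alpha> = (m\<^sub>n, 0)\<close> and \<open>\<beta> = (0, m\<^sub>n)\<close>. It is
  Cohen-Macaulay iff \<open>S\<close> has no hole \<open>s \<notin> S\<close> with \<open>s + \<alpha> \<in> S\<close> and \<open>s + \<beta> \<in> S\<close>.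

  Without holes, let \<open>M\<close> be a maximal ideal. A Nullstellensatz argument gives nonzero one-variable
  polynomials \<open>p\<close> and \<open>q\<close> with \<open>p(x\<^sup>\<alpha>), q(x\<^sup>\<beta>) \<in> M\<close>, and division by \<open>q(x\<^sup>\<beta>)\<close> shows that they form a
  regular sequence. As the depth never exceeds the dimension, and any three elements of \<open>K[S]\<close> are
  algebraically dependent, depth and dimension at \<open>M\<close> are both 2. With a hole, a maximal hole \<open>t\<close>
  gives a monomial outside \<open>K[S]\<close> that the irrelevant ideal multiplies into \<open>K[S]\<close>, so the depth
  there is at most 1, while the dimension is at least 2.

  A degree \<open>N\<close> monomial with first exponent \<open>x\<close> is in \<open>S\<close> iff \<open>x\<close> is a sum of at most \<open>N\<close> terms
  \<open>m\<^sub>i\<close>. For an arithmetic sequence subtracting \<open>m\<^sub>n\<close> shortens such sums, so there is no hole; for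
  \<open>h \<ge> 2\<close> the equation \<open>h m\<^sub>1 + m\<^sub>n = m\<^sub>2 + m\<^sub>n\<^sub>-\<^sub>1\<close> gives one.
\<close>

text \<open>Cohen-Macaulayness is tested at every maximal ideal \<open>M\<close> of
  \<open>K[S]\<close>, and \<open>K\<close> need not be algebraically closed, so \<open>M\<close>
  need not be the ideal of a point with coordinates in \<open>K\<close>. A pair of elements of
  \<open>M\<close>, each a polynomial in one axis monomial, takes the place of coordinates; its
  regularity is an identity in \<open>K[S]\<close> that passes to the localization afterwards. Such
  elements exist because \<open>K[S]\<close> is a finite module over the polynomials in
  \<open>x^\<alpha>\<close> and \<open>x^\<beta>\<close>. The infinite field supplies a value
  \<gamma> at which a leading coefficient does not vanish, and Nakayama's lemma over the local ring
  of the line at \<gamma> excludes that an axis monomial is transcendental modulo \<open>M\<close>.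
  Dimension theory is replaced by the squeeze 2 <= depth <= dimension <= 2, whose last bound rests
  on counting: products of powers of three elements grow cubically in number, exponents in the plane
  quadratically.\<close>

section \<open>Primes avoiding a multiplicative set, and depth against dimension\<close>

lemma (in cring) idealI_closed:
  assumes "I \<subseteq> carrier R" "\<zero> \<in> I"
    and "\<And>a b. \<lbrakk>a \<in> I; b \<in> I\<rbrakk> \<Longrightarrow> a \<oplus> b \<in> I"
    and "\<And>a x. \<lbrakk>a \<in> I; x \<in> carrier R\<rbrakk> \<Longrightarrow> x \<otimes> a \<in> I"
  shows "ideal I R"
proof (rule idealI)
  show "ring R" by (rule ring_axioms)
  have "\<ominus> a \<in> I" if "a \<in> I" for a
  proof -
    have "\<ominus> a = (\<ominus> \<one>) \<otimes> a"
      using that assms(1) by (auto simp: l_minus)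
    then show ?thesis using assms(4)[OF that, of "\<ominus> \<one>"] by simp
  qed
  then show "subgroup I (add_monoid R)"
    using assms by (intro add.subgroupI) (auto simp: a_inv_def)
  show "x \<otimes> a \<in> I" "a \<otimes> x \<in> I" if "a \<in> I" "x \<in> carrier R" for a x
    using assms(1,4) that by (auto simp: m_comm subset_iff)
qed

text \<open>By Zorn's lemma there is an ideal \<open>P\<close> maximal among those above
  \<open>I\<close> that miss \<open>S\<close>. It is prime: for \<open>a\<close> and
  \<open>b\<close> outside \<open>P\<close> both \<open>P + (a)\<close> and \<open>P + (b)\<close>
  meet \<open>S\<close>, and the product of the two elements found lies in
  \<open>P + (ab)\<close>.\<close>

lemma (in cring) prime_avoiding_exists:
  assumes I: "ideal I R" and S: "S \<subseteq> carrier R" "\<one> \<in> S"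
    and S_mult: "\<And>s t. \<lbrakk>s \<in> S; t \<in> S\<rbrakk> \<Longrightarrow> s \<otimes> t \<in> S" and disj: "I \<inter> S = {}"
  shows "\<exists>P. primeideal P R \<and> I \<subseteq> P \<and> P \<inter> S = {}"
proof -
  define F where "F = {J. ideal J R \<and> I \<subseteq> J \<and> J \<inter> S = {}}"
  have "\<exists>P\<in>F. \<forall>Z\<in>F. P \<subseteq> Z \<longrightarrow> Z = P"
  proof (rule subset_Zorn_nonempty)
    show "F \<noteq> {}" using I disj by (auto simp: F_def)
  next
    fix C assume C: "C \<noteq> {}" "subset.chain F C"
    then have CF: "C \<subseteq> F" and lin: "\<And>Z W. \<lbrakk>Z \<in> C; W \<in> C\<rbrakk> \<Longrightarrow> Z \<subseteq> W \<or> W \<subseteq> Z"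
      by (auto simp: subset.chain_def)
    obtain J0 where J0: "J0 \<in> C" using C by blast
    have idl: "ideal J R" if "J \<in> C" for J using that CF by (auto simp: F_def)
    have "ideal (\<Union>C) R"
    proof (rule idealI_closed)
      show "\<Union>C \<subseteq> carrier R" using idl ideal.Icarr by fastforce
      show "\<zero> \<in> \<Union>C" using J0 idl[OF J0] additive_subgroup.zero_closed ideal.axioms(1) by blast
    next
      fix a b assume "a \<in> \<Union>C" "b \<in> \<Union>C"
      then obtain Z where "Z \<in> C" "a \<in> Z" "b \<in> Z" using lin by blast
      then show "a \<oplus> b \<in> \<Union>C"
        using additive_subgroup.a_closed[OF ideal.axioms(1)[OF idl]] by blast
    next
      fix a x assume "a \<in> \<Union>C" "x \<in> carrier R"
      then show "x \<otimes> a \<in> \<Union>C" using ideal.I_l_closed[OF idl] by blast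
    qed
    moreover have "I \<subseteq> \<Union>C" using J0 CF by (auto simp: F_def)
    moreover have "\<Union>C \<inter> S = {}" using CF by (auto simp: F_def)
    ultimately show "\<Union>C \<in> F" by (simp add: F_def)
  qed
  then obtain P where P: "ideal P R" "I \<subseteq> P" "P \<inter> S = {}"
    and max: "\<And>Z. \<lbrakk>ideal Z R; P \<subseteq> Z; Z \<inter> S = {}\<rbrakk> \<Longrightarrow> Z = P" by (auto simp: F_def)
  interpret P: ideal P R by fact
  have ext: "\<exists>p\<in>P. \<exists>r\<in>carrier R. p \<oplus> a \<otimes> r \<in> S" if a: "a \<in> carrier R" "a \<notin> P" for a
  proof (rule ccontr)
    let ?J = "{p \<oplus> a \<otimes> r | p r. p \<in> P \<and> r \<in> carrier R}"
    assume "\<not> ?thesis"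
    then have J: "?J \<inter> S = {}" by blast
    have "ideal ?J R"
    proof (rule idealI_closed)
      show "?J \<subseteq> carrier R" using a by auto
      show "\<zero> \<in> ?J" using a by (intro CollectI exI[of _ \<zero>]) auto
    next
      fix x y assume "x \<in> ?J" "y \<in> ?J"
      then obtain p r q t where "p \<in> P" "q \<in> P" "r \<in> carrier R" "t \<in> carrier R"
        and x: "x = p \<oplus> a \<otimes> r" and y: "y = q \<oplus> a \<otimes> t" by blast
      moreover from this have "x \<oplus> y = (p \<oplus> q) \<oplus> a \<otimes> (r \<oplus> t)"
        using a P.Icarr unfolding x y by algebra
      ultimately show "x \<oplus> y \<in> ?J" by blast
    next
      fix x y assume "x \<in> ?J" and yc: "y \<in> carrier R"
      then obtain p r where "p \<in> P" "r \<in> carrier R" and x: "x = p \<oplus> a \<otimes> r" by blast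
      moreover from this have "y \<otimes> x = (y \<otimes> p) \<oplus> a \<otimes> (y \<otimes> r)"
        using a P.Icarr yc unfolding x by algebra
      ultimately show "y \<otimes> x \<in> ?J" using yc P.I_l_closed by blast
    qed
    moreover have "P \<subseteq> ?J"
    proof
      fix p assume "p \<in> P"
      then have "p = p \<oplus> a \<otimes> \<zero>" using a by auto
      then show "p \<in> ?J" using \<open>p \<in> P\<close> by blast
    qed
    ultimately have "?J = P" using max J by blast
    moreover have "a \<in> ?J"
      using a by (intro CollectI exI[of _ \<zero>] exI[of _ \<one>]) auto
    ultimately show False using a by blast
  qed
  have "primeideal P R"
  proof (rule primeidealI)
    show "carrier R \<noteq> P" using S P(3) by blast
    fix a b assume ab: "a \<in> carrier R" "b \<in> carrier R" "a \<otimes> b \<in> P"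
    show "a \<in> P \<or> b \<in> P"
    proof (rule ccontr)
      assume "\<not> ?thesis"
      then obtain p r q t where pr: "p \<in> P" "q \<in> P" "r \<in> carrier R" "t \<in> carrier R"
        and S2: "p \<oplus> a \<otimes> r \<in> S" "q \<oplus> b \<otimes> t \<in> S" using ext ab by meson
      have "(p \<oplus> a \<otimes> r) \<otimes> (q \<oplus> b \<otimes> t)
          = ((q \<oplus> b \<otimes> t) \<otimes> p \<oplus> (a \<otimes> r) \<otimes> q) \<oplus> (r \<otimes> t) \<otimes> (a \<otimes> b)"
        using pr ab P.Icarr by algebra
      also have "\<dots> \<in> P"
        using pr ab P.I_l_closed[of p "q \<oplus> b \<otimes> t"] P.I_l_closed[of q "a \<otimes> r"]
          P.I_l_closed[of "a \<otimes> b" "r \<otimes> t"] by (auto simp: P.Icarr)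
      finally show False using S_mult[OF S2] P(3) by blast
    qed
  qed (use P in \<open>auto intro: is_cring\<close>)
  then show ?thesis using P by blast
qed

text \<open>A nonzerodivisor modulo an ideal \<open>I\<close> avoids some prime over \<open>I\<close> inside any given prime over
  \<open>I\<close>, so a regular sequence lets us build a chain of primes downwards.\<close>

lemma (in cring) regular_sequence_prime_chain:
  assumes "regular_sequence R xs"
  shows "\<exists>P :: nat \<Rightarrow> 'a set. (\<forall>i\<le>length xs. primeideal (P i) R) \<and> (\<forall>i<length xs. P i \<subset> P (Suc i))"
proof -
  have xs: "set xs \<subseteq> carrier R" and nc: "Idl (set xs) \<noteq> carrier R"
    and reg: "\<And>i a. \<lbrakk>i < length xs; a \<in> carrier R; xs ! i \<otimes> a \<in> Idl (set (take i xs))\<rbrakk>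
                 \<Longrightarrow> a \<in> Idl (set (take i xs))"
    using assms by (auto simp: regular_sequence_def)
  have take_carr: "set (take i xs) \<subseteq> carrier R" for i
    using xs set_take_subset by fastforce
  \<comment> \<open>The chain is extended at its lower end. The invariant keeps the first
    \<open>length xs - k\<close> entries in \<open>P 0\<close>, so that the last of these can
    separate the next prime from \<open>P 0\<close>.\<close>
  have "\<exists>P :: nat \<Rightarrow> 'a set. (\<forall>i\<le>k. primeideal (P i) R) \<and> (\<forall>i<k. P i \<subset> P (Suc i)) \<and>
          Idl (set (take (length xs - k) xs)) \<subseteq> P 0" if "k \<le> length xs" for k
    using that
  proof (induction k)
    case 0
    have I: "ideal (Idl (set xs)) R" using genideal_ideal xs by blast
    then have "\<one> \<notin> Idl (set xs)" using nc ideal.one_imp_carrier by blast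
    then obtain P where "primeideal P R" "Idl (set xs) \<subseteq> P"
      using prime_avoiding_exists[OF I, of "{\<one>}"] by auto
    then show ?case by (intro exI[of _ "\<lambda>_. P"]) auto
  next
    case (Suc k)
    then obtain P :: "nat \<Rightarrow> 'a set" where P: "\<forall>i\<le>k. primeideal (P i) R" "\<forall>i<k. P i \<subset> P (Suc i)"
      and sub: "Idl (set (take (length xs - k) xs)) \<subseteq> P 0" by auto
    define i where "i = length xs - Suc k"
    have i: "i < length xs" "length xs - k = Suc i" using Suc.prems by (auto simp: i_def)
    let ?x = "xs ! i" and ?I = "Idl (set (take i xs))"
    have I: "ideal ?I R" using genideal_ideal take_carr by blast
    have xc: "?x \<in> carrier R" using xs i by auto
    have tk: "set (take (Suc i) xs) \<subseteq> P 0"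
      using sub i genideal_self[OF take_carr] by fastforce
    then have xP: "?x \<in> P 0" using i by (auto simp: take_Suc_conv_app_nth)
    interpret P0: primeideal "P 0" R using P by blast
    have IP: "?I \<subseteq> P 0"
      using tk i by (intro genideal_minimal) (auto simp: take_Suc_conv_app_nth P0.is_ideal)
    \<comment> \<open>Missing this set does two things at once: the case \<open>j = 0\<close> forces
      \<open>Q\<close> into \<open>P 0\<close>, and \<open>?x\<close> itself stays outside
      \<open>Q\<close>.\<close>
    let ?S = "{s \<otimes> ?x [^] (j::nat) | s j. s \<in> carrier R - P 0}"
    \<comment> \<open>Powers of \<open>?x\<close> cancel modulo \<open>?I\<close>, so a common
      element of \<open>?I\<close> and \<open>?S\<close> would give an element of \<open>?I\<close>
      outside \<open>P 0\<close>.\<close>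
    have pow: "s \<in> ?I" if "s \<in> carrier R" "s \<otimes> ?x [^] (j::nat) \<in> ?I" for s j
      using that
    proof (induction j)
      case (Suc j)
      have "?x \<otimes> (s \<otimes> ?x [^] j) = s \<otimes> ?x [^] Suc j"
        using xc Suc.prems by (simp add: m_ac)
      then show ?case using reg[OF i(1), of "s \<otimes> ?x [^] j"] Suc xc by auto
    qed auto
    have "\<exists>Q. primeideal Q R \<and> ?I \<subseteq> Q \<and> Q \<inter> ?S = {}"
    proof (rule prime_avoiding_exists[OF I])
      show "?S \<subseteq> carrier R" using xc by auto
      have "\<one> \<notin> P 0" using P0.one_imp_carrier P0.I_notcarr by blast
      then show "\<one> \<in> ?S" by (intro CollectI exI[of _ \<one>] exI[of _ 0]) auto
      show "s \<otimes> t \<in> ?S" if "s \<in> ?S" "t \<in> ?S" for s t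
      proof -
        obtain a b j l where ab: "a \<in> carrier R - P 0" "b \<in> carrier R - P 0"
          and st: "s = a \<otimes> ?x [^] (j::nat)" "t = b \<otimes> ?x [^] (l::nat)" using \<open>s \<in> ?S\<close> \<open>t \<in> ?S\<close> by blast
        then have "s \<otimes> t = (a \<otimes> b) \<otimes> ?x [^] (j + l)"
          using xc by (simp add: nat_pow_mult[symmetric] m_ac)
        moreover have "a \<otimes> b \<in> carrier R - P 0" using ab P0.I_prime by blast
        ultimately show ?thesis by blast
      qed
      show "?I \<inter> ?S = {}" using pow IP by blast
    qed
    then obtain Q where Q: "primeideal Q R" "?I \<subseteq> Q" "Q \<inter> ?S = {}" by blast
    have "Q \<subseteq> P 0"
    proof
      fix s assume "s \<in> Q"
      then have sc: "s \<in> carrier R" using Q(1) ideal.Icarr primeideal.axioms(1) by metis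
      show "s \<in> P 0"
      proof (rule ccontr)
        assume "s \<notin> P 0"
        then have "s \<otimes> ?x [^] (0::nat) \<in> ?S" using sc by blast
        then show False using \<open>s \<in> Q\<close> Q(3) sc by auto
      qed
    qed
    moreover have "?x \<notin> Q"
    proof -
      have "\<one> \<notin> P 0" using P0.one_imp_carrier P0.I_notcarr by blast
      then have "\<one> \<otimes> ?x [^] (1::nat) \<in> ?S" by blast
      then show ?thesis using Q(3) xc by auto
    qed
    ultimately have "Q \<subset> P 0" using xP by blast
    then show ?case using P Q i
      by (intro exI[of _ "case_nat Q P"]) (auto simp: less_Suc_eq_0_disj i_def split: nat.split)
  qed
  from this[of "length xs"] show ?thesis by auto
qed

lemma (in cring) local_depth_le_krull_dim: "local_depth R \<le> krull_dim R"
  unfolding local_depth_def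
proof (rule SUP_least)
  fix xs assume "xs \<in> {xs. regular_sequence R xs \<and> set xs \<subseteq> carrier R - Units R}"
  then show "enat (length xs) \<le> krull_dim R"
    unfolding krull_dim_def using regular_sequence_prime_chain by (intro SUP_upper) blast
qed


section \<open>Localization of a domain at a prime ideal\<close>

locale domain_prime = domain A for A (structure) +
  fixes M
  assumes prime_M: "primeideal M A"
begin

sublocale M: primeideal M A by (rule prime_M)

definition D where "D = carrier A - M"

abbreviation L where "L \<equiv> localization A (carrier A - M)"

definition frac where "frac a s = frac_rel A D `` {(a, s)}"

lemma mem_D_iff: "s \<in> carrier A \<Longrightarrow> s \<in> D \<longleftrightarrow> s \<notin> M"
  by (simp add: D_def)

lemma D_carrier [simp]: "s \<in> D \<Longrightarrow> s \<in> carrier A"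
  by (simp add: D_def)

lemma D_not_zero: "s \<in> D \<Longrightarrow> s \<noteq> \<zero>"
  using M.zero_closed by (auto simp: D_def)

lemma one_D [simp]: "\<one> \<in> D"
  using M.one_imp_carrier M.I_notcarr by (auto simp: D_def)

lemma mult_D [simp]: "s \<in> D \<Longrightarrow> t \<in> D \<Longrightarrow> s \<otimes> t \<in> D"
  using M.I_prime by (auto simp: D_def)

text \<open>In a domain the factor \<open>w\<close> of \<open>frac_rel\<close> is nonzero and
  cancels, so equality of fractions is plain cross multiplication.\<close>

lemma frac_rel_iff:
  "((a, s), (b, t)) \<in> frac_rel A (D) \<longleftrightarrow>
     a \<in> carrier A \<and> s \<in> D \<and> b \<in> carrier A \<and> t \<in> D \<and> t \<otimes> a = s \<otimes> b"
proof -
  have "(\<exists>w\<in>D. w \<otimes> (t \<otimes> a) = w \<otimes> (s \<otimes> b)) \<longleftrightarrow> t \<otimes> a = s \<otimes> b"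
    if "a \<in> carrier A" "s \<in> carrier A" "b \<in> carrier A" "t \<in> carrier A"
    using that m_lcancel D_carrier D_not_zero one_D by (metis m_closed)
  then show ?thesis by (auto simp: frac_rel_def)
qed

lemma cross_trans:
  assumes "a \<in> carrier A" "b \<in> carrier A" "c \<in> carrier A" "s \<in> carrier A" "t \<in> carrier A" "r \<in> carrier A"
    "t \<noteq> \<zero>" "t \<otimes> a = s \<otimes> b" "r \<otimes> b = t \<otimes> c"
  shows "r \<otimes> a = s \<otimes> c"
proof -
  have "t \<otimes> (r \<otimes> a) = r \<otimes> (t \<otimes> a)" using assms(1-6) by algebra
  also have "\<dots> = s \<otimes> (r \<otimes> b)" using assms(1-6) unfolding assms(8) by algebra
  also have "\<dots> = t \<otimes> (s \<otimes> c)" using assms(1-6) unfolding assms(9) by algebra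
  finally show ?thesis using assms by (simp add: m_lcancel)
qed

lemma equiv_frac_rel: "equiv (carrier A \<times> (D)) (frac_rel A (D))"
proof (rule equivI)
  show "frac_rel A (D) \<subseteq> (carrier A \<times> (D)) \<times> carrier A \<times> (D)"
    by (auto simp: frac_rel_def)
  show "refl_on (carrier A \<times> (D)) (frac_rel A (D))"
    by (auto simp: refl_on_def frac_rel_iff)
  show "sym (frac_rel A (D))"
    by (auto intro!: symI simp: frac_rel_iff)
  show "trans (frac_rel A (D))"
    proof (rule transI)
    fix x y z assume "(x, y) \<in> frac_rel A D" "(y, z) \<in> frac_rel A D"
    then show "(x, z) \<in> frac_rel A D"
      using cross_trans[of "fst x" "fst y" "fst z" "snd x" "snd y" "snd z"] D_not_zero
      by (cases x; cases y; cases z) (auto simp: frac_rel_iff)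
  qed
qed

lemma frac_eq_iff:
  assumes "a \<in> carrier A" "s \<in> D" "b \<in> carrier A" "t \<in> D"
  shows "frac a s = frac b t \<longleftrightarrow> t \<otimes> a = s \<otimes> b"
  unfolding frac_def using eq_equiv_class_iff[OF equiv_frac_rel, of "(a,s)" "(b,t)"] assms
  by (simp add: frac_rel_iff)

lemma mem_frac:
  assumes "a \<in> carrier A" "s \<in> D"
  shows "(b, t) \<in> frac a s \<longleftrightarrow> b \<in> carrier A \<and> t \<in> D \<and> frac b t = frac a s"
proof -
  have "(b, t) \<in> frac a s \<longleftrightarrow> ((a, s), (b, t)) \<in> frac_rel A D" by (simp add: frac_def)
  then show ?thesis using assms frac_eq_iff by (metis frac_rel_iff)
qed

lemma carrier_L: "carrier L = {frac a s | a s. a \<in> carrier A \<and> s \<in> D}"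
  by (auto simp: localization_def quotient_def frac_def D_def)

lemma frac_closed [simp]: "a \<in> carrier A \<Longrightarrow> s \<in> D \<Longrightarrow> frac a s \<in> carrier L"
  by (auto simp: carrier_L)

lemma frac_cases:
  assumes "x \<in> carrier L"
  obtains a s where "a \<in> carrier A" "s \<in> D" "x = frac a s"
  using assms by (auto simp: carrier_L)

lemma one_L: "\<one>\<^bsub>L\<^esub> = frac \<one> \<one>" and zero_L: "\<zero>\<^bsub>L\<^esub> = frac \<zero> \<one>"
  by (auto simp: localization_def frac_def D_def)

text \<open>The operations of \<open>localization\<close> are unions over all representatives. A
  value independent of the representatives makes this a union of a nonempty constant family, so only
  well-definedness remains for \<open>mult_L\<close> and \<open>add_L\<close>.\<close>

lemma frac_Union:
  assumes x: "a \<in> carrier A" "s \<in> D" and y: "b \<in> carrier A" "t \<in> D"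
    and "\<And>a' s' b' t'. \<lbrakk>a' \<in> carrier A; s' \<in> D; frac a' s' = frac a s;
            b' \<in> carrier A; t' \<in> D; frac b' t' = frac b t\<rbrakk> \<Longrightarrow> F a' s' b' t' = F a s b t"
  shows "(\<Union>(a, s)\<in>frac a s. \<Union>(b, t)\<in>frac b t. F a s b t) = F a s b t"
proof -
  have ne: "frac a s \<noteq> {}" "frac b t \<noteq> {}" using x y mem_frac by fastforce+
  have eq: "F a' s' b' t' = F a s b t" if "(a', s') \<in> frac a s" "(b', t') \<in> frac b t" for a' s' b' t'
    using mem_frac[OF x, of a' s'] mem_frac[OF y, of b' t'] that by (intro assms(5)) simp_all
  have "(\<Union>(a, s)\<in>frac a s. \<Union>(b, t)\<in>frac b t. F a s b t) = (\<Union>p\<in>frac a s. \<Union>q\<in>frac b t. F a s b t)"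
    using eq by (intro SUP_cong refl) (auto simp: split_beta)
  then show ?thesis using ne by simp
qed

lemma mult_L:
  assumes "a \<in> carrier A" "s \<in> D" "b \<in> carrier A" "t \<in> D"
  shows "frac a s \<otimes>\<^bsub>L\<^esub> frac b t = frac (a \<otimes> b) (s \<otimes> t)"
proof -
  have "frac a s \<otimes>\<^bsub>L\<^esub> frac b t = (\<Union>(a, s)\<in>frac a s. \<Union>(b, t)\<in>frac b t. frac (a \<otimes> b) (s \<otimes> t))"
    by (simp add: localization_def frac_def D_def)
  also have "\<dots> = frac (a \<otimes> b) (s \<otimes> t)"
  proof (rule frac_Union[OF assms])
    fix a' s' b' t' assume *: "a' \<in> carrier A" "s' \<in> D" "frac a' s' = frac a s"
      "b' \<in> carrier A" "t' \<in> D" "frac b' t' = frac b t"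
    then have e: "s \<otimes> a' = s' \<otimes> a" "t \<otimes> b' = t' \<otimes> b" using assms by (simp_all add: frac_eq_iff)
    have c: "s \<in> carrier A" "t \<in> carrier A" "s' \<in> carrier A" "t' \<in> carrier A" using * assms by auto
    have "(s \<otimes> t) \<otimes> (a' \<otimes> b') = (s \<otimes> a') \<otimes> (t \<otimes> b')" using * assms c by algebra
    also have "\<dots> = (s' \<otimes> t') \<otimes> (a \<otimes> b)" unfolding e using * assms c by algebra
    finally show "frac (a' \<otimes> b') (s' \<otimes> t') = frac (a \<otimes> b) (s \<otimes> t)"
      using * assms by (simp add: frac_eq_iff)
  qed
  finally show ?thesis .
qed

lemma add_L:
  assumes "a \<in> carrier A" "s \<in> D" "b \<in> carrier A" "t \<in> D"
  shows "frac a s \<oplus>\<^bsub>L\<^esub> frac b t = frac (t \<otimes> a \<oplus> s \<otimes> b) (s \<otimes> t)"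
proof -
  have "frac a s \<oplus>\<^bsub>L\<^esub> frac b t = (\<Union>(a, s)\<in>frac a s. \<Union>(b, t)\<in>frac b t. frac (t \<otimes> a \<oplus> s \<otimes> b) (s \<otimes> t))"
    by (simp add: localization_def frac_def D_def)
  also have "\<dots> = frac (t \<otimes> a \<oplus> s \<otimes> b) (s \<otimes> t)"
  proof (rule frac_Union[OF assms])
    fix a' s' b' t' assume *: "a' \<in> carrier A" "s' \<in> D" "frac a' s' = frac a s"
      "b' \<in> carrier A" "t' \<in> D" "frac b' t' = frac b t"
    then have e: "s \<otimes> a' = s' \<otimes> a" "t \<otimes> b' = t' \<otimes> b" using assms by (simp_all add: frac_eq_iff)
    have c: "s \<in> carrier A" "t \<in> carrier A" "s' \<in> carrier A" "t' \<in> carrier A" using * assms by auto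
    have "(s \<otimes> t) \<otimes> (t' \<otimes> a' \<oplus> s' \<otimes> b') = (t \<otimes> t') \<otimes> (s \<otimes> a') \<oplus> (s \<otimes> s') \<otimes> (t \<otimes> b')"
      using * assms c by algebra
    also have "\<dots> = (s' \<otimes> t') \<otimes> (t \<otimes> a \<oplus> s \<otimes> b)" unfolding e using * assms c by algebra
    finally show "frac (t' \<otimes> a' \<oplus> s' \<otimes> b') (s' \<otimes> t') = frac (t \<otimes> a \<oplus> s \<otimes> b) (s \<otimes> t)"
      using * assms by (simp add: frac_eq_iff)
  qed
  finally show ?thesis .
qed

lemma cring_L: "cring L"
proof (rule cringI)
  show "abelian_group L"
  proof (rule abelian_groupI)
    fix x y z assume "x \<in> carrier L" "y \<in> carrier L" "z \<in> carrier L"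
    from this(1) obtain a s where x: "a \<in> carrier A" "s \<in> D" "x = frac a s" by (rule frac_cases)
    from \<open>y \<in> carrier L\<close> obtain b t where y: "b \<in> carrier A" "t \<in> D" "y = frac b t" by (rule frac_cases)
    from \<open>z \<in> carrier L\<close> obtain c r where "c \<in> carrier A" "r \<in> D" "z = frac c r" by (rule frac_cases)
    note xyz = x y this
    then have c: "s \<in> carrier A" "t \<in> carrier A" "r \<in> carrier A" by auto
    show "x \<oplus>\<^bsub>L\<^esub> y \<in> carrier L" using xyz by (simp add: add_L)
    have "(r \<otimes> (t \<otimes> a \<oplus> s \<otimes> b) \<oplus> (s \<otimes> t) \<otimes> c) = ((t \<otimes> r) \<otimes> a \<oplus> s \<otimes> (r \<otimes> b \<oplus> t \<otimes> c))"
      using xyz c by algebra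
    then show "x \<oplus>\<^bsub>L\<^esub> y \<oplus>\<^bsub>L\<^esub> z = x \<oplus>\<^bsub>L\<^esub> (y \<oplus>\<^bsub>L\<^esub> z)"
      using xyz by (simp add: add_L m_assoc)
    show "x \<oplus>\<^bsub>L\<^esub> y = y \<oplus>\<^bsub>L\<^esub> x"
      using xyz by (simp add: add_L a_comm m_comm)
    show "\<zero>\<^bsub>L\<^esub> \<oplus>\<^bsub>L\<^esub> x = x" using xyz by (simp add: add_L zero_L)
    have "t \<otimes> b = t \<otimes> b" by simp
    have "s \<otimes> \<ominus> a \<oplus> s \<otimes> a = \<zero>" using xyz c by algebra
    then show "\<exists>y\<in>carrier L. y \<oplus>\<^bsub>L\<^esub> x = \<zero>\<^bsub>L\<^esub>"
      using xyz by (intro bexI[of _ "frac (\<ominus> a) s"]) (auto simp: add_L zero_L frac_eq_iff)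
  qed (simp add: zero_L)
  show "comm_monoid L"
  proof (rule comm_monoidI)
    fix x y z assume "x \<in> carrier L" "y \<in> carrier L" "z \<in> carrier L"
    from this(1) obtain a s where x: "a \<in> carrier A" "s \<in> D" "x = frac a s" by (rule frac_cases)
    from \<open>y \<in> carrier L\<close> obtain b t where y: "b \<in> carrier A" "t \<in> D" "y = frac b t" by (rule frac_cases)
    from \<open>z \<in> carrier L\<close> obtain c r where "c \<in> carrier A" "r \<in> D" "z = frac c r" by (rule frac_cases)
    note xyz = x y this
    then have c: "s \<in> carrier A" "t \<in> carrier A" "r \<in> carrier A" by auto
    show "x \<otimes>\<^bsub>L\<^esub> y \<in> carrier L" using xyz by (simp add: mult_L)
    show "x \<otimes>\<^bsub>L\<^esub> y \<otimes>\<^bsub>L\<^esub> z = x \<otimes>\<^bsub>L\<^esub> (y \<otimes>\<^bsub>L\<^esub> z)" using xyz by (simp add: mult_L m_assoc)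
    show "x \<otimes>\<^bsub>L\<^esub> y = y \<otimes>\<^bsub>L\<^esub> x" using xyz by (simp add: mult_L m_comm)
    show "\<one>\<^bsub>L\<^esub> \<otimes>\<^bsub>L\<^esub> x = x" using xyz by (simp add: mult_L one_L)
  qed (simp add: one_L)
    fix x y z assume "x \<in> carrier L" "y \<in> carrier L" "z \<in> carrier L"
    from this(1) obtain a s where x: "a \<in> carrier A" "s \<in> D" "x = frac a s" by (rule frac_cases)
    from \<open>y \<in> carrier L\<close> obtain b t where y: "b \<in> carrier A" "t \<in> D" "y = frac b t" by (rule frac_cases)
    from \<open>z \<in> carrier L\<close> obtain c r where "c \<in> carrier A" "r \<in> D" "z = frac c r" by (rule frac_cases)
    note xyz = x y this
    then have c: "s \<in> carrier A" "t \<in> carrier A" "r \<in> carrier A" by auto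
  have "((s \<otimes> r) \<otimes> (t \<otimes> r)) \<otimes> ((t \<otimes> a \<oplus> s \<otimes> b) \<otimes> c)
      = ((s \<otimes> t) \<otimes> r) \<otimes> ((t \<otimes> r) \<otimes> (a \<otimes> c) \<oplus> (s \<otimes> r) \<otimes> (b \<otimes> c))"
    using xyz c by algebra
  then show "(x \<oplus>\<^bsub>L\<^esub> y) \<otimes>\<^bsub>L\<^esub> z = x \<otimes>\<^bsub>L\<^esub> z \<oplus>\<^bsub>L\<^esub> y \<otimes>\<^bsub>L\<^esub> z"
    using xyz by (simp add: add_L mult_L frac_eq_iff)
qed

sublocale L: cring L by (rule cring_L)

lemma frac_Units: "frac a s \<in> Units L" if "a \<in> D" "s \<in> D"
proof -
  have "frac a s \<otimes>\<^bsub>L\<^esub> frac s a = \<one>\<^bsub>L\<^esub>"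
    using that by (simp add: mult_L one_L frac_eq_iff m_comm)
  moreover have "frac s a \<otimes>\<^bsub>L\<^esub> frac a s = \<one>\<^bsub>L\<^esub>"
    using that by (simp add: mult_L one_L frac_eq_iff m_comm)
  ultimately show ?thesis
    unfolding Units_def using frac_closed[of a s] frac_closed[of s a] that D_carrier by blast
qed

lemma frac_Units_iff:
  assumes "a \<in> carrier A" "s \<in> D"
  shows "frac a s \<in> Units L \<longleftrightarrow> a \<notin> M"
proof
  assume "frac a s \<in> Units L"
  then obtain y where y: "y \<in> carrier L" "frac a s \<otimes>\<^bsub>L\<^esub> y = \<one>\<^bsub>L\<^esub>" by (auto simp: Units_def)
  from y(1) obtain b t where b: "b \<in> carrier A" "t \<in> D" "y = frac b t" by (rule frac_cases)
  then have "a \<otimes> b = s \<otimes> t" using assms y(2)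
    by (simp add: mult_L one_L frac_eq_iff)
  then show "a \<notin> M" using assms b mult_D[of s t] M.I_r_closed[of a b] by (auto simp: D_def)
qed (use assms frac_Units mem_D_iff in simp)

lemma frac_mult_denom:
  assumes "a \<in> carrier A" "s \<in> D"
  shows "frac s \<one> \<otimes>\<^bsub>L\<^esub> frac a s = frac a \<one>" "frac \<one> s \<otimes>\<^bsub>L\<^esub> frac a \<one> = frac a s"
  using assms by (simp_all add: mult_L frac_eq_iff)

lemma contract_prime:
  assumes Q: "primeideal Q L"
  shows "primeideal {a \<in> carrier A. frac a \<one> \<in> Q} A"
proof -
  interpret Q: primeideal Q L by fact
  have add1: "frac (a \<oplus> b) \<one> = frac a \<one> \<oplus>\<^bsub>L\<^esub> frac b \<one>" if "a \<in> carrier A" "b \<in> carrier A" for a b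
    using that by (simp add: add_L)
  have mul1: "frac (a \<otimes> b) \<one> = frac a \<one> \<otimes>\<^bsub>L\<^esub> frac b \<one>" if "a \<in> carrier A" "b \<in> carrier A" for a b
    using that by (simp add: mult_L)
  show ?thesis
  proof (rule primeidealI)
    show "ideal {a \<in> carrier A. frac a \<one> \<in> Q} A"
    proof (rule idealI_closed)
      show "\<zero> \<in> {a \<in> carrier A. frac a \<one> \<in> Q}" using Q.zero_closed by (simp add: zero_L)
    qed (auto simp: add1 mul1 intro!: Q.a_closed Q.I_l_closed)
    have "\<one> \<notin> {a \<in> carrier A. frac a \<one> \<in> Q}" using Q.one_imp_carrier Q.I_notcarr by (auto simp: one_L)
    then show "carrier A \<noteq> {a \<in> carrier A. frac a \<one> \<in> Q}" by blast
  qed (use Q.I_prime in \<open>auto simp: mul1 is_cring\<close>)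
qed

text \<open>\<open>a / s\<close> and \<open>a / 1\<close> differ by the unit \<open>s / 1\<close>,
  so membership depends on the numerator alone.\<close>

lemma mem_prime_L_iff:
  assumes "primeideal Q L" "a \<in> carrier A" "s \<in> D"
  shows "frac a s \<in> Q \<longleftrightarrow> frac a \<one> \<in> Q"
proof -
  interpret Q: primeideal Q L by fact
  show ?thesis
    using Q.I_l_closed[of "frac a s" "frac s \<one>"] Q.I_l_closed[of "frac a \<one>" "frac \<one> s"]
      assms frac_mult_denom[OF assms(2,3)] by auto
qed

lemma contract_strict:
  assumes "primeideal Q L" "primeideal Q' L" "Q \<subset> Q'"
  shows "{a \<in> carrier A. frac a \<one> \<in> Q} \<subset> {a \<in> carrier A. frac a \<one> \<in> Q'}"
proof -
  obtain x where x: "x \<in> Q'" "x \<notin> Q" using assms by blast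
  then have "x \<in> carrier L" using assms(2) ideal.Icarr primeideal.axioms(1) by metis
  then obtain a s where "a \<in> carrier A" "s \<in> D" "x = frac a s" by (rule frac_cases)
  then have "a \<in> {a \<in> carrier A. frac a \<one> \<in> Q'} - {a \<in> carrier A. frac a \<one> \<in> Q}"
    using x assms mem_prime_L_iff by blast
  then show ?thesis using assms(3) by blast
qed

text \<open>A fraction in this set may have other representatives with numerator outside
  \<open>P\<close>; for a prime inside \<open>M\<close> this does not occur, by
  \<open>mem_extend_iff\<close>.\<close>

definition extend where "extend P = {frac a s | a s. a \<in> P \<and> s \<in> D}"

lemma extendI: "a \<in> P \<Longrightarrow> s \<in> D \<Longrightarrow> frac a s \<in> extend P"
  by (auto simp: extend_def)

lemma mem_extend_iff:
  assumes "primeideal P A" "P \<subseteq> M" "a \<in> carrier A" "s \<in> D"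
  shows "frac a s \<in> extend P \<longleftrightarrow> a \<in> P"
proof
  interpret P: primeideal P A by fact
  assume "frac a s \<in> extend P"
  then obtain b t where bt: "b \<in> P" "t \<in> D" "frac a s = frac b t" by (auto simp: extend_def)
  then have "t \<otimes> a = s \<otimes> b" using assms by (simp add: frac_eq_iff P.Icarr)
  then have "t \<otimes> a \<in> P" using bt assms P.I_l_closed by auto
  then show "a \<in> P" using P.I_prime[of t a] bt assms by (auto simp: D_def)
qed (use assms in \<open>auto simp: extend_def\<close>)

lemma extend_prime:
  assumes P: "primeideal P A" "P \<subseteq> M"
  shows "primeideal (extend P) L"
proof -
  interpret P: primeideal P A by fact
  show ?thesis
  proof (rule primeidealI)
    show "ideal (extend P) L"
    proof (rule L.idealI_closed)
      show "extend P \<subseteq> carrier L" by (auto simp: extend_def P.Icarr)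
      show "\<zero>\<^bsub>L\<^esub> \<in> extend P" using P.zero_closed one_D unfolding zero_L extend_def by blast
    next
      fix x y assume "x \<in> extend P" "y \<in> extend P"
      then obtain a s b t where "a \<in> P" "s \<in> D" "x = frac a s"
        "b \<in> P" "t \<in> D" "y = frac b t" by (auto simp: extend_def)
      moreover from this have "t \<otimes> a \<oplus> s \<otimes> b \<in> P" by (auto intro!: P.a_closed P.I_l_closed)
      ultimately show "x \<oplus>\<^bsub>L\<^esub> y \<in> extend P"
        by (simp add: extendI add_L P.Icarr)
    next
      fix x y assume "x \<in> extend P" "y \<in> carrier L"
      then obtain a s b t where "a \<in> P" "s \<in> D" "x = frac a s"
        "b \<in> carrier A" "t \<in> D" "y = frac b t" by (auto simp: extend_def carrier_L)
      then show "y \<otimes>\<^bsub>L\<^esub> x \<in> extend P"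
        using P.I_l_closed by (simp add: extendI mult_L P.Icarr)
    qed
    have "\<one>\<^bsub>L\<^esub> \<notin> extend P"
      using P P.one_imp_carrier P.I_notcarr by (auto simp: one_L mem_extend_iff)
    then show "carrier L \<noteq> extend P" by blast
  next
    fix x y assume xy: "x \<in> carrier L" "y \<in> carrier L" "x \<otimes>\<^bsub>L\<^esub> y \<in> extend P"
    from xy(1) obtain a s where x: "a \<in> carrier A" "s \<in> D" "x = frac a s" by (rule frac_cases)
    from xy(2) obtain b t where "b \<in> carrier A" "t \<in> D" "y = frac b t" by (rule frac_cases)
    note * = x this
    then have "a \<otimes> b \<in> P" using xy P by (auto simp: mult_L mem_extend_iff)
    then show "x \<in> extend P \<or> y \<in> extend P" using * P P.I_prime by (auto simp: mem_extend_iff)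
  qed (rule cring_L)
qed

text \<open>Contraction turns a chain of primes of \<open>L\<close> into a chain of primes of
  \<open>A\<close> of the same length.\<close>

lemma krull_dim_L_le:
  assumes "\<nexists>P. (\<forall>i\<le>Suc k. primeideal (P i) A) \<and> (\<forall>i<Suc k. P i \<subset> P (Suc i))"
  shows "krull_dim L \<le> enat k"
  unfolding krull_dim_def
proof (rule SUP_least, clarsimp)
  fix l and Q :: "nat \<Rightarrow> ('a \<times> 'a) set set"
  assume Q: "\<forall>i\<le>l. primeideal (Q i) L" "\<forall>i<l. Q i \<subset> Q (Suc i)"
  show "l \<le> k"
  proof (rule ccontr)
    let ?P = "\<lambda>i. {a \<in> carrier A. frac a \<one> \<in> Q i}"
    assume "\<not> l \<le> k"
    then have l: "Suc k \<le> l" by simp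
    have "primeideal (?P i) A" if "i \<le> Suc k" for i
      by (rule contract_prime) (use Q l that in simp)
    moreover have "?P i \<subset> ?P (Suc i)" if "i < Suc k" for i
      by (rule contract_strict) (use Q l that in simp_all)
    ultimately have "(\<forall>i\<le>Suc k. primeideal (?P i) A) \<and> (\<forall>i<Suc k. ?P i \<subset> ?P (Suc i))" by blast
    with assms show False by (rule notE[OF _ exI[of _ ?P]])
  qed
qed

text \<open>Extension keeps inclusions strict because a prime inside \<open>M\<close> is recovered
  from the numerators of its extension.\<close>

lemma krull_dim_L_ge:
  assumes P: "\<And>i. i \<le> k \<Longrightarrow> primeideal (P i) A" "\<And>i. i < k \<Longrightarrow> P i \<subset> P (Suc i)"
    and "P k \<subseteq> M"
  shows "enat k \<le> krull_dim L"
proof -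
  have sub: "P i \<subseteq> M" if "i \<le> k" for i
    using that
  proof (induction rule: inc_induct)
    case (step n)
    then show ?case using P(2) by blast
  qed (rule assms)
  have "extend (P i) \<subset> extend (P (Suc i))" if i: "i < k" for i
  proof -
    obtain a where a: "a \<in> P (Suc i)" "a \<notin> P i" using P(2)[OF i] by blast
    have pr: "primeideal (P i) A" "primeideal (P (Suc i)) A" using that by (simp_all add: P(1))
    interpret I: primeideal "P (Suc i)" A by (rule pr)
    have "a \<in> carrier A" using a(1) by (rule I.Icarr)
    then have "frac a \<one> \<in> extend (P (Suc i)) - extend (P i)"
      using a pr sub[of i] sub[of "Suc i"] that by (simp add: mem_extend_iff)
    moreover have "extend (P i) \<subseteq> extend (P (Suc i))" using P(2)[OF that] by (auto simp: extend_def)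
    ultimately show ?thesis by blast
  qed
  then have "(\<forall>i\<le>k. primeideal (extend (P i)) L) \<and> (\<forall>i<k. extend (P i) \<subset> extend (P (Suc i)))"
    using extend_prime P(1) sub by simp
  then show ?thesis
    unfolding krull_dim_def by (intro SUP_upper CollectI exI[of _ "\<lambda>i. extend (P i)"])
qed

lemma Idl_empty_L: "Idl\<^bsub>L\<^esub> {} = {\<zero>\<^bsub>L\<^esub>}"
  using L.genideal_minimal[OF L.zeroideal, of "{}"] L.genideal_ideal[of "{}"]
    additive_subgroup.zero_closed[OF ideal.axioms(1)] by blast

lemma mem_Idl_singleton_L_iff:
  assumes "x \<in> carrier L"
  shows "y \<in> Idl\<^bsub>L\<^esub> {x} \<longleftrightarrow> (\<exists>c\<in>carrier L. y = c \<otimes>\<^bsub>L\<^esub> x)"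
  unfolding L.cgenideal_eq_genideal[OF assms, symmetric] by (auto simp: cgenideal_def)

lemma frac_eq_zero_iff: "a \<in> carrier A \<Longrightarrow> s \<in> D \<Longrightarrow> frac a s = \<zero>\<^bsub>L\<^esub> \<longleftrightarrow> a = \<zero>"
  by (simp add: zero_L frac_eq_iff)

text \<open>In a domain \<open>x\<close> is a nonzerodivisor at once. For \<open>y\<close> modulo
  \<open>x\<close> the denominators of the relation are cleared, the hypothesis on \<open>A\<close>
  is applied, and the resulting multiple of \<open>x\<close> is divided by the denominators
  again.\<close>

lemma local_depth_L_ge_2:
  assumes x: "x \<in> M" "x \<noteq> \<zero>" and y: "y \<in> M"
    and reg: "\<And>f g. \<lbrakk>f \<in> carrier A; g \<in> carrier A; y \<otimes> f = x \<otimes> g\<rbrakk> \<Longrightarrow> \<exists>h\<in>carrier A. f = x \<otimes> h"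
  shows "enat 2 \<le> local_depth L"
proof -
  let ?x = "frac x \<one>" and ?y = "frac y \<one>"
  have xy: "x \<in> carrier A" "y \<in> carrier A" using x y M.Icarr by auto
  have reg0: "a = \<zero>\<^bsub>L\<^esub>" if "a \<in> carrier L" "?x \<otimes>\<^bsub>L\<^esub> a = \<zero>\<^bsub>L\<^esub>" for a
  proof -
    from that(1) obtain f s where f: "f \<in> carrier A" "s \<in> D" "a = frac f s" by (rule frac_cases)
    then have "x \<otimes> f = \<zero>" using that(2) xy by (simp add: mult_L frac_eq_zero_iff)
    then show ?thesis using f x xy integral frac_eq_zero_iff by blast
  qed
  have reg1: "a \<in> Idl\<^bsub>L\<^esub> {?x}" if a: "a \<in> carrier L" "?y \<otimes>\<^bsub>L\<^esub> a \<in> Idl\<^bsub>L\<^esub> {?x}" for a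
  proof -
    from a(1) obtain f s where f: "f \<in> carrier A" "s \<in> D" "a = frac f s" by (rule frac_cases)
    obtain c where c: "c \<in> carrier L" "?y \<otimes>\<^bsub>L\<^esub> a = c \<otimes>\<^bsub>L\<^esub> ?x"
      using a xy by (auto simp: mem_Idl_singleton_L_iff)
    from c(1) obtain g t where g: "g \<in> carrier A" "t \<in> D" "c = frac g t" by (rule frac_cases)
    have e: "t \<otimes> (y \<otimes> f) = s \<otimes> (g \<otimes> x)"
      using c(2) f g xy by (simp add: mult_L frac_eq_iff)
    have st: "s \<in> carrier A" "t \<in> carrier A" using f g by auto
    have "y \<otimes> (t \<otimes> f) = t \<otimes> (y \<otimes> f)" using f(1) xy st by algebra
    also have "\<dots> = x \<otimes> (s \<otimes> g)" unfolding e using g(1) xy st by algebra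
    finally have "y \<otimes> (t \<otimes> f) = x \<otimes> (s \<otimes> g)" .
    then obtain h where h: "h \<in> carrier A" "t \<otimes> f = x \<otimes> h"
      using reg[of "t \<otimes> f" "s \<otimes> g"] f g by auto
    have "(t \<otimes> s) \<otimes> f = s \<otimes> (t \<otimes> f)" using f(1) st by algebra
    also have "\<dots> = s \<otimes> (h \<otimes> x)" using h xy by (simp add: m_comm)
    finally have "(t \<otimes> s) \<otimes> f = s \<otimes> (h \<otimes> x)" .
    then have "a = frac h (t \<otimes> s) \<otimes>\<^bsub>L\<^esub> ?x"
      using f g h xy by (simp add: mult_L frac_eq_iff)
    then show ?thesis using f g h xy by (auto simp: mem_Idl_singleton_L_iff)
  qed
  have "regular_sequence L [?x, ?y]"
    unfolding regular_sequence_def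
  proof (intro conjI allI impI ballI)
    show "set [?x, ?y] \<subseteq> carrier L" using xy by simp
    show "a \<in> Idl\<^bsub>L\<^esub> (set (take i [?x, ?y]))"
      if i: "i < length [?x, ?y]" and "a \<in> carrier L" "[?x, ?y] ! i \<otimes>\<^bsub>L\<^esub> a \<in> Idl\<^bsub>L\<^esub> (set (take i [?x, ?y]))"
      for i a
    proof -
      consider "i = 0" | "i = 1" using i by fastforce
      then show ?thesis using that(2,3) reg0 reg1 by cases (simp_all add: Idl_empty_L)
    qed
    interpret E: primeideal "extend M" L using extend_prime prime_M by blast
    have "Idl\<^bsub>L\<^esub> (set [?x, ?y]) \<subseteq> extend M"
      using x y by (intro L.genideal_minimal E.is_ideal) (simp add: extendI)
    then show "Idl\<^bsub>L\<^esub> (set [?x, ?y]) \<noteq> carrier L"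
      using E.I_notcarr E.a_subset by blast
  qed
  moreover have "set [?x, ?y] \<subseteq> carrier L - Units L"
    using xy x y by (simp add: frac_Units_iff)
  ultimately show ?thesis
    unfolding local_depth_def by (intro SUP_upper2[of "[?x, ?y]"]) auto
qed

text \<open>The pair \<open>w\<close>, \<open>z\<close> stands for a fraction \<open>w / z\<close> outside the local ring that \<open>M\<close>
  multiplies into it.\<close>

lemma local_depth_L_le_1:
  assumes wz: "w \<in> carrier A" "z \<in> carrier A" "z \<noteq> \<zero>"
    and in_M: "\<And>m. m \<in> M \<Longrightarrow> \<exists>k\<in>carrier A. m \<otimes> w = z \<otimes> k"
    and notin_M: "\<And>g k. \<lbrakk>g \<in> D; k \<in> carrier A\<rbrakk> \<Longrightarrow> g \<otimes> w \<noteq> z \<otimes> k"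
  shows "local_depth L \<le> enat 1"
  unfolding local_depth_def
proof (rule SUP_least, rule ccontr)
  fix xs assume xs: "xs \<in> {xs. regular_sequence L xs \<and> set xs \<subseteq> carrier L - Units L}"
    and "\<not> enat (length xs) \<le> enat 1"
  then have len: "2 \<le> length xs" by auto
  then have mem: "xs ! 0 \<in> set xs" "xs ! 1 \<in> set xs" by (intro nth_mem; linarith)+
  have reg: "a \<in> Idl\<^bsub>L\<^esub> (set (take i xs))"
    if "i < length xs" "a \<in> carrier L" "xs ! i \<otimes>\<^bsub>L\<^esub> a \<in> Idl\<^bsub>L\<^esub> (set (take i xs))" for i a
    using xs that by (auto simp: regular_sequence_def)
  have take1: "set (take 1 xs) = {xs ! 0}" using len by (cases xs) auto
  have "xs ! 0 \<in> carrier L" "xs ! 1 \<in> carrier L" using xs mem by auto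
  from this(1) obtain x s where x: "x \<in> carrier A" "s \<in> D" "xs ! 0 = frac x s" by (rule frac_cases)
  from \<open>xs ! 1 \<in> carrier L\<close> obtain y t where y: "y \<in> carrier A" "t \<in> D" "xs ! 1 = frac y t"
    by (rule frac_cases)
  have st: "s \<in> carrier A" "t \<in> carrier A" using x y by auto
  have "frac x s \<notin> Units L" "frac y t \<notin> Units L" using xs mem x y by auto
  then have M: "x \<in> M" "y \<in> M" using x y frac_Units_iff by auto
  have "x \<noteq> \<zero>"
  proof
    assume "x = \<zero>"
    then have "xs ! 0 \<otimes>\<^bsub>L\<^esub> \<one>\<^bsub>L\<^esub> \<in> Idl\<^bsub>L\<^esub> (set (take 0 xs))"
      using x by (simp add: Idl_empty_L frac_eq_zero_iff[THEN iffD2])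
    then have "\<one>\<^bsub>L\<^esub> \<in> Idl\<^bsub>L\<^esub> (set (take 0 xs))" using reg[of 0 "\<one>\<^bsub>L\<^esub>"] len by (cases xs) auto
    then show False by (simp add: Idl_empty_L one_L frac_eq_zero_iff)
  qed
  \<comment> \<open>\<open>x'\<close> and \<open>y'\<close> play the part of \<open>x w / z\<close>
    and \<open>y w / z\<close>, whence \<open>y x' = x y'\<close>: modulo the first entry, the
    second one kills \<open>x'\<close>.\<close>
  obtain x' where x': "x' \<in> carrier A" "x \<otimes> w = z \<otimes> x'" using in_M M by blast
  obtain y' where y': "y' \<in> carrier A" "y \<otimes> w = z \<otimes> y'" using in_M M by blast
  have "z \<otimes> (y \<otimes> x') = y \<otimes> (x \<otimes> w)" unfolding x'(2) using wz y(1) x'(1) by algebra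
  also have "\<dots> = x \<otimes> (y \<otimes> w)" using wz x(1) y(1) by algebra
  also have "\<dots> = z \<otimes> (x \<otimes> y')" unfolding y'(2) using wz x(1) y(1) y'(1) by algebra
  finally have e: "y \<otimes> x' = x \<otimes> y'" using wz x x' y y' by (simp add: m_lcancel)
  have "(s \<otimes> t) \<otimes> (y \<otimes> x') = t \<otimes> ((s \<otimes> y') \<otimes> x)"
    unfolding e using st x(1) y'(1) by algebra
  then have "xs ! 1 \<otimes>\<^bsub>L\<^esub> frac x' \<one> = frac (s \<otimes> y') t \<otimes>\<^bsub>L\<^esub> xs ! 0"
    using x y x' y' st by (simp add: mult_L frac_eq_iff m_comm[of t s])
  then have "xs ! 1 \<otimes>\<^bsub>L\<^esub> frac x' \<one> \<in> Idl\<^bsub>L\<^esub> (set (take 1 xs))"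
    unfolding take1 using x y y' by (auto simp: mem_Idl_singleton_L_iff)
  then have "frac x' \<one> \<in> Idl\<^bsub>L\<^esub> {xs ! 0}" using reg[of 1 "frac x' \<one>"] len x' take1 by simp
  then obtain c where c: "c \<in> carrier L" "frac x' \<one> = c \<otimes>\<^bsub>L\<^esub> frac x s"
    using x by (auto simp: mem_Idl_singleton_L_iff)
  from c(1) obtain g r where g: "g \<in> carrier A" "r \<in> D" "c = frac g r" by (rule frac_cases)
  then have e2: "(r \<otimes> s) \<otimes> x' = g \<otimes> x" using c(2) x x' by (simp add: mult_L frac_eq_iff)
  have rc: "r \<in> carrier A" using g by auto
  \<comment> \<open>Regularity has made \<open>x'\<close> a multiple of the first entry; cancelling
    \<open>x\<close> would now turn \<open>w / z\<close> into \<open>g / (r s)\<close>, an element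
    of \<open>L\<close>.\<close>
  have "x \<otimes> ((r \<otimes> s) \<otimes> w) = (r \<otimes> s) \<otimes> (x \<otimes> w)" using x(1) rc st wz by algebra
  also have "\<dots> = z \<otimes> ((r \<otimes> s) \<otimes> x')" unfolding x'(2) using x'(1) rc st wz by algebra
  also have "\<dots> = x \<otimes> (z \<otimes> g)" unfolding e2 using x(1) g(1) wz by algebra
  finally have "(r \<otimes> s) \<otimes> w = z \<otimes> g" using x(1) g(1) rc st wz \<open>x \<noteq> \<zero>\<close> by (simp add: m_lcancel)
  then show False using notin_M[of "r \<otimes> s" g] g x by simp
qed

end

section \<open>Criteria for a domain to be or not to be Cohen-Macaulay\<close>

theorem (in domain) cohen_macaulayI:
  assumes noeth: "noetherian_ring R"
    and dim: "\<nexists>P. (\<forall>i\<le>3. primeideal (P i) R) \<and> (\<forall>i<3::nat. P i \<subset> P (Suc i))"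
    and depth: "\<And>M. maximalideal M R \<Longrightarrow> \<exists>x\<in>M. \<exists>y\<in>M. x \<noteq> \<zero> \<and>
        (\<forall>f\<in>carrier R. \<forall>g\<in>carrier R. y \<otimes> f = x \<otimes> g \<longrightarrow> (\<exists>h\<in>carrier R. f = x \<otimes> h))"
  shows "cohen_macaulay R"
  unfolding cohen_macaulay_def
proof (intro conjI allI impI)
  fix M assume M: "maximalideal M R"
  interpret domain_prime R M
    by (intro domain_prime.intro domain_prime_axioms.intro domain_axioms maximalideal_prime[OF M])
  obtain x y where xy: "x \<in> M" "y \<in> M" "x \<noteq> \<zero>"
    and reg: "\<forall>f\<in>carrier R. \<forall>g\<in>carrier R. y \<otimes> f = x \<otimes> g \<longrightarrow> (\<exists>h\<in>carrier R. f = x \<otimes> h)"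
    using depth[OF M] by blast
  have "enat 2 \<le> local_depth L"
    by (rule local_depth_L_ge_2[OF xy(1,3,2)]) (use reg in blast)
  moreover have "local_depth L \<le> krull_dim L" by (rule L.local_depth_le_krull_dim)
  moreover have "krull_dim L \<le> enat 2" using dim by (intro krull_dim_L_le) (simp add: numeral_3_eq_3)
  ultimately show "local_depth L = krull_dim L" by (meson order_antisym order_trans)
qed (use noeth in \<open>auto intro: is_cring\<close>)

text \<open>The chain from zero through \<open>P\<close> to \<open>M\<close> gives dimension at
  least 2 at \<open>M\<close>, while the fraction \<open>w / z\<close> keeps the depth there at 1 or
  below.\<close>

theorem (in domain) not_cohen_macaulayI:
  assumes M: "maximalideal M R" and P: "primeideal P R" "P \<noteq> {\<zero>}" "P \<subset> M"
    and wz: "w \<in> carrier R" "z \<in> carrier R" "z \<noteq> \<zero>"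
    and in_M: "\<And>m. m \<in> M \<Longrightarrow> \<exists>k\<in>carrier R. m \<otimes> w = z \<otimes> k"
    and notin_M: "\<And>g k. \<lbrakk>g \<in> carrier R - M; k \<in> carrier R\<rbrakk> \<Longrightarrow> g \<otimes> w \<noteq> z \<otimes> k"
  shows "\<not> cohen_macaulay R"
proof
  assume CM: "cohen_macaulay R"
  interpret domain_prime R M
    by (intro domain_prime.intro domain_prime_axioms.intro domain_axioms maximalideal_prime[OF M])
  let ?P = "\<lambda>i::nat. if i = 0 then {\<zero>} else if i = 1 then P else M"
  interpret P: primeideal P R by fact
  have "enat 2 \<le> krull_dim L"
  proof (rule krull_dim_L_ge[where P = ?P])
    show "primeideal (?P i) R" for i using P zeroprimeideal prime_M by simp
    show "?P i \<subset> ?P (Suc i)" if "i < 2" for i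
      using that P P.zero_closed by (auto simp: less_2_cases_iff)
  qed simp
  moreover have "local_depth L \<le> enat 1"
    using wz in_M notin_M by (intro local_depth_L_le_1) (auto simp: D_def)
  moreover have "local_depth L = krull_dim L" using CM M by (simp add: cohen_macaulay_def)
  ultimately have "enat 2 \<le> enat 1" by (metis order_trans)
  then show False by simp
qed

section \<open>Subalgebras of a domain\<close>

text \<open>Places a subset of a type-class ring under the carrier-based theory: arithmetic stays
  with the type class, while ideals and localizations refer to \<open>ring_on A\<close>.\<close>

definition ring_on :: "'u::comm_ring_1 set \<Rightarrow> 'u ring" where
  "ring_on A = \<lparr>carrier = A, monoid.mult = (*), one = 1, ring.zero = 0, add = (+)\<rparr>"

lemma ring_on_simps [simp]:
  "carrier (ring_on A) = A" "monoid.mult (ring_on A) = (*)" "one (ring_on A) = 1"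
  "ring.zero (ring_on A) = 0" "add (ring_on A) = (+)"
  by (simp_all add: ring_on_def)

text \<open>\<open>C\<close> embeds the scalars. The inductive form lets a linear statement be
  proved by adding one term at a time.\<close>

inductive_set lin_span :: "('k \<Rightarrow> 'u::comm_ring_1) \<Rightarrow> 'u set \<Rightarrow> 'u set" for C B where
  zero: "0 \<in> lin_span C B"
| step: "b \<in> B \<Longrightarrow> v \<in> lin_span C B \<Longrightarrow> C c * b + v \<in> lin_span C B"

locale subalgebra =
  fixes A :: "'u::idom set" and C :: "'k::field \<Rightarrow> 'u"
  assumes C_add: "C (a + b) = C a + C b" and C_mult: "C (a * b) = C a * C b"
    and C_one [simp]: "C 1 = 1" and C_in [simp]: "C a \<in> A"
    and add_in [simp]: "f \<in> A \<Longrightarrow> g \<in> A \<Longrightarrow> f + g \<in> A"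
    and mult_in [simp]: "f \<in> A \<Longrightarrow> g \<in> A \<Longrightarrow> f * g \<in> A"
begin

lemma C_zero [simp]: "C 0 = 0"
  using C_add[of 0 0] by (metis add.right_neutral add_left_cancel)

lemma C_uminus: "C (- a) = - C a"
  using C_add[of a "- a"] by (simp add: eq_neg_iff_add_eq_0 add.commute)

lemma one_in [simp]: "1 \<in> A"
  using C_in[of 1] by simp

lemma zero_in [simp]: "0 \<in> A"
  using C_in[of 0] by simp

lemma uminus_in [simp]: "f \<in> A \<Longrightarrow> - f \<in> A"
  using mult_in[OF C_in[of "- 1"], of f] by (simp add: C_uminus)

lemma diff_in [simp]: "f \<in> A \<Longrightarrow> g \<in> A \<Longrightarrow> f - g \<in> A"
  using add_in[of f "- g"] by simp

lemma power_in [simp]: "f \<in> A \<Longrightarrow> f ^ n \<in> A"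
  by (induction n) auto

lemma sum_in: "(\<And>t. t \<in> T \<Longrightarrow> g t \<in> A) \<Longrightarrow> sum g T \<in> A"
  by (induction T rule: infinite_finite_induct) auto

lemma cring_ring_on: "cring (ring_on A)"
proof (rule cringI)
  show "abelian_group (ring_on A)"
  proof (rule abelian_groupI)
    show "\<exists>y\<in>carrier (ring_on A). y \<oplus>\<^bsub>ring_on A\<^esub> x = \<zero>\<^bsub>ring_on A\<^esub>" if "x \<in> carrier (ring_on A)" for x
      using that by (intro bexI[of _ "- x"]) auto
  qed (auto simp: algebra_simps)
  show "comm_monoid (ring_on A)"
    by (rule comm_monoidI) (auto simp: algebra_simps)
qed (auto simp: algebra_simps)

lemma domain_ring_on: "domain (ring_on A)"
  using cring_ring_on by (simp add: domain_def domain_axioms_def)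

end

locale subalgebra_ideal = subalgebra A C for A :: "'u::idom set" and C :: "'k::field \<Rightarrow> 'u" +
  fixes I :: "'u set"
  assumes ideal: "ideal I (ring_on A)"
begin

sublocale I: ideal I "ring_on A" by (rule ideal)

lemma I_in: "f \<in> I \<Longrightarrow> f \<in> A"
  using I.Icarr by simp

lemma I_zero [simp]: "0 \<in> I"
  using additive_subgroup.zero_closed[OF ideal.axioms(1)[OF ideal]] by simp

lemma I_add: "f \<in> I \<Longrightarrow> g \<in> I \<Longrightarrow> f + g \<in> I"
  using additive_subgroup.a_closed[OF ideal.axioms(1)[OF ideal]] by simp

lemma I_mult: "f \<in> A \<Longrightarrow> g \<in> I \<Longrightarrow> f * g \<in> I"
  using I.I_l_closed by simp

lemma I_uminus: "f \<in> I \<Longrightarrow> - f \<in> I"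
  using I_mult[of "- 1" f] by simp

lemma I_diff: "f \<in> I \<Longrightarrow> g \<in> I \<Longrightarrow> f - g \<in> I"
  using I_add[of f "- g"] I_uminus by simp

lemma I_sum: "(\<And>t. t \<in> T \<Longrightarrow> g t \<in> I) \<Longrightarrow> sum g T \<in> I"
  by (induction T rule: infinite_finite_induct) (auto intro: I_add)

lemma I_one: "1 \<in> I \<Longrightarrow> I = A"
  using I.one_imp_carrier by simp

end

section \<open>Algebraic dependence and chains of primes\<close>

context subalgebra
begin

lemma subalgebra_idealI: "ideal I (ring_on A) \<Longrightarrow> subalgebra_ideal A C I"
  by (simp add: subalgebra_ideal_def subalgebra_axioms subalgebra_ideal_axioms_def)

text \<open>The key step of the bound of the Krull dimension by the transcendence degree: in an algebraic
  relation holding modulo \<open>P\<close>, the terms with the lowest power of \<open>f\<close> survive modulo \<open>Q\<close>.\<close>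

lemma lowest_power_terms:
  assumes P: "primeideal P (ring_on A)" and Q: "ideal Q (ring_on A)" "P \<subseteq> Q"
    and f: "f \<in> Q" "f \<notin> P" and T: "finite T" "T \<noteq> {}" and g: "\<And>t. t \<in> T \<Longrightarrow> g t \<in> A"
    and rel: "(\<Sum>t\<in>T. f ^ e t * g t) \<in> P"
  shows "\<exists>i. (\<exists>t\<in>T. e t = i) \<and> (\<Sum>t\<in>{t\<in>T. e t = i}. g t) \<in> Q"
proof -
  interpret P: primeideal P "ring_on A" by fact
  interpret Q: subalgebra_ideal A C Q by (rule subalgebra_idealI) fact
  define i where "i = Min (e ` T)"
  have i: "i \<in> e ` T" "\<And>t. t \<in> T \<Longrightarrow> i \<le> e t" unfolding i_def using T by auto
  have fA: "f \<in> A" using f Q.I_in by blast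
  let ?Y = "\<Sum>t\<in>T. f ^ (e t - i) * g t"
  have YA: "?Y \<in> A" using g fA by (intro sum_in) auto
  \<comment> \<open>The common factor \<open>f ^ i\<close> is removed modulo the prime
    \<open>P\<close>; afterwards every term that still contains \<open>f\<close> lies in
    \<open>Q\<close>.\<close>
  have "(\<Sum>t\<in>T. f ^ e t * g t) = f ^ i * ?Y"
    using i(2) by (simp add: sum_distrib_left mult.assoc[symmetric] power_add[symmetric])
  then have "f ^ i * ?Y \<in> P" using rel by simp
  moreover have "f ^ j \<notin> P" for j
  proof (induction j)
    case 0
    then show ?case using P.one_imp_carrier P.I_notcarr by auto
  next
    case (Suc j)
    then show ?case using P.I_prime[of f "f ^ j"] f fA by auto
  qed
  ultimately have "?Y \<in> P" using P.I_prime[of "f ^ i" ?Y] YA fA by auto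
  then have "?Y \<in> Q" using Q by blast
  have Y1: "?Y = (\<Sum>t\<in>{t\<in>T. e t = i}. f ^ (e t - i) * g t) + (\<Sum>t\<in>{t\<in>T. e t \<noteq> i}. f ^ (e t - i) * g t)"
    using T by (subst sum.union_disjoint[symmetric]) (auto intro: sum.cong)
  have Y2: "(\<Sum>t\<in>{t\<in>T. e t = i}. f ^ (e t - i) * g t) = (\<Sum>t\<in>{t\<in>T. e t = i}. g t)"
    by (intro sum.cong) auto
  have Y3: "(\<Sum>t\<in>{t\<in>T. e t \<noteq> i}. f ^ (e t - i) * g t) \<in> Q"
  proof (rule Q.I_sum)
    fix t assume t: "t \<in> {t\<in>T. e t \<noteq> i}"
    then have "e t - i = Suc (e t - i - 1)" using i(2)[of t] by auto
    then have "f ^ (e t - i) * g t = (f ^ (e t - i - 1) * g t) * f" by (metis mult.assoc mult.commute power_Suc)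
    moreover have "(f ^ (e t - i - 1) * g t) * f \<in> Q" using t f fA g by (intro Q.I_mult) auto
    ultimately show "f ^ (e t - i) * g t \<in> Q" by (simp only:)
  qed
  have "?Y - (\<Sum>t\<in>{t\<in>T. e t \<noteq> i}. f ^ (e t - i) * g t) \<in> Q"
    using \<open>?Y \<in> Q\<close> Y3 by (rule Q.I_diff)
  then have "(\<Sum>t\<in>{t\<in>T. e t = i}. g t) \<in> Q" unfolding Y1 Y2 by simp
  then show ?thesis using i by auto
qed

text \<open>Algebraic dependence over the field, a triple in \<open>T\<close> being the exponents of
  a monomial. Nonzero coefficients on all of \<open>T\<close> keep the relation nontrivial when it
  is cut down to a nonempty part of \<open>T\<close>.\<close>

definition dependent3 where
  "dependent3 f0 f1 f2 \<longleftrightarrow> (\<exists>(T :: (nat \<times> nat \<times> nat) set) a. finite T \<and> T \<noteq> {} \<and> (\<forall>t\<in>T. a t \<noteq> 0) \<and>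
     (\<Sum>t\<in>T. C (a t) * f0 ^ fst t * f1 ^ fst (snd t) * f2 ^ snd (snd t)) = 0)"

lemma C_notin_proper_ideal:
  assumes "ideal I (ring_on A)" "I \<noteq> A" "a \<noteq> 0"
  shows "C a \<notin> I"
proof
  interpret subalgebra_ideal A C I by (rule subalgebra_idealI) fact
  assume "C a \<in> I"
  then have "C (inverse a) * C a \<in> I" by (intro I_mult) auto
  then have "1 \<in> I" using assms by (simp add: C_mult[symmetric])
  then show False using I_one assms by auto
qed

text \<open>Choose \<open>f0\<close>, \<open>f1\<close>, \<open>f2\<close>, each in the next prime
  of the chain but not in the one before, and strip their powers from a relation by
  \<open>lowest_power_terms\<close>, one per step of the chain. What is left is a single nonzero
  constant in the proper ideal \<open>P 3\<close>.\<close>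

lemma no_prime_chain:
  assumes dep: "\<And>f0 f1 f2. \<lbrakk>f0 \<in> A; f1 \<in> A; f2 \<in> A\<rbrakk> \<Longrightarrow> dependent3 f0 f1 f2"
  shows "\<nexists>P. (\<forall>i\<le>3. primeideal (P i) (ring_on A)) \<and> (\<forall>i<3::nat. P i \<subset> P (Suc i))"
proof
  assume "\<exists>P. (\<forall>i\<le>3. primeideal (P i) (ring_on A)) \<and> (\<forall>i<3::nat. P i \<subset> P (Suc i))"
  then obtain P :: "nat \<Rightarrow> 'u set" where P: "\<And>i. i \<le> 3 \<Longrightarrow> primeideal (P i) (ring_on A)"
    and strict: "\<And>i. i < 3 \<Longrightarrow> P i \<subset> P (Suc i)" by blast
  have sub: "P 0 \<subseteq> P 1" "P 1 \<subseteq> P 2" "P 2 \<subseteq> P 3"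
    using strict[of 0] strict[of 1] strict[of 2] by (auto simp: numeral_2_eq_2 numeral_3_eq_3)
  have idl: "ideal (P i) (ring_on A)" if "i \<le> 3" for i
    using P[OF that] by (rule primeideal.axioms(1))
  have P_in: "f \<in> A" if "f \<in> P i" "i \<le> 3" for f i
    using ideal.Icarr[OF idl[OF that(2)] that(1)] by simp
  obtain f0 where f0: "f0 \<in> P 1" "f0 \<notin> P 0" using strict[of 0] by auto
  obtain f1 where f1: "f1 \<in> P 2" "f1 \<notin> P 1" using strict[of 1] by (auto simp: numeral_2_eq_2)
  obtain f2 where f2: "f2 \<in> P 3" "f2 \<notin> P 2" using strict[of 2] by (auto simp: numeral_3_eq_3 numeral_2_eq_2)
  have fA: "f0 \<in> A" "f1 \<in> A" "f2 \<in> A" using P_in f0(1) f1(1) f2(1) by auto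
  obtain T :: "(nat \<times> nat \<times> nat) set" and a where T: "finite T" "T \<noteq> {}" "\<forall>t\<in>T. a t \<noteq> 0"
    and rel: "(\<Sum>t\<in>T. C (a t) * f0 ^ fst t * f1 ^ fst (snd t) * f2 ^ snd (snd t)) = 0"
    using dep[OF fA] by (auto simp: dependent3_def)
  have "0 \<in> P 0" using additive_subgroup.zero_closed[OF ideal.axioms(1)[OF idl[of 0]]] by simp
  then have "(\<Sum>t\<in>T. f0 ^ fst t * (C (a t) * f1 ^ fst (snd t) * f2 ^ snd (snd t))) \<in> P 0"
    using rel by (simp add: mult_ac)
  then obtain i where i: "\<exists>t\<in>T. fst t = i"
    and 1: "(\<Sum>t\<in>{t\<in>T. fst t = i}. C (a t) * f1 ^ fst (snd t) * f2 ^ snd (snd t)) \<in> P 1"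
    using lowest_power_terms[OF P[of 0] idl[of 1] sub(1) f0 T(1,2),
      of "\<lambda>t. C (a t) * f1 ^ fst (snd t) * f2 ^ snd (snd t)" fst] fA by auto
  define T1 where "T1 = {t\<in>T. fst t = i}"
  have T1: "finite T1" "T1 \<noteq> {}" using T i by (auto simp: T1_def)
  have "(\<Sum>t\<in>T1. f1 ^ fst (snd t) * (C (a t) * f2 ^ snd (snd t))) \<in> P 1"
    using 1 by (simp add: mult_ac T1_def)
  then obtain j where j: "\<exists>t\<in>T1. fst (snd t) = j"
    and 2: "(\<Sum>t\<in>{t\<in>T1. fst (snd t) = j}. C (a t) * f2 ^ snd (snd t)) \<in> P 2"
    using lowest_power_terms[OF P[of 1] idl[of 2] sub(2) f1 T1,
      of "\<lambda>t. C (a t) * f2 ^ snd (snd t)" "\<lambda>t. fst (snd t)"] fA by auto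
  define T2 where "T2 = {t\<in>T1. fst (snd t) = j}"
  have T2: "finite T2" "T2 \<noteq> {}" using T1 j by (auto simp: T2_def)
  have "(\<Sum>t\<in>T2. f2 ^ snd (snd t) * C (a t)) \<in> P 2"
    using 2 by (simp add: mult_ac T2_def)
  then obtain k where k: "\<exists>t\<in>T2. snd (snd t) = k"
    and s: "(\<Sum>t\<in>{t\<in>T2. snd (snd t) = k}. C (a t)) \<in> P 3"
    using lowest_power_terms[OF P[of 2] idl[of 3] sub(3) f2 T2,
      of "\<lambda>t. C (a t)" "\<lambda>t. snd (snd t)"] fA by auto
  have "{t\<in>T2. snd (snd t) = k} = {(i, j, k)}" "(i, j, k) \<in> T"
    using k by (auto simp: T1_def T2_def)
  then have "C (a (i, j, k)) \<in> P 3" "(i, j, k) \<in> T" using s by auto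
  moreover have "P 3 \<noteq> A" using primeideal.I_notcarr[OF P[of 3]] by auto
  ultimately show False using C_notin_proper_ideal[OF idl[of 3]] T(3) by auto
qed

subsection \<open>A special case of the Nullstellensatz\<close>

definition ev :: "'u \<Rightarrow> 'k poly \<Rightarrow> 'u" where
  "ev x p = poly (map_poly C p) x"

lemma ev_0 [simp]: "ev x 0 = 0"
  by (simp add: ev_def)

lemma ev_pCons [simp]: "ev x (pCons c p) = C c + x * ev x p"
  by (cases "p = 0 \<and> c = 0") (auto simp: ev_def map_poly_pCons)

lemma ev_1 [simp]: "ev x 1 = 1"
  by (simp add: one_pCons)

lemma ev_add: "ev x (p + q) = ev x p + ev x q"
proof (induction p arbitrary: q)
  case (pCons a p)
  then show ?case by (cases q) (simp add: C_add algebra_simps)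
qed simp

lemma ev_smult: "ev x (smult c p) = C c * ev x p"
  by (induction p) (auto simp: C_mult algebra_simps)

lemma ev_mult: "ev x (p * q) = ev x p * ev x q"
  by (induction p) (auto simp: ev_add ev_smult algebra_simps)

lemma ev_uminus: "ev x (- p) = - ev x p"
  using ev_add[of x p "- p"] by (simp add: eq_neg_iff_add_eq_0 add.commute)

lemma ev_diff: "ev x (p - q) = ev x p - ev x q"
  using ev_add[of x p "- q"] by (simp add: ev_uminus)

lemma ev_monom: "ev x (monom a n) = C a * x ^ n"
  by (induction n) (auto simp: monom_Suc monom_0 algebra_simps)

lemma ev_sum: "ev x (sum g T) = (\<Sum>t\<in>T. ev x (g t))"
  by (induction T rule: infinite_finite_induct) (auto simp: ev_add)

lemma ev_in [simp]: "x \<in> A \<Longrightarrow> ev x p \<in> A"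
  by (induction p) auto

lemma ev_altdef: "ev x p = (\<Sum>i\<le>degree p. C (coeff p i) * x ^ i)"
  using ev_sum[of x "\<lambda>i. monom (coeff p i) i" "{..degree p}"]
  by (simp add: poly_as_sum_of_monoms ev_monom)

end

text \<open>This is \<open>M\<close> plus the module generated by \<open>H\<close> over the
  polynomials in one element, \<open>E\<close> being the evaluation at that element.\<close>

inductive_set mod_span :: "('p \<Rightarrow> 'u::comm_ring_1) \<Rightarrow> 'u set \<Rightarrow> 'u set \<Rightarrow> 'u set" for E M H where
  base: "m \<in> M \<Longrightarrow> m \<in> mod_span E M H"
| step: "h \<in> H \<Longrightarrow> v \<in> mod_span E M H \<Longrightarrow> E p * h + v \<in> mod_span E M H"

locale subalgebra_point = subalgebra_ideal A C M for A :: "'u::idom set" and C :: "'k::field \<Rightarrow> 'u" and M +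
  fixes x :: 'u
  assumes x_in [simp]: "x \<in> A"
begin

abbreviation N where "N \<equiv> mod_span (ev x) M"

lemma mod_span_add: "v \<in> N H \<Longrightarrow> w \<in> N H \<Longrightarrow> v + w \<in> N H"
proof (induction rule: mod_span.induct)
  case (base m)
  show ?case using \<open>w \<in> N H\<close> base(1)
  proof (induction rule: mod_span.induct)
    case (step h v p)
    then have "ev x p * h + (m + v) \<in> N H" by (intro mod_span.step)
    then show ?case by (simp add: algebra_simps)
  qed (auto intro: mod_span.base I_add)
next
  case (step h v p)
  then have "ev x p * h + (v + w) \<in> N H" by (intro mod_span.step)
  then show ?case by (simp add: algebra_simps)
qed

lemma mod_span_mult: "v \<in> N H \<Longrightarrow> ev x q * v \<in> N H"
proof (induction rule: mod_span.induct)
  case (base m)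
  then show ?case by (intro mod_span.base I_mult ev_in) auto
next
  case (step h v p)
  then have "ev x (q * p) * h + ev x q * v \<in> N H" by (intro mod_span.step)
  then show ?case by (simp add: algebra_simps ev_mult)
qed

lemma mod_span_insert: "v \<in> N (insert h H) \<Longrightarrow> \<exists>p w. v = ev x p * h + w \<and> w \<in> N H"
proof (induction rule: mod_span.induct)
  case (base m)
  then show ?case by (intro exI[of _ 0] exI[of _ m]) (auto intro: mod_span.base)
next
  case (step h' v p)
  then obtain q w where v: "v = ev x q * h + w" and w: "w \<in> N H" by blast
  show ?case
  proof (cases "h' = h")
    case True
    then show ?thesis using v w
      by (intro exI[of _ "p + q"] exI[of _ w]) (simp add: ev_add algebra_simps)
  next
    case False
    then have "ev x p * h' + w \<in> N H" using step w by (intro mod_span.step) auto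
    then show ?thesis using v by (intro exI[of _ q] exI[of _ "ev x p * h' + w"]) simp
  qed
qed

lemma mod_span_empty: "v \<in> N {} \<Longrightarrow> v \<in> M"
  by (induction rule: mod_span.induct) auto

text \<open>Nakayama's lemma over the local ring of the affine line at \<open>\<gamma>\<close>, by eliminating one generator
  at a time.\<close>

lemma nakayama_elimination:
  assumes "finite H" "H \<subseteq> A"
    and "\<And>f. f \<in> A \<Longrightarrow> \<exists>\<delta>. poly \<delta> \<gamma> \<noteq> 0 \<and> (\<exists>v\<in>N H. ev x \<delta> * f - (x - C \<gamma>) * v \<in> M)"
    and "f \<in> A"
  shows "\<exists>\<delta>. poly \<delta> \<gamma> \<noteq> 0 \<and> ev x \<delta> * f \<in> M"
  using assms
proof (induction H arbitrary: f rule: finite_induct)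
  case empty
  then obtain \<delta> v where \<delta>: "poly \<delta> \<gamma> \<noteq> 0" "v \<in> N {}" "ev x \<delta> * f - (x - C \<gamma>) * v \<in> M" by meson
  have "(x - C \<gamma>) * v \<in> M" using mod_span_empty[OF \<delta>(2)] by (intro I_mult) auto
  then show ?case using \<delta> I_add by fastforce
next
  case (insert h H)
  let ?l = "[:- \<gamma>, 1:]"
  have l: "ev x ?l = x - C \<gamma>" by (simp add: C_uminus)
  have hA: "h \<in> A" using insert by auto
  obtain \<delta>0 v0 where d0: "poly \<delta>0 \<gamma> \<noteq> 0" "v0 \<in> N (insert h H)" "ev x \<delta>0 * h - (x - C \<gamma>) * v0 \<in> M"
    using insert.prems(2)[OF hA] by blast
  obtain p v where v: "v0 = ev x p * h + v" "v \<in> N H" using mod_span_insert[OF d0(2)] by blast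
  \<comment> \<open>Moving the \<open>h\<close>-part of \<open>v0\<close> to the left gives
    \<open>h\<close> the coefficient \<epsilon>, whose value at \<gamma> is that of
    \<open>\<delta>0\<close> because \<open>?l\<close> vanishes there. So \<epsilon> is invertible
    near \<gamma> and \<open>h\<close> can be eliminated.\<close>
  define \<epsilon> where "\<epsilon> = \<delta>0 - ?l * p"
  have \<epsilon>: "poly \<epsilon> \<gamma> \<noteq> 0" using d0 by (simp add: \<epsilon>_def)
  have eh: "ev x \<epsilon> * h - (x - C \<gamma>) * v \<in> M"
    using d0(3) unfolding v \<epsilon>_def ev_diff ev_mult l by (simp add: algebra_simps)
  show ?case
  proof (rule insert.IH)
    show "H \<subseteq> A" using insert by auto
    show "f \<in> A" by fact
    fix f assume fA: "f \<in> A"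
    obtain \<delta> w0 where d: "poly \<delta> \<gamma> \<noteq> 0" "w0 \<in> N (insert h H)" "ev x \<delta> * f - (x - C \<gamma>) * w0 \<in> M"
      using insert.prems(2)[OF fA] by blast
    obtain q w where w: "w0 = ev x q * h + w" "w \<in> N H" using mod_span_insert[OF d(2)] by blast
    \<comment> \<open>After multiplication by \<epsilon>, the product \<open>\<epsilon> h\<close>
      coming from \<open>w0\<close> is replaced by \<open>(x - C \<gamma>) * v\<close>, which is
      congruent to it modulo \<open>M\<close>.\<close>
    let ?u = "ev x (q * ?l) * v + ev x \<epsilon> * w"
    have "ev x (\<epsilon> * \<delta>) * f - (x - C \<gamma>) * ?u
        = ev x \<epsilon> * (ev x \<delta> * f - (x - C \<gamma>) * w0) + ((x - C \<gamma>) * ev x q) * (ev x \<epsilon> * h - (x - C \<gamma>) * v)"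
      unfolding w(1) ev_mult l by (simp add: algebra_simps)
    also have "\<dots> \<in> M"
      using d(3) eh by (intro I_add I_mult) (auto intro: ev_in)
    finally have "ev x (\<epsilon> * \<delta>) * f - (x - C \<gamma>) * ?u \<in> M" .
    moreover have "?u \<in> N H" using v w by (intro mod_span_add mod_span_mult)
    moreover have "poly (\<epsilon> * \<delta>) \<gamma> \<noteq> 0" using \<epsilon> d by simp
    ultimately show "\<exists>\<delta>. poly \<delta> \<gamma> \<noteq> 0 \<and> (\<exists>v\<in>N H. ev x \<delta> * f - (x - C \<gamma>) * v \<in> M)" by blast
  qed
qed

text \<open>Where \<open>c r\<close> does not vanish the relation is monic up to a unit of the local
  ring at \<gamma>, so it rewrites \<open>y ^ r\<close> by lower powers. Hence finitely many
  products \<open>h * y ^ j\<close> generate everything modulo \<open>M\<close>, once a denominator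
  \<delta> is allowed.\<close>

lemma fraction_span:
  assumes y: "y \<in> A" and H: "H \<subseteq> A" and span: "A \<subseteq> lin_span C {h * x ^ i * y ^ j | h i j. h \<in> H}"
    and lc: "poly (c r) \<gamma> \<noteq> 0" and rel: "(\<Sum>j\<le>r. ev x (c j) * y ^ j) \<in> M"
    and f: "f \<in> A"
  shows "\<exists>\<delta>. poly \<delta> \<gamma> \<noteq> 0 \<and> ev x \<delta> * f \<in> N {h * y ^ j | h j. h \<in> H \<and> j < r}"
proof -
  let ?N = "N {h * y ^ j | h j. h \<in> H \<and> j < r}"
  \<comment> \<open>\<open>W\<close> collects the elements that reach the span after clearing a
    denominator. It is closed under addition and under multiplication by polynomials in
    \<open>x\<close>, so only the products \<open>h * y ^ j\<close> need checking.\<close>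
  define W where "W = {w. \<exists>\<delta>. poly \<delta> \<gamma> \<noteq> 0 \<and> ev x \<delta> * w \<in> ?N}"
  have W_add: "v + w \<in> W" if "v \<in> W" "w \<in> W" for v w
  proof -
    obtain \<delta> \<epsilon> where d: "poly \<delta> \<gamma> \<noteq> 0" "ev x \<delta> * v \<in> ?N" "poly \<epsilon> \<gamma> \<noteq> 0" "ev x \<epsilon> * w \<in> ?N"
      using \<open>v \<in> W\<close> \<open>w \<in> W\<close> by (auto simp: W_def)
    have "ev x (\<delta> * \<epsilon>) * (v + w) = ev x \<epsilon> * (ev x \<delta> * v) + ev x \<delta> * (ev x \<epsilon> * w)"
      by (simp add: ev_mult algebra_simps)
    also have "\<dots> \<in> ?N" by (rule mod_span_add[OF mod_span_mult[OF d(2)] mod_span_mult[OF d(4)]])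
    finally show ?thesis using d unfolding W_def by (intro CollectI exI[of _ "\<delta> * \<epsilon>"]) simp
  qed
  have W_mult: "ev x p * v \<in> W" if v: "v \<in> W" for p v
  proof -
    obtain \<delta> where d: "poly \<delta> \<gamma> \<noteq> 0" "ev x \<delta> * v \<in> ?N" using v by (auto simp: W_def)
    have "ev x \<delta> * (ev x p * v) = ev x p * (ev x \<delta> * v)" by simp
    also have "\<dots> \<in> ?N" by (rule mod_span_mult[OF d(2)])
    finally show ?thesis using d unfolding W_def by blast
  qed
  have W_M: "m \<in> W" if "m \<in> M" for m
    unfolding W_def using that by (intro CollectI exI[of _ 1]) (auto intro: mod_span.base)
  have W_sum: "sum g T \<in> W" if "\<And>t. t \<in> T \<Longrightarrow> g t \<in> W" for g :: "nat \<Rightarrow> 'u" and T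
    using that W_M by (induction T rule: infinite_finite_induct) (auto intro: W_add)
  have gen: "h * y ^ j \<in> W" if h: "h \<in> H" for h j
  proof (induction j rule: less_induct)
    case (less j)
    show ?case
    proof (cases "j < r")
      case True
      then have "ev x 1 * (h * y ^ j) + 0 \<in> ?N" using h by (intro mod_span.step mod_span.base) auto
      then show ?thesis unfolding W_def by (intro CollectI exI[of _ 1]) simp
    next
      case False
      have "(\<Sum>j\<le>r. ev x (c j) * y ^ j) = (\<Sum>j<r. ev x (c j) * y ^ j) + ev x (c r) * y ^ r"
        by (simp add: lessThan_Suc_atMost[symmetric])
      moreover have "y ^ j = y ^ (j - r) * y ^ r" using False by (simp flip: power_add)
      moreover have "(\<Sum>i<r. ev x (- c i) * (h * y ^ (j - r + i)))
          = - (h * y ^ (j - r) * (\<Sum>j<r. ev x (c j) * y ^ j))"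
        by (simp add: ev_uminus sum_negf sum_distrib_left power_add mult_ac)
      \<comment> \<open>The relation times \<open>h * y ^ (j - r)\<close> isolates the top power;
        the induction covers the lower ones, and \<open>c r\<close> joins the denominator.\<close>
      ultimately have "ev x (c r) * (h * y ^ j) = h * y ^ (j - r) * (\<Sum>j\<le>r. ev x (c j) * y ^ j)
          + (\<Sum>i<r. ev x (- c i) * (h * y ^ (j - r + i)))"
        by (simp add: algebra_simps)
      also have "\<dots> \<in> W"
      proof (intro W_add W_sum W_mult)
        show "h * y ^ (j - r) * (\<Sum>j\<le>r. ev x (c j) * y ^ j) \<in> W"
          using h H y rel by (intro W_M I_mult) auto
        show "h * y ^ (j - r + i) \<in> W" if "i \<in> {..<r}" for i
          using that False by (intro less) auto
      qed
      finally obtain \<delta> where d: "poly \<delta> \<gamma> \<noteq> 0" "ev x \<delta> * (ev x (c r) * (h * y ^ j)) \<in> ?N"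
        by (auto simp: W_def)
      then show ?thesis unfolding W_def using lc
        by (intro CollectI exI[of _ "\<delta> * c r"]) (simp add: ev_mult mult_ac)
    qed
  qed
  have "f \<in> lin_span C {h * x ^ i * y ^ j | h i j. h \<in> H}" using f span by blast
  then have "f \<in> W"
  proof (induction rule: lin_span.induct)
    case zero
    then show ?case using W_M by simp
  next
    case (step b v a)
    then obtain h i j where b: "b = h * x ^ i * y ^ j" "h \<in> H" by blast
    have "C a * b = ev x (monom a i) * (h * y ^ j)" using b by (simp add: ev_monom mult_ac)
    then show ?case using W_add[OF W_mult[OF gen[OF b(2)]] step.IH] by metis
  qed
  then show ?thesis by (simp add: W_def)
qed

text \<open>A nonzero \<open>f\<close> in \<open>M\<close> turns a dependence of \<open>f\<close>,
  \<open>x\<close>, \<open>y\<close> into a relation between \<open>x\<close> and \<open>y\<close>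
  modulo \<open>M\<close>. If \<open>x - C \<gamma>\<close> is not in \<open>M\<close>, it is
  invertible modulo \<open>M\<close>, so every element is a multiple of it modulo \<open>M\<close>.
  By Nakayama's lemma some \<delta> with nonzero value at \<gamma> then kills \<open>1\<close>
  modulo \<open>M\<close>, which says that \<delta> evaluated at \<open>x\<close> lies in
  \<open>M\<close>.\<close>

theorem maximal_contains_univariate:
  assumes K: "infinite (UNIV :: 'k set)"
    and max: "maximalideal M (ring_on A)" and f: "f \<in> M" "f \<noteq> 0"
    and y: "y \<in> A" and H: "finite H" "H \<subseteq> A"
    and span: "A \<subseteq> lin_span C {h * x ^ i * y ^ j | h i j. h \<in> H}"
    and dep: "dependent3 f x y"
  shows "\<exists>p. p \<noteq> 0 \<and> ev x p \<in> M"
proof -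
  interpret max: maximalideal M "ring_on A" by fact
  interpret dom: domain "ring_on A" by (rule domain_ring_on)
  obtain T :: "(nat \<times> nat \<times> nat) set" and a where T: "finite T" "T \<noteq> {}" "\<forall>t\<in>T. a t \<noteq> 0"
    and rel: "(\<Sum>t\<in>T. C (a t) * f ^ fst t * x ^ fst (snd t) * y ^ snd (snd t)) = 0"
    using dep by (auto simp: dependent3_def)
  have "(\<Sum>t\<in>T. f ^ fst t * (C (a t) * x ^ fst (snd t) * y ^ snd (snd t))) \<in> {0}"
    using rel by (simp add: mult_ac)
  \<comment> \<open>With zero as the smaller and \<open>M\<close> as the larger ideal, dividing out
    the least power of \<open>f\<close> leaves a relation modulo \<open>M\<close> that is free of
    \<open>f\<close>.\<close>
  moreover have "primeideal {0} (ring_on A)" using dom.zeroprimeideal by simp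
  ultimately obtain k where k: "\<exists>t\<in>T. fst t = k"
    and sM: "(\<Sum>t\<in>{t\<in>T. fst t = k}. C (a t) * x ^ fst (snd t) * y ^ snd (snd t)) \<in> M"
    using lowest_power_terms[of "{0}" M f T "\<lambda>t. C (a t) * x ^ fst (snd t) * y ^ snd (snd t)" fst]
      ideal f T(1,2) y by auto
  define T' where "T' = {t\<in>T. fst t = k}"
  have T': "finite T'" "T' \<noteq> {}" using T k by (auto simp: T'_def)
  define r where "r = Max ((\<lambda>t. snd (snd t)) ` T')"
  have r: "\<And>t. t \<in> T' \<Longrightarrow> snd (snd t) \<le> r" "r \<in> (\<lambda>t. snd (snd t)) ` T'"
    unfolding r_def using T' by auto
  define c where "c j = (\<Sum>t\<in>{t\<in>T'. snd (snd t) = j}. monom (a t) (fst (snd t)))" for j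
  have "(\<Sum>j\<le>r. ev x (c j) * y ^ j)
      = (\<Sum>j\<le>r. \<Sum>t\<in>{t\<in>T'. snd (snd t) = j}. C (a t) * x ^ fst (snd t) * y ^ snd (snd t))"
    by (simp add: c_def ev_sum ev_monom sum_distrib_right)
  also have "\<dots> = (\<Sum>t\<in>T'. C (a t) * x ^ fst (snd t) * y ^ snd (snd t))"
    using T' r by (intro sum.group) auto
  finally have rel': "(\<Sum>j\<le>r. ev x (c j) * y ^ j) \<in> M" using sM by (simp add: T'_def)
  \<comment> \<open>All triples in \<open>T'\<close> share the first exponent, so among those with
    last exponent \<open>r\<close> the power of \<open>x\<close> tells them apart and no
    coefficients merge.\<close>
  have "c r \<noteq> 0"
  proof -
    obtain t where t: "t \<in> T'" "snd (snd t) = r" using r by auto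
    have "coeff (c r) (fst (snd t)) = (\<Sum>t'\<in>{t'\<in>T'. snd (snd t') = r}. if t' = t then a t' else 0)"
      unfolding c_def coeff_sum using t by (intro sum.cong refl) (auto simp: T'_def prod_eq_iff)
    also have "\<dots> = a t" using t T' by simp
    finally show ?thesis using t T by (auto simp: T'_def)
  qed
  then have "finite {\<gamma>. poly (c r) \<gamma> = 0}" by (rule poly_roots_finite)
  then obtain \<gamma> where \<gamma>: "poly (c r) \<gamma> \<noteq> 0" using K by (metis (mono_tags) ex_new_if_finite mem_Collect_eq)
  show ?thesis
  proof (cases "x - C \<gamma> \<in> M")
    case True
    then show ?thesis by (intro exI[of _ "[:- \<gamma>, 1:]"]) (simp add: C_uminus)
  next
    case False
    \<comment> \<open>By maximality, \<open>M\<close> and \<open>x - C \<gamma>\<close> generate the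
      whole ring.\<close>
    have "\<exists>g\<in>A. (x - C \<gamma>) * g - 1 \<in> M"
    proof -
      let ?J = "{m + (x - C \<gamma>) * g | m g. m \<in> M \<and> g \<in> A}"
      have J1: "ideal ?J (ring_on A)"
      proof (rule cring.idealI_closed[OF cring_ring_on])
        show "?J \<subseteq> carrier (ring_on A)" using I_in by auto
        show "\<zero>\<^bsub>ring_on A\<^esub> \<in> ?J" by (auto intro!: exI[of _ 0])
      next
        fix p q assume "p \<in> ?J" "q \<in> ?J"
        then obtain m g n k where pq: "m \<in> M" "g \<in> A" "n \<in> M" "k \<in> A"
          "p = m + (x - C \<gamma>) * g" "q = n + (x - C \<gamma>) * k" by blast
        have "p + q = (m + n) + (x - C \<gamma>) * (g + k)" unfolding pq(5,6) by (simp add: algebra_simps)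
        then show "p \<oplus>\<^bsub>ring_on A\<^esub> q \<in> ?J" 
          using I_add[OF pq(1,3)] add_in[OF pq(2,4)] by (auto simp only: ring_on_simps mem_Collect_eq)
      next
        fix p q assume "p \<in> ?J" "q \<in> carrier (ring_on A)"
        then obtain m g where pq: "m \<in> M" "g \<in> A" "p = m + (x - C \<gamma>) * g" "q \<in> A" by auto
        have "q * p = q * m + (x - C \<gamma>) * (q * g)" unfolding pq(3) by (simp add: algebra_simps)
        then show "q \<otimes>\<^bsub>ring_on A\<^esub> p \<in> ?J" 
          using I_mult[OF pq(4,1)] mult_in[OF pq(4,2)] by (auto simp only: ring_on_simps mem_Collect_eq)
      qed
      have J2: "M \<subseteq> ?J"
      proof
        fix m assume "m \<in> M"
        then show "m \<in> ?J" by (intro CollectI exI[of _ m] exI[of _ 0]) auto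
      qed
      have J3: "?J \<subseteq> carrier (ring_on A)" using I_in by auto
      have "x - C \<gamma> \<in> ?J" by (intro CollectI exI[of _ 0] exI[of _ 1]) auto
      then have "?J \<noteq> M" using False by blast
      then have "?J = A" using max.I_maximal[OF J1 J2 J3] by simp
      then have "1 \<in> ?J" by simp
      then obtain m g where "m \<in> M" "g \<in> A" "1 = m + (x - C \<gamma>) * g" by blast
      moreover from this have "(x - C \<gamma>) * g - 1 = - m" by (simp add: algebra_simps)
      ultimately show ?thesis using I_uminus by metis
    qed
    then obtain g where g: "g \<in> A" "(x - C \<gamma>) * g - 1 \<in> M" by blast
    let ?H = "{h * y ^ j | h j. h \<in> H \<and> j < r}"
    have "?H = (\<lambda>(h, j). h * y ^ j) ` (H \<times> {..<r})" by auto
    then have fin: "finite ?H" using H by simp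
    have "\<exists>\<delta>. poly \<delta> \<gamma> \<noteq> 0 \<and> ev x \<delta> * 1 \<in> M"
    proof (rule nakayama_elimination[OF fin])
      show "?H \<subseteq> A" using H y by auto
      fix k assume k: "k \<in> A"
      then have "g * k \<in> A" using g by simp
      then obtain \<delta> where d: "poly \<delta> \<gamma> \<noteq> 0" "ev x \<delta> * (g * k) \<in> N ?H"
        using fraction_span[OF y H(2) span \<gamma> rel'] by blast
      \<comment> \<open>Modulo \<open>M\<close>, \<open>k\<close> is \<open>x - C \<gamma>\<close>
        times \<open>g * k\<close>; the factor \<delta> is there to bring \<open>g * k\<close> into
        the span.\<close>
      have "ev x \<delta> * k - (x - C \<gamma>) * (ev x \<delta> * (g * k)) = (- (ev x \<delta> * k)) * ((x - C \<gamma>) * g - 1)"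
        by (simp add: algebra_simps)
      also have "\<dots> \<in> M" using g k by (intro I_mult) (auto intro: ev_in)
      finally show "\<exists>\<delta>. poly \<delta> \<gamma> \<noteq> 0 \<and> (\<exists>v\<in>N ?H. ev x \<delta> * k - (x - C \<gamma>) * v \<in> M)"
        using d by blast
    qed simp
    then show ?thesis by (metis mult_1_right poly_0)
  qed
qed

end

section \<open>Monomials\<close>

definition mon :: "('v \<Rightarrow>\<^sub>0 nat) \<Rightarrow> ('v, 'k::field) mpol" where
  "mon \<kappa> = Poly_Mapping.single \<kappa> 1"

text \<open>For a semigroup \<open>S\<close> this is the ring \<open>K[S]\<close>; for an arbitrary
  set, as in \<open>image_subst\<close>, it is only the span of the monomials.\<close>

definition monomial_algebra :: "('v \<Rightarrow>\<^sub>0 nat) set \<Rightarrow> ('v, 'k::field) mpol set" where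
  "monomial_algebra S = {f. Poly_Mapping.keys f \<subseteq> S}"

lemma mon_0 [simp]: "mon 0 = 1"
  by (simp add: mon_def)

lemma mon_mult: "mon \<kappa> * mon \<mu> = mon (\<kappa> + \<mu>)"
  by (simp add: mon_def mult_single)

lemma keys_mon [simp]: "Poly_Mapping.keys (mon \<kappa> :: ('v, 'k::field) mpol) = {\<kappa>}"
  by (simp add: mon_def)

lemma mon_nonzero [simp]: "mon \<kappa> \<noteq> 0"
  using keys_mon by (metis insert_not_empty keys_zero)

lemma const_mult_mon: "mpol_const a * mon \<kappa> = Poly_Mapping.single \<kappa> a"
  by (simp add: mpol_const_def mon_def mult_single)

lemma keys_mpol_const: "Poly_Mapping.keys (mpol_const a) \<subseteq> {0}"
  by (simp add: mpol_const_def)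

lemma lookup_single_mult:
  fixes f :: "('v, 'k::field) mpol"
  shows "Poly_Mapping.lookup (Poly_Mapping.single \<kappa> a * f) (\<kappa> + s) = a * Poly_Mapping.lookup f s"
  by (simp add: lookup_mult lookup_single when_mult)

lemma keys_single_mult:
  fixes f :: "('v, 'k::field) mpol"
  shows "Poly_Mapping.keys (Poly_Mapping.single \<kappa> a * f) \<subseteq> (\<lambda>s. \<kappa> + s) ` Poly_Mapping.keys f"
  using keys_mult[of "Poly_Mapping.single \<kappa> a" f] by (auto split: if_splits)

lemma lookup_const_mult [simp]:
  fixes f :: "('v, 'k::field) mpol"
  shows "Poly_Mapping.lookup (mpol_const a * f) \<kappa> = a * Poly_Mapping.lookup f \<kappa>"
  using lookup_single_mult[of 0 a f \<kappa>] by (simp add: mpol_const_def)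

lemma mpol_expansion:
  fixes f :: "('v, 'k::field) mpol"
  shows "f = (\<Sum>\<kappa>\<in>Poly_Mapping.keys f. mpol_const (Poly_Mapping.lookup f \<kappa>) * mon \<kappa>)"
proof (rule poly_mapping_eqI)
  fix \<mu>
  have "Poly_Mapping.lookup (\<Sum>\<kappa>\<in>Poly_Mapping.keys f. mpol_const (Poly_Mapping.lookup f \<kappa>) * mon \<kappa>) \<mu>
      = (\<Sum>\<kappa>\<in>Poly_Mapping.keys f. if \<kappa> = \<mu> then Poly_Mapping.lookup f \<kappa> else 0)"
    unfolding lookup_sum const_mult_mon by (intro sum.cong) (auto simp: lookup_single)
  also have "\<dots> = Poly_Mapping.lookup f \<mu>" by (simp add: in_keys_iff)
  finally show "Poly_Mapping.lookup f \<mu>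
      = Poly_Mapping.lookup (\<Sum>\<kappa>\<in>Poly_Mapping.keys f. mpol_const (Poly_Mapping.lookup f \<kappa>) * mon \<kappa>) \<mu>"
    by simp
qed

lemma keys_sum_subset:
  "(\<And>t. t \<in> T \<Longrightarrow> Poly_Mapping.keys (g t) \<subseteq> U) \<Longrightarrow> Poly_Mapping.keys (sum g T) \<subseteq> U"
proof (induction T rule: infinite_finite_induct)
  case (insert t T)
  then show ?case using keys_add[of "g t" "sum g T"] by auto
qed auto

lemma keys_minus_subset:
  fixes f g :: "('v, 'k::field) mpol"
  shows "Poly_Mapping.keys (f - g) \<subseteq> Poly_Mapping.keys f \<union> Poly_Mapping.keys g"
  by (auto simp: in_keys_iff lookup_minus)

lemma lin_span_mono: "B \<subseteq> B' \<Longrightarrow> lin_span C B \<subseteq> lin_span C B'"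
proof
  fix v assume "B \<subseteq> B'" and v: "v \<in> lin_span C B"
  from v show "v \<in> lin_span C B'"
    by (induction rule: lin_span.induct) (use \<open>B \<subseteq> B'\<close> in \<open>auto intro: lin_span.intros\<close>)
qed

lemma lin_span_sum:
  "(\<And>t. t \<in> T \<Longrightarrow> b t \<in> B) \<Longrightarrow> (\<Sum>t\<in>T. C (a t) * b t) \<in> lin_span C B"
  by (induction T rule: infinite_finite_induct) (auto intro: lin_span.intros)

lemma subalgebra_monomial_algebra:
  fixes S :: "('v::linorder \<Rightarrow>\<^sub>0 nat) set"
  assumes "0 \<in> S" "\<And>s t. s \<in> S \<Longrightarrow> t \<in> S \<Longrightarrow> s + t \<in> S"
  shows "subalgebra (monomial_algebra S :: ('v, 'k::field) mpol set) mpol_const"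
proof
  fix f g :: "('v, 'k) mpol"
  assume fg: "f \<in> monomial_algebra S" "g \<in> monomial_algebra S"
  then show "f + g \<in> monomial_algebra S"
    using keys_add[of f g] by (auto simp: monomial_algebra_def)
  show "f * g \<in> monomial_algebra S"
    using fg keys_mult[of f g] assms(2) by (fastforce simp: monomial_algebra_def)
next
  show "mpol_const a \<in> monomial_algebra S" for a :: 'k
    using assms(1) keys_mpol_const[of a] by (auto simp: monomial_algebra_def)
qed (simp_all add: mpol_const_def single_add mult_single)

lemma monomial_algebra_span:
  fixes S :: "('v \<Rightarrow>\<^sub>0 nat) set"
  shows "monomial_algebra S \<subseteq> lin_span mpol_const (mon ` S :: ('v, 'k::field) mpol set)"
proof
  fix f :: "('v, 'k::field) mpol" assume "f \<in> monomial_algebra S"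
  then have "(\<Sum>\<kappa>\<in>Poly_Mapping.keys f. mpol_const (Poly_Mapping.lookup f \<kappa>) * mon \<kappa>) \<in> lin_span mpol_const (mon ` S)"
    by (intro lin_span_sum) (auto simp: monomial_algebra_def)
  then show "f \<in> lin_span mpol_const (mon ` S)" using mpol_expansion[of f] by simp
qed

subsection \<open>Dickson's lemma\<close>

text \<open>Fix one \<open>z\<close>. A point not above \<open>z\<close> lies on one of the finitely
  many lines \<open>a x = i\<close> with \<open>i < a z\<close> or \<open>b x = j\<close> with
  \<open>j < b z\<close>, and on each line a point minimizing the other coordinate lies below all
  the others.\<close>

lemma dickson_nat:
  fixes a b :: "'x \<Rightarrow> nat"
  shows "\<exists>F\<subseteq>Z. finite F \<and> (\<forall>x\<in>Z. \<exists>f\<in>F. a f \<le> a x \<and> b f \<le> b x)"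
proof (cases "Z = {}")
  case False
  then obtain z where z: "z \<in> Z" by blast
  have arg: "\<exists>f\<in>Y. \<forall>x\<in>Y. h f \<le> h x" if "Y \<noteq> {}" for Y and h :: "'x \<Rightarrow> nat"
    using that arg_min_natI[of "\<lambda>x. x \<in> Y" _ h] arg_min_nat_le[of "\<lambda>x. x \<in> Y" _ h] by (meson ex_in_conv)
  define R where "R i = {x\<in>Z. a x = i}" for i
  define Co where "Co j = {x\<in>Z. b x = j}" for j
  have "\<exists>f. \<forall>i. R i \<noteq> {} \<longrightarrow> f i \<in> R i \<and> (\<forall>x\<in>R i. b (f i) \<le> b x)"
    using arg[of "R _" b] by (intro choice) blast
  then obtain f where f: "\<And>i. R i \<noteq> {} \<Longrightarrow> f i \<in> R i \<and> (\<forall>x\<in>R i. b (f i) \<le> b x)" by blast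
  have "\<exists>f. \<forall>i. Co i \<noteq> {} \<longrightarrow> f i \<in> Co i \<and> (\<forall>x\<in>Co i. a (f i) \<le> a x)"
    using arg[of "Co _" a] by (intro choice) blast
  then obtain g where g: "\<And>i. Co i \<noteq> {} \<Longrightarrow> g i \<in> Co i \<and> (\<forall>x\<in>Co i. a (g i) \<le> a x)" by blast
  let ?F = "insert z (f ` {i. i < a z \<and> R i \<noteq> {}} \<union> g ` {j. j < b z \<and> Co j \<noteq> {}})"
  have "?F \<subseteq> Z" using z f g by (auto simp: R_def Co_def)
  moreover have "finite ?F" by simp
  moreover have "\<exists>f\<in>?F. a f \<le> a x \<and> b f \<le> b x" if x: "x \<in> Z" for x
  proof -
    consider "a z \<le> a x \<and> b z \<le> b x" | "a x < a z" | "b x < b z" by linarith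
    then show ?thesis
    proof cases
      case 2
      have "x \<in> R (a x)" using x by (simp add: R_def)
      then have "f (a x) \<in> R (a x)" "b (f (a x)) \<le> b x" "R (a x) \<noteq> {}" using f by blast+
      then show ?thesis using 2 by (intro bexI[of _ "f (a x)"]) (auto simp: R_def)
    next
      case 3
      have "x \<in> Co (b x)" using x by (simp add: Co_def)
      then have "g (b x) \<in> Co (b x)" "a (g (b x)) \<le> a x" "Co (b x) \<noteq> {}" using g by blast+
      then show ?thesis using 3 by (intro bexI[of _ "g (b x)"]) (auto simp: Co_def)
    qed auto
  qed
  ultimately show ?thesis by blast
qed auto

subsection \<open>Linear dependence\<close>

text \<open>The family is indexed, so it may repeat a vector. A repetition gives a relation with
  coefficients 1 and -1; an injective family exceeds the possible size of an independent
  set.\<close>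

lemma (in vector_space) linear_relation:
  assumes fin: "finite I" "finite B" and card: "card B < card I" and g: "\<And>i. i \<in> I \<Longrightarrow> g i \<in> span B"
  shows "\<exists>a. (\<exists>i\<in>I. a i \<noteq> 0) \<and> (\<Sum>i\<in>I. scale (a i) (g i)) = 0"
proof (cases "inj_on g I")
  case True
  have "dependent (g ` I)"
  proof (rule ccontr)
    assume ind: "\<not> dependent (g ` I)"
    have "card (g ` I) \<le> card B"
      using independent_span_bound[OF fin(2) ind] g by blast
    then show False using card True by (simp add: card_image)
  qed
  then obtain u where u: "\<exists>v\<in>g ` I. u v \<noteq> 0" "(\<Sum>v\<in>g ` I. scale (u v) v) = 0"
    using dependent_finite[of "g ` I"] fin by auto
  then show ?thesis
    using True by (intro exI[of _ "\<lambda>i. u (g i)"]) (auto simp: sum.reindex)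
next
  case False
  then obtain i j where ij: "i \<in> I" "j \<in> I" "i \<noteq> j" "g i = g j" by (auto simp: inj_on_def)
  let ?a = "\<lambda>k. if k = i then 1 else if k = j then - 1 else 0 :: 'a"
  have "(\<Sum>k\<in>I. scale (?a k) (g k)) = (\<Sum>k\<in>{i, j}. scale (?a k) (g k))"
    using fin ij by (intro sum.mono_neutral_right) auto
  also have "\<dots> = 0" using ij by simp
  finally show ?thesis using ij by (intro exI[of _ ?a]) auto
qed

definition box :: "nat \<Rightarrow> (nat \<Rightarrow>\<^sub>0 nat) set" where
  "box n = {\<kappa>. Poly_Mapping.keys \<kappa> \<subseteq> {0, 1} \<and> Poly_Mapping.lookup \<kappa> 0 \<le> n \<and> Poly_Mapping.lookup \<kappa> 1 \<le> n}"

lemma plane_eqI: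
  fixes \<kappa> \<mu> :: "nat \<Rightarrow>\<^sub>0 nat"
  assumes "Poly_Mapping.keys \<kappa> \<subseteq> {0, 1}" "Poly_Mapping.keys \<mu> \<subseteq> {0, 1}"
    "Poly_Mapping.lookup \<kappa> 0 = Poly_Mapping.lookup \<mu> 0" "Poly_Mapping.lookup \<kappa> 1 = Poly_Mapping.lookup \<mu> 1"
  shows "\<kappa> = \<mu>"
proof (rule poly_mapping_eqI)
  fix k
  show "Poly_Mapping.lookup \<kappa> k = Poly_Mapping.lookup \<mu> k"
  proof (cases "k \<in> {0, 1}")
    case False
    then have "k \<notin> Poly_Mapping.keys \<kappa>" "k \<notin> Poly_Mapping.keys \<mu>" using assms by auto
    then show ?thesis by (simp add: in_keys_iff)
  qed (use assms in auto)
qed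

lemma box_finite: "finite (box n)" and card_box: "card (box n) \<le> (n + 1) ^ 2"
proof -
  let ?f = "\<lambda>\<kappa>. (Poly_Mapping.lookup \<kappa> (0::nat), Poly_Mapping.lookup \<kappa> (1::nat))"
  have inj: "inj_on ?f (box n)" by (rule inj_onI) (simp add: box_def plane_eqI del: One_nat_def)
  have sub: "?f ` box n \<subseteq> {..n} \<times> {..n}" by (auto simp: box_def)
  show "finite (box n)" using inj sub by (meson finite_SigmaI finite_atMost finite_imageD finite_subset)
  have "card (box n) \<le> card ({..n} \<times> {..n})" using inj sub by (intro card_inj_on_le) auto
  then show "card (box n) \<le> (n + 1) ^ 2" by (simp add: power2_eq_square)
qed

lemma keys_plus_nat: "Poly_Mapping.keys (\<kappa> + \<mu>) = Poly_Mapping.keys \<kappa> \<union> Poly_Mapping.keys \<mu>"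
  for \<kappa> \<mu> :: "'v \<Rightarrow>\<^sub>0 nat"
  by (auto simp: in_keys_iff lookup_add)

lemma box_mono: "m \<le> n \<Longrightarrow> box m \<subseteq> box n"
  by (auto simp: box_def)

lemma keys_mult_box:
  assumes "Poly_Mapping.keys f \<subseteq> box m" "Poly_Mapping.keys g \<subseteq> box n"
  shows "Poly_Mapping.keys (f * g :: (nat, 'k::field) mpol) \<subseteq> box (m + n)"
proof
  fix \<kappa> assume "\<kappa> \<in> Poly_Mapping.keys (f * g)"
  then obtain s t where "\<kappa> = s + t" "s \<in> box m" "t \<in> box n" using keys_mult[of f g] assms by blast
  then show "\<kappa> \<in> box (m + n)" by (auto simp: box_def keys_plus_nat lookup_add)
qed

lemma keys_power_box:
  assumes "Poly_Mapping.keys f \<subseteq> box m"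
  shows "Poly_Mapping.keys (f ^ i :: (nat, 'k::field) mpol) \<subseteq> box (m * i)"
proof (induction i)
  case 0
  then show ?case by (simp add: box_def)
next
  case (Suc i)
  then show ?case using keys_mult_box[OF assms Suc] by simp
qed

lemma finite_in_box:
  assumes "finite U" "\<And>\<kappa>. \<kappa> \<in> U \<Longrightarrow> Poly_Mapping.keys \<kappa> \<subseteq> {0, 1}"
  shows "\<exists>D. U \<subseteq> box D"
  using assms
proof (induction U rule: finite_induct)
  case (insert \<kappa> U)
  then obtain D where D: "U \<subseteq> box D" by auto
  let ?D = "D + Poly_Mapping.lookup \<kappa> 0 + Poly_Mapping.lookup \<kappa> 1"
  have "\<kappa> \<in> box ?D" using insert.prems[of \<kappa>] by (simp add: box_def)
  moreover have "U \<subseteq> box ?D" using D box_mono[of D ?D] by auto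
  ultimately show ?case by blast
qed auto

lemma vector_space_mpol: "vector_space (\<lambda>a (f :: ('v, 'k::field) mpol). mpol_const a * f)"
  by unfold_locales (simp_all add: algebra_simps mpol_const_def single_add mult_single flip: mult.assoc)

lemma monomial_relation:
  fixes f0 f1 f2 :: "(nat, 'k::field) mpol"
  assumes "\<And>\<kappa>. \<kappa> \<in> Poly_Mapping.keys f0 \<union> Poly_Mapping.keys f1 \<union> Poly_Mapping.keys f2 \<Longrightarrow>
             Poly_Mapping.keys \<kappa> \<subseteq> {0, 1}"
  shows "\<exists>(T :: (nat \<times> nat \<times> nat) set) a. finite T \<and> T \<noteq> {} \<and> (\<forall>t\<in>T. a t \<noteq> 0) \<and>
     (\<Sum>t\<in>T. mpol_const (a t) * f0 ^ fst t * f1 ^ fst (snd t) * f2 ^ snd (snd t)) = 0"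
proof -
  interpret V: vector_space "\<lambda>a (f :: (nat, 'k) mpol). mpol_const a * f" by (rule vector_space_mpol)
  obtain D where D: "Poly_Mapping.keys f0 \<union> Poly_Mapping.keys f1 \<union> Poly_Mapping.keys f2 \<subseteq> box D"
    using finite_in_box[of "Poly_Mapping.keys f0 \<union> Poly_Mapping.keys f1 \<union> Poly_Mapping.keys f2"] assms by auto
  \<comment> \<open>This choice makes \<open>r > (3 D + 1) ^ 2\<close>. The \<open>r ^ 3\<close>
    products with exponents below \<open>r\<close> then outnumber the at most
    \<open>(3 r D + 1) ^ 2 \<le> r ^ 2 (3 D + 1) ^ 2\<close> exponents that can occur in
    them.\<close>
  define r where "r = (3 * D + 1) ^ 2 + 1"
  define I where "I = {..<r} \<times> {..<r} \<times> {..<r}"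
  define g where "g t = f0 ^ fst t * f1 ^ fst (snd t) * f2 ^ snd (snd t)" for t
  let ?B = "mon ` box (3 * r * D) :: (nat, 'k) mpol set"
  have in_span: "g t \<in> V.span ?B" if t: "t \<in> I" for t
  proof -
    obtain i j k where ijk: "t = (i, j, k)" "i < r" "j < r" "k < r" using t by (auto simp: I_def)
    have "Poly_Mapping.keys (g t) \<subseteq> box (D * i + D * j + D * k)"
      unfolding g_def ijk fst_conv snd_conv using D by (intro keys_mult_box keys_power_box) simp_all
    moreover have "D * i + D * j + D * k \<le> 3 * r * D"
      using mult_le_mono2[of "i + j + k" "3 * r" D] ijk by (simp add: algebra_simps)
    ultimately have k: "Poly_Mapping.keys (g t) \<subseteq> box (3 * r * D)" using box_mono by blast
    have "(\<Sum>\<kappa>\<in>Poly_Mapping.keys (g t). mpol_const (Poly_Mapping.lookup (g t) \<kappa>) * mon \<kappa>) \<in> V.span ?B"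
      using k by (intro V.span_sum V.span_scale V.span_base) auto
    then show ?thesis using mpol_expansion[of "g t"] by simp
  qed
  have "card ?B \<le> card (box (3 * r * D))" by (intro card_image_le box_finite)
  also have "\<dots> \<le> (3 * r * D + 1) ^ 2" by (rule card_box)
  also have "\<dots> \<le> (r * (3 * D + 1)) ^ 2" by (intro power_mono) (auto simp: r_def algebra_simps)
  also have "\<dots> = r ^ 2 * (3 * D + 1) ^ 2" by (rule power_mult_distrib)
  also have "\<dots> < r ^ 2 * r" by (intro mult_strict_left_mono) (auto simp: r_def)
  also have "\<dots> = card I" by (simp add: I_def power2_eq_square)
  finally have "card ?B < card I" .
  then obtain a where a: "\<exists>t\<in>I. a t \<noteq> 0" "(\<Sum>t\<in>I. mpol_const (a t) * g t) = 0"
    using V.linear_relation[of I ?B g] in_span box_finite by (auto simp: I_def)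
  let ?T = "{t\<in>I. a t \<noteq> 0}"
  have "(\<Sum>t\<in>?T. mpol_const (a t) * g t) = (\<Sum>t\<in>I. mpol_const (a t) * g t)"
    by (intro sum.mono_neutral_left) (auto simp: I_def mpol_const_def)
  then show ?thesis
    using a by (intro exI[of _ ?T] exI[of _ a]) (auto simp: g_def I_def mult.assoc)
qed

section \<open>Semigroup rings of plane semigroups\<close>

text \<open>The parameter \<open>K\<close> only fixes the coefficient field.\<close>

locale plane_semigroup =
  fixes S :: "(nat \<Rightarrow>\<^sub>0 nat) set" and c :: nat and K :: "'k::field itself"
  assumes plane: "s \<in> S \<Longrightarrow> Poly_Mapping.keys s \<subseteq> {0, 1}"
    and zero_S [simp]: "0 \<in> S" and add_S [simp]: "s \<in> S \<Longrightarrow> t \<in> S \<Longrightarrow> s + t \<in> S"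
    and c_pos: "0 < c"
    and axis0: "Poly_Mapping.single 0 c \<in> S" and axis1: "Poly_Mapping.single 1 c \<in> S"
begin

declare One_nat_def [simp del]

text \<open>\<open>ax 0 1\<close> and \<open>ax 1 1\<close> are \<alpha> and \<beta>; the first
  argument selects the axis, the second the multiple.\<close>

definition ax :: "nat \<Rightarrow> nat \<Rightarrow> nat \<Rightarrow>\<^sub>0 nat" where
  "ax v i = Poly_Mapping.single v (i * c)"

abbreviation A :: "(nat, 'k) mpol set" where "A \<equiv> monomial_algebra S"

sublocale subalgebra A mpol_const
  by (rule subalgebra_monomial_algebra) auto

lemma mem_A: "f \<in> A \<longleftrightarrow> Poly_Mapping.keys f \<subseteq> S"
  by (simp add: monomial_algebra_def)

lemma mon_in [simp]: "s \<in> S \<Longrightarrow> mon s \<in> A"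
  by (simp add: mem_A)

lemma ax_0 [simp]: "ax v 0 = 0"
  by (simp add: ax_def)

lemma ax_add: "ax v (i + j) = ax v i + ax v j"
  by (simp add: ax_def single_add algebra_simps)

lemma ax_Suc: "ax v (Suc i) = ax v 1 + ax v i"
  using ax_add[of v 1 i] by (simp only: plus_1_eq_Suc)

lemma ax_in [simp]: "v \<in> {0, 1} \<Longrightarrow> ax v i \<in> S"
proof (induction i)
  case (Suc i)
  have "ax v 1 \<in> S" using Suc.prems axis0 axis1 by (auto simp: ax_def)
  then show ?case using Suc by (simp add: ax_Suc)
qed auto

lemma mon_ax_power: "mon (ax v 1) ^ i = mon (ax v i)"
proof (induction i)
  case (Suc i)
  then show ?case by (simp add: mon_mult ax_Suc)
qed simp

lemma lookup_ax: "Poly_Mapping.lookup (ax v i) w = (if w = v then i * c else 0)"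
  by (auto simp: ax_def lookup_single)

text \<open>Within a class of exponents modulo \<open>c\<close>, reaching one from another by
  \<alpha> and \<beta> is a comparison of quotients, so Dickson's lemma applies to each of the
  \<open>c ^ 2\<close> classes. This serves for module generators, for leading exponents and for
  generators of the semigroup.\<close>

lemma residue_generators:
  assumes "Z \<subseteq> S"
  shows "\<exists>F\<subseteq>Z. finite F \<and> (\<forall>z\<in>Z. \<exists>f\<in>F. \<exists>i j. z = f + ax 0 i + ax 1 j)"
proof -
  let ?u = "\<lambda>z. Poly_Mapping.lookup z (0::nat)" and ?v = "\<lambda>z. Poly_Mapping.lookup z (1::nat)"
  define R where "R p q = {z\<in>Z. ?u z mod c = p \<and> ?v z mod c = q}" for p q
  have "\<exists>F. \<forall>p q. F p q \<subseteq> R p q \<and> finite (F p q) \<and>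
      (\<forall>z\<in>R p q. \<exists>f\<in>F p q. ?u f div c \<le> ?u z div c \<and> ?v f div c \<le> ?v z div c)"
    by (intro choice allI dickson_nat)
  then obtain F where F: "\<And>p q. F p q \<subseteq> R p q" "\<And>p q. finite (F p q)"
    "\<And>p q z. z \<in> R p q \<Longrightarrow> \<exists>f\<in>F p q. ?u f div c \<le> ?u z div c \<and> ?v f div c \<le> ?v z div c" by metis
  let ?F = "\<Union>p\<in>{..<c}. \<Union>q\<in>{..<c}. F p q"
  have 1: "?F \<subseteq> Z" using F(1) by (auto simp: R_def)
  have 2: "finite ?F" using F(2) by auto
  have 3: "\<exists>f\<in>?F. \<exists>i j. z = f + ax 0 i + ax 1 j" if z: "z \<in> Z" for z
  proof -
    let ?p = "?u z mod c" and ?q = "?v z mod c"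
    have "z \<in> R ?p ?q" using z by (simp add: R_def)
    then obtain f where f: "f \<in> F ?p ?q" "?u f div c \<le> ?u z div c" "?v f div c \<le> ?v z div c" using F(3) by blast
    then have fR: "f \<in> R ?p ?q" using F(1) by blast
    obtain i j where ij: "?u z div c = ?u f div c + i" "?v z div c = ?v f div c + j"
      using f(2,3) by (auto simp: le_iff_add)
    have "?u z = (?u f div c + i) * c + ?u f mod c" "?v z = (?v f div c + j) * c + ?v f mod c"
      using div_mult_mod_eq[of "?u z" c] div_mult_mod_eq[of "?v z" c] fR unfolding ij by (auto simp: R_def)
    then have "?u z = ?u f + i * c" "?v z = ?v f + j * c"
      using div_mult_mod_eq[of "?u f" c] div_mult_mod_eq[of "?v f" c] by (simp_all add: add_mult_distrib)
    moreover have "f \<in> S" "z \<in> S" using fR z assms by (auto simp: R_def)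
    moreover have "Poly_Mapping.keys (ax 0 i) \<subseteq> {0, 1}" "Poly_Mapping.keys (ax 1 j) \<subseteq> {0, 1}"
      by (auto simp: ax_def)
    ultimately have "z = f + ax 0 i + ax 1 j"
      using plane by (intro plane_eqI) (auto simp: lookup_add lookup_ax keys_plus_nat)
    moreover have "f \<in> ?F" using f(1) c_pos by (intro UN_I[of ?p] UN_I[of ?q]) auto
    ultimately show ?thesis by blast
  qed
  show ?thesis by (intro exI[of _ ?F] conjI ballI 1 2 3)
qed

text \<open>Every exponent in \<open>S\<close> is one of finitely many plus multiples of \<alpha>
  and \<beta>, so \<open>A\<close> is a finite module over the polynomials in the two axis
  monomials.\<close>

lemma finite_module_generators:
  "\<exists>H. finite H \<and> H \<subseteq> A \<and> A \<subseteq> lin_span mpol_const {h * mon (ax 0 1) ^ i * mon (ax 1 1) ^ j | h i j. h \<in> H}"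
proof -
  obtain G where G: "G \<subseteq> S" "finite G" "\<forall>s\<in>S. \<exists>g\<in>G. \<exists>i j. s = g + ax 0 i + ax 1 j"
    using residue_generators[of S] by blast
  let ?H = "mon ` G :: (nat, 'k) mpol set"
  have "mon ` S \<subseteq> {h * mon (ax 0 1) ^ i * mon (ax 1 1) ^ j | h i j. h \<in> ?H}"
  proof
    fix m :: "(nat, 'k) mpol" assume "m \<in> mon ` S"
    then obtain s where "s \<in> S" "m = mon s" by blast
    moreover from this obtain g i j where "g \<in> G" "s = g + ax 0 i + ax 1 j" using G(3) by blast
    ultimately have "g \<in> G" "m = mon (g + ax 0 i + ax 1 j)" by auto
    then show "m \<in> {h * mon (ax 0 1) ^ i * mon (ax 1 1) ^ j | h i j. h \<in> ?H}"
      by (intro CollectI exI[of _ "mon g"] exI[of _ i] exI[of _ j]) (simp add: mon_ax_power mon_mult)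
  qed
  then have "lin_span mpol_const (mon ` S)
      \<subseteq> lin_span mpol_const {h * mon (ax 0 1) ^ i * mon (ax 1 1) ^ j | h i j. h \<in> ?H}"
    by (rule lin_span_mono)
  then have "A \<subseteq> lin_span mpol_const {h * mon (ax 0 1) ^ i * mon (ax 1 1) ^ j | h i j. h \<in> ?H}"
    using monomial_algebra_span by (rule order_trans[rotated])
  moreover have "?H \<subseteq> A" using G(1) by auto
  moreover have "finite ?H" using G(2) by simp
  ultimately show ?thesis by (intro exI[of _ ?H] conjI)
qed

lemma dependent3_A: "f0 \<in> A \<Longrightarrow> f1 \<in> A \<Longrightarrow> f2 \<in> A \<Longrightarrow> dependent3 f0 f1 f2"
  unfolding dependent3_def by (rule monomial_relation, rule plane) (auto simp: mem_A)

subsection \<open>Noetherianity\<close>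

text \<open>The order on exponents is lexicographic with coordinate 0 first, and compatible with
  addition. The value at the zero polynomial is meaningless.\<close>

definition lead :: "(nat, 'k) mpol \<Rightarrow> nat \<Rightarrow>\<^sub>0 nat" where
  "lead f = Max (Poly_Mapping.keys f)"

lemma lead_in_keys: "f \<noteq> 0 \<Longrightarrow> lead f \<in> Poly_Mapping.keys f"
  unfolding lead_def by (intro Max_in) auto

lemma lead_in_S: "f \<in> A \<Longrightarrow> f \<noteq> 0 \<Longrightarrow> lead f \<in> S"
  using lead_in_keys[of f] by (auto simp: mem_A)

lemma less_plane:
  assumes "s < t" "s \<in> S" "t \<in> S"
  shows "Poly_Mapping.lookup s 0 < Poly_Mapping.lookup t 0 \<or>
    Poly_Mapping.lookup s 0 = Poly_Mapping.lookup t 0 \<and> Poly_Mapping.lookup s 1 < Poly_Mapping.lookup t 1"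
proof -
  obtain k where k: "Poly_Mapping.lookup s k < Poly_Mapping.lookup t k"
    "\<And>i. i < k \<Longrightarrow> Poly_Mapping.lookup s i = Poly_Mapping.lookup t i"
    using assms(1) by (auto simp: less_poly_mapping.rep_eq less_fun_def)
  then have "k \<in> Poly_Mapping.keys t" by (auto simp: in_keys_iff)
  then have "k \<in> {0, 1}" using plane[OF assms(3)] by blast
  then show ?thesis using k by auto
qed

text \<open>For exponents in the plane the order is the lexicographic one on pairs of naturals; with
  infinitely many variables it would not be well-founded.\<close>

lemma wf_S: "wf {(s, t). s \<in> S \<and> t \<in> S \<and> s < t}"
proof (rule wf_subset)
  show "wf (inv_image (less_than <*lex*> less_than)
      (\<lambda>s :: nat \<Rightarrow>\<^sub>0 nat. (Poly_Mapping.lookup s 0, Poly_Mapping.lookup s 1)))"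
    by (intro wf_inv_image wf_lex_prod wf_less_than)
qed (use less_plane in auto)

text \<open>As with Groebner bases, finitely many elements of \<open>I\<close> have leading
  exponents from which all others arise by adding multiples of \<alpha> and \<beta>. Subtracting a
  suitable multiple of one of them lowers the leading exponent, and well-foundedness ends the
  reduction.\<close>

lemma noetherian: "noetherian_ring (ring_on A)"
proof -
  interpret R: domain "ring_on A" by (rule domain_ring_on)
  show ?thesis
  proof (rule R.noetherian_ringI)
    fix I assume I: "ideal I (ring_on A)"
    then interpret I: subalgebra_ideal A mpol_const I by (rule subalgebra_idealI)
    have "lead ` (I - {0}) \<subseteq> S" using lead_in_S I.I_in by auto
    from residue_generators[OF this] obtain F where F: "F \<subseteq> lead ` (I - {0})" "finite F"
      "\<forall>z\<in>lead ` (I - {0}). \<exists>f\<in>F. \<exists>i j. z = f + ax 0 i + ax 1 j" by (elim exE conjE)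
    from finite_subset_image[OF F(2,1)] obtain B where B: "B \<subseteq> I - {0}" "finite B" "F = lead ` B" by (elim exE conjE)
    have BA: "B \<subseteq> carrier (ring_on A)" using B I.I_in by auto
    interpret J: subalgebra_ideal A mpol_const "Idl\<^bsub>ring_on A\<^esub> B"
      by (rule subalgebra_idealI[OF R.genideal_ideal[OF BA]])
    have "f \<in> Idl\<^bsub>ring_on A\<^esub> B" if "lead f = s" "f \<in> I" for f s
      using that
    proof (induction s arbitrary: f rule: wf_induct_rule[OF wf_S])
      case (1 s f)
      show ?case
      proof (cases "f = 0")
        case False
        then have "lead f \<in> lead ` (I - {0})" using 1 by blast
        then obtain b i j where b: "b \<in> B" "lead f = lead b + ax 0 i + ax 1 j" using F(3) B(3) by blast
        have b0: "b \<noteq> 0" "b \<in> I" using b B by auto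
        define \<mu> where "\<mu> = ax 0 i + ax 1 j"
        have \<mu>: "\<mu> \<in> S" by (simp add: \<mu>_def)
        have lf: "lead f = \<mu> + lead b" using b by (simp add: \<mu>_def ac_simps)
        \<comment> \<open>The quotient of the leading coefficients, so that the leading terms of
          \<open>f\<close> and \<open>t * b\<close> cancel.\<close>
        define a where "a = Poly_Mapping.lookup f (lead f) / Poly_Mapping.lookup b (lead b)"
        define t where "t = Poly_Mapping.single \<mu> a"
        have tA: "t \<in> A" using \<mu> by (simp add: t_def mem_A)
        define f' where "f' = f - t * b"
        have bJ: "b \<in> Idl\<^bsub>ring_on A\<^esub> B" using R.genideal_self[OF BA] b by blast
        have f'I: "f' \<in> I" unfolding f'_def using 1 tA b0 by (intro I.I_diff I.I_mult) auto
        have "f' \<in> Idl\<^bsub>ring_on A\<^esub> B"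
        proof (cases "f' = 0")
          case nz: False
          have "Poly_Mapping.lookup b (lead b) \<noteq> 0" using lead_in_keys[OF b0(1)] by (simp add: in_keys_iff)
          then have "Poly_Mapping.lookup f' (lead f) = 0"
            unfolding f'_def lf t_def lookup_minus lookup_single_mult by (simp add: a_def lf)
          then have ne: "lead f' \<noteq> lead f" using lead_in_keys[OF nz] by (auto simp: in_keys_iff)
          have "lead f' \<in> Poly_Mapping.keys f \<union> (\<lambda>s. \<mu> + s) ` Poly_Mapping.keys b"
            using lead_in_keys[OF nz] keys_minus_subset[of f "t * b"] keys_single_mult[of \<mu> a b]
            unfolding f'_def t_def by blast
          then have "lead f' \<le> lead f"
            unfolding lf by (auto simp: lead_def lf[unfolded lead_def, symmetric])
              (simp add: lf[unfolded lead_def] add_left_mono)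
          then have "lead f' < lead f" using ne by simp
          moreover have "lead f' \<in> S" "lead f \<in> S"
            using lead_in_S nz False I.I_in f'I "1.prems"(2) by auto
          ultimately show ?thesis using "1.IH"[of "lead f'" f'] "1.prems" f'I by auto
        qed simp
        then have "f' + t * b \<in> Idl\<^bsub>ring_on A\<^esub> B" using bJ tA by (intro J.I_add J.I_mult)
        then show ?thesis by (simp add: f'_def)
      qed simp
    qed
    then have "I \<subseteq> Idl\<^bsub>ring_on A\<^esub> B" by blast
    moreover have "Idl\<^bsub>ring_on A\<^esub> B \<subseteq> I" using B by (intro R.genideal_minimal I) auto
    ultimately show "\<exists>B\<subseteq>carrier (ring_on A). finite B \<and> I = Idl\<^bsub>ring_on A\<^esub> B" using BA B by blast
  qed
qed

subsection \<open>Regular sequences\<close>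

lemma lookup_ev_mult:
  "Poly_Mapping.lookup (ev (mon (ax v 1)) q * g) \<kappa>
     = (\<Sum>i\<le>degree q. Poly_Mapping.lookup (Poly_Mapping.single (ax v i) (coeff q i) * g) \<kappa>)"
  by (simp add: ev_altdef mon_ax_power const_mult_mon sum_distrib_right lookup_sum)

text \<open>Only the top term of \<open>q\<close> can reach \<open>s + ax v (degree q)\<close>: a
  lower term would need a key of \<open>g\<close> further along the axis \<open>v\<close> than
  \<open>s\<close>. So nothing cancels there.\<close>

lemma ev_leading_key:
  assumes q: "q \<noteq> 0" and s: "s \<in> Poly_Mapping.keys g"
    and max: "\<And>t. t \<in> Poly_Mapping.keys g \<Longrightarrow> Poly_Mapping.lookup t v \<le> Poly_Mapping.lookup s v"
  shows "s + ax v (degree q) \<in> Poly_Mapping.keys (ev (mon (ax v 1)) q * g)"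
proof -
  let ?r = "degree q"
  have coeff: "Poly_Mapping.lookup (Poly_Mapping.single (ax v i) (coeff q i) * g) (s + ax v ?r)
      = (if i = ?r then lead_coeff q * Poly_Mapping.lookup g s else 0)" if i: "i \<le> ?r" for i
  proof -
    have "s + ax v ?r = ax v i + (s + ax v (?r - i))" using i ax_add[of v i "?r - i"] by (simp add: ac_simps)
    then have "Poly_Mapping.lookup (Poly_Mapping.single (ax v i) (coeff q i) * g) (s + ax v ?r)
        = coeff q i * Poly_Mapping.lookup g (s + ax v (?r - i))" by (simp add: lookup_single_mult)
    moreover have "Poly_Mapping.lookup g (s + ax v (?r - i)) = 0" if "i \<noteq> ?r"
    proof (rule ccontr)
      assume "Poly_Mapping.lookup g (s + ax v (?r - i)) \<noteq> 0"
      then have "Poly_Mapping.lookup (s + ax v (?r - i)) v \<le> Poly_Mapping.lookup s v"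
        by (intro max) (simp add: in_keys_iff)
      then show False using i \<open>i \<noteq> ?r\<close> c_pos by (simp add: lookup_add lookup_ax)
    qed
    ultimately show ?thesis by auto
  qed
  have "Poly_Mapping.lookup (ev (mon (ax v 1)) q * g) (s + ax v ?r) = lead_coeff q * Poly_Mapping.lookup g s"
    unfolding lookup_ev_mult by (simp add: coeff sum.delta)
  then show ?thesis using q s by (simp add: in_keys_iff)
qed

lemma max_key_exists:
  assumes "g \<noteq> (0 :: (nat, 'k) mpol)"
  shows "\<exists>s\<in>Poly_Mapping.keys g. \<forall>t\<in>Poly_Mapping.keys g. Poly_Mapping.lookup t v \<le> Poly_Mapping.lookup s v"
proof -
  let ?l = "\<lambda>t. Poly_Mapping.lookup t v"
  have "Max (?l ` Poly_Mapping.keys g) \<in> ?l ` Poly_Mapping.keys g" using assms by (intro Max_in) auto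
  then obtain s where "s \<in> Poly_Mapping.keys g" "?l s = Max (?l ` Poly_Mapping.keys g)" by auto
  then show ?thesis by (intro bexI[of _ s]) auto
qed

lemma ev_nonzero: "q \<noteq> 0 \<Longrightarrow> ev (mon (ax v 1)) q \<noteq> 0"
  using ev_leading_key[of q 0 1 v] by auto

lemma keys_ev_mult:
  "Poly_Mapping.keys (ev (mon (ax v 1)) q * g) \<subseteq> {ax v i + k | i k. k \<in> Poly_Mapping.keys g}"
proof
  fix \<kappa> assume "\<kappa> \<in> Poly_Mapping.keys (ev (mon (ax v 1)) q * g)"
  then have "(\<Sum>i\<le>degree q. Poly_Mapping.lookup (Poly_Mapping.single (ax v i) (coeff q i) * g) \<kappa>) \<noteq> 0"
    by (simp add: in_keys_iff lookup_ev_mult)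
  then obtain i where "Poly_Mapping.lookup (Poly_Mapping.single (ax v i) (coeff q i) * g) \<kappa> \<noteq> 0"
    by (meson sum.neutral)
  then have "\<kappa> \<in> (\<lambda>s. ax v i + s) ` Poly_Mapping.keys g"
    using keys_single_mult[of "ax v i" "coeff q i" g] by (auto simp flip: in_keys_iff)
  then show "\<kappa> \<in> {ax v i + k | i k. k \<in> Poly_Mapping.keys g}" by blast
qed

lemma add_eq_of_neg: "x = - y + z \<Longrightarrow> z = x + y" for x y z :: "(nat, 'k) mpol"
  by simp

text \<open>If \<open>s = t + ax 1 r\<close> with \<open>t\<close> in \<open>S\<close> and
  \<open>r\<close> the degree of \<open>q\<close>, then \<open>q\<close> at the axis monomial, times
  \<open>mon t\<close>, expresses \<open>mon s\<close> through monomials of smaller second exponent,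
  to which the induction applies. Divisibility is meant within \<open>S\<close>, so a remainder may
  have large exponents that are not of this form.\<close>

lemma division_mon:
  assumes q: "q \<noteq> 0" and s: "s \<in> S"
  shows "\<exists>g\<in>A. \<exists>f\<in>A. mon s = ev (mon (ax 1 1)) q * g + f \<and>
    Poly_Mapping.keys f \<inter> {t + ax 1 (degree q) | t. t \<in> S} = {}"
  using s
proof (induction "Poly_Mapping.lookup s 1" arbitrary: s rule: less_induct)
  case less
  let ?r = "degree q" and ?Q = "ev (mon (ax 1 1)) q" and ?T = "{t + ax 1 (degree q) | t. t \<in> S}"
  show ?case
  proof (cases "s \<in> ?T")
    case False
    then show ?thesis using less.prems by (intro bexI[of _ 0] bexI[of _ "mon s"]) auto
  next
    case True
    then obtain t where t: "t \<in> S" "s = t + ax 1 ?r" by blast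
    have dec: "\<exists>g\<in>A. \<exists>f\<in>A. mon (t + ax 1 i) = ?Q * g + f \<and> Poly_Mapping.keys f \<inter> ?T = {}"
      if i: "i < ?r" for i
    proof -
      have "Poly_Mapping.lookup (t + ax 1 i) 1 < Poly_Mapping.lookup s 1"
        using t i c_pos by (simp add: lookup_add lookup_ax)
      then show ?thesis using t(1) by (intro less.hyps) auto
    qed
    have "\<forall>i. \<exists>g. i < ?r \<longrightarrow> g \<in> A \<and>
        (\<exists>f\<in>A. mon (t + ax 1 i) = ?Q * g + f \<and> Poly_Mapping.keys f \<inter> ?T = {})"
      using dec by blast
    from choice[OF this] obtain g where g: "\<forall>i. i < ?r \<longrightarrow> g i \<in> A \<and>
        (\<exists>f\<in>A. mon (t + ax 1 i) = ?Q * g i + f \<and> Poly_Mapping.keys f \<inter> ?T = {})" by (rule exE)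
    then have "\<forall>i. \<exists>f. i < ?r \<longrightarrow> f \<in> A \<and> mon (t + ax 1 i) = ?Q * g i + f \<and>
        Poly_Mapping.keys f \<inter> ?T = {}" by blast
    from choice[OF this] obtain f where f: "\<forall>i. i < ?r \<longrightarrow> f i \<in> A \<and>
        mon (t + ax 1 i) = ?Q * g i + f i \<and> Poly_Mapping.keys (f i) \<inter> ?T = {}" by (rule exE)
    note gf = g[rule_format, THEN conjunct1] f[rule_format, THEN conjunct1]
      f[rule_format, THEN conjunct2, THEN conjunct1] f[rule_format, THEN conjunct2, THEN conjunct2]
    \<comment> \<open>The coefficients of the lower powers once the relation is solved for the top
      power.\<close>
    let ?a = "\<lambda>i. mpol_const (- coeff q i / lead_coeff q) :: (nat, 'k) mpol"
    let ?l = "mpol_const (1 / lead_coeff q) :: (nat, 'k) mpol"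
    have "?Q = (\<Sum>i<?r. mpol_const (coeff q i) * mon (ax 1 i)) + mpol_const (lead_coeff q) * mon (ax 1 ?r)"
      by (simp add: ev_altdef mon_ax_power lessThan_Suc_atMost[symmetric])
    then have eq: "?l * ?Q * mon t = (\<Sum>i<?r. ?l * mpol_const (coeff q i) * mon (t + ax 1 i))
        + ?l * mpol_const (lead_coeff q) * mon (t + ax 1 ?r)"
      by (simp add: algebra_simps sum_distrib_left sum_distrib_right flip: mon_mult)
    have lc: "?l * mpol_const (lead_coeff q) = 1" using q by (simp flip: C_mult)
    have la: "?l * mpol_const (coeff q i) = - ?a i" for i by (simp flip: C_mult C_uminus)
    have "?l * ?Q * mon t = - (\<Sum>i<?r. ?a i * mon (t + ax 1 i)) + mon s"
      using eq[unfolded lc] unfolding la t(2) by (simp only: sum_negf mult_minus_left mult_1_left)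
    then have "mon s = ?l * ?Q * mon t + (\<Sum>i<?r. ?a i * mon (t + ax 1 i))"
      by (rule add_eq_of_neg)
    also have "?l * ?Q * mon t = ?Q * (?l * mon t)" by (simp only: mult_ac)
    also have "(\<Sum>i<?r. ?a i * mon (t + ax 1 i)) = ?Q * (\<Sum>i<?r. ?a i * g i) + (\<Sum>i<?r. ?a i * f i)"
      using gf(3) by (simp add: sum_distrib_left algebra_simps flip: sum.distrib)
    finally have e: "mon s = ?Q * (?l * mon t + (\<Sum>i<?r. ?a i * g i)) + (\<Sum>i<?r. ?a i * f i)"
      by (simp add: algebra_simps)
    have k: "Poly_Mapping.keys (\<Sum>i<?r. ?a i * f i) \<subseteq> - ?T"
      using gf(4) by (intro keys_sum_subset) (fastforce simp: in_keys_iff)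
    have "?l * mon t + (\<Sum>i<?r. ?a i * g i) \<in> A" "(\<Sum>i<?r. ?a i * f i) \<in> A"
      using t gf(1,2) by (auto intro!: sum_in add_in mult_in)
    moreover have "Poly_Mapping.keys (\<Sum>i<?r. ?a i * f i) \<inter> ?T = {}" using k by blast
    ultimately show ?thesis using e by blast
  qed
qed

lemma division:
  assumes q: "q \<noteq> 0" and h: "h \<in> A"
  shows "\<exists>g\<in>A. \<exists>f\<in>A. h = ev (mon (ax 1 1)) q * g + f \<and>
    Poly_Mapping.keys f \<inter> {t + ax 1 (degree q) | t. t \<in> S} = {}"
proof -
  let ?T = "{t + ax 1 (degree q) | t. t \<in> S}"
  have "h \<in> lin_span mpol_const (mon ` S)" using h monomial_algebra_span by blast
  then show ?thesis
  proof (induction rule: lin_span.induct)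
    case zero
    then show ?case by (intro bexI[of _ 0]) auto
  next
    case (step b v a)
    then obtain g f where gf: "g \<in> A" "f \<in> A" "v = ev (mon (ax 1 1)) q * g + f" "Poly_Mapping.keys f \<inter> ?T = {}"
      by blast
    obtain g' f' where gf': "g' \<in> A" "f' \<in> A" "b = ev (mon (ax 1 1)) q * g' + f'" "Poly_Mapping.keys f' \<inter> ?T = {}"
      using division_mon[OF q] step(1) by blast
    have e: "mpol_const a * b + v = ev (mon (ax 1 1)) q * (mpol_const a * g' + g) + (mpol_const a * f' + f)"
      unfolding gf gf' by (simp add: algebra_simps)
    have "Poly_Mapping.keys (mpol_const a * f' + f) \<subseteq> Poly_Mapping.keys f' \<union> Poly_Mapping.keys f"
      by (auto simp: in_keys_iff lookup_add)
    then have "Poly_Mapping.keys (mpol_const a * f' + f) \<inter> ?T = {}" using gf(4) gf'(4) by blast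
    moreover have "mpol_const a * g' + g \<in> A" "mpol_const a * f' + f \<in> A" using gf gf' by auto
    ultimately show ?case using e by blast
  qed
qed

text \<open>\<open>s\<close> runs over pairs of naturals, which misses no hole in the integer plane:
  \<beta> leaves the first entry alone and \<alpha> the second, so membership of both translates
  makes the entries of \<open>s\<close> nonnegative.\<close>

definition saturated where
  "saturated \<longleftrightarrow> (\<forall>s. Poly_Mapping.keys s \<subseteq> {0, 1} \<longrightarrow> s + ax 0 1 \<in> S \<longrightarrow> s + ax 1 1 \<in> S \<longrightarrow> s \<in> S)"

text \<open>When \<open>i\<close> and \<open>j\<close> are positive, \<open>s + \<alpha>\<close> and
  \<open>s + \<beta>\<close> satisfy the hypotheses with a smaller sum \<open>i + j\<close>. By
  induction they lie in \<open>S\<close>, and then so does \<open>s\<close>.\<close>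

lemma saturated_iterate:
  assumes saturated "Poly_Mapping.keys s \<subseteq> {0, 1}" "s + ax 0 i \<in> S" "s + ax 1 j \<in> S"
  shows "s \<in> S"
  using assms(2-)
proof (induction "i + j" arbitrary: i j s)
  case (Suc n)
  show ?case
  proof (cases "i = 0 \<or> j = 0")
    case True
    then show ?thesis using Suc by auto
  next
    case False
    then obtain i' j' where ij: "i = Suc i'" "j = Suc j'" by (auto simp: gr0_conv_Suc)
    have keys: "Poly_Mapping.keys (s + ax v 1) \<subseteq> {0, 1}" if "v \<in> {0, 1}" for v
      using that Suc.prems(1) by (auto simp: keys_plus_nat ax_def split: if_splits)
    have "s + ax 0 1 + ax 0 i' \<in> S" using Suc.prems(2) unfolding ij ax_Suc by (simp add: add.assoc)
    moreover have "s + ax 0 1 + ax 1 j \<in> S" using Suc.prems add_S[of "s + ax 1 j" "ax 0 1"] by (simp add: ac_simps)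
    ultimately have "s + ax 0 1 \<in> S" using Suc.hyps(1)[of i' j "s + ax 0 1"] Suc.hyps(2) ij keys[of 0] by auto
    moreover have "s + ax 1 1 + ax 1 j' \<in> S" using Suc.prems(3) unfolding ij ax_Suc by (simp add: add.assoc)
    moreover have "s + ax 1 1 + ax 0 i \<in> S" using Suc.prems add_S[of "s + ax 0 i" "ax 1 1"] by (simp add: ac_simps)
    ultimately have "s + ax 0 1 \<in> S" "s + ax 1 1 \<in> S"
      using Suc.hyps(1)[of i j' "s + ax 1 1"] Suc.hyps(2) ij keys[of 1] by auto
    then show ?thesis using assms(1) Suc.prems(1) by (auto simp: saturated_def)
  qed
qed auto

text \<open>Let \<open>f0\<close> be the remainder of \<open>f\<close>. If the new cofactor
  \<open>g'\<close> is nonzero, its key \<open>s\<close> of largest second entry gives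
  \<open>s + r\<beta> = i\<alpha> + k\<close> with \<open>k\<close> a key of \<open>f0\<close>. Then
  \<open>t = k - r\<beta>\<close> has \<open>t + i\<alpha> = s\<close> and
  \<open>t + r\<beta> = k\<close> in \<open>S\<close>, so saturation puts \<open>t\<close> into
  \<open>S\<close>, although \<open>f0\<close> is reduced.\<close>

lemma regular_pair:
  assumes sat: saturated and p: "p \<noteq> 0" and q: "q \<noteq> 0" and fg: "f \<in> A" "g \<in> A"
    and e: "ev (mon (ax 0 1)) p * f = ev (mon (ax 1 1)) q * g"
  shows "\<exists>h\<in>A. f = ev (mon (ax 1 1)) q * h"
proof -
  let ?P = "ev (mon (ax 0 1)) p" and ?Q = "ev (mon (ax 1 1)) q" and ?r = "degree q"
  have PQ: "?P \<in> A" "?Q \<in> A" by (simp_all add: ev_in)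
  obtain f1 f0 where f: "f1 \<in> A" "f0 \<in> A" "f = ?Q * f1 + f0"
    and red: "Poly_Mapping.keys f0 \<inter> {t + ax 1 ?r | t. t \<in> S} = {}" using division[OF q fg(1)] by blast
  define g' where "g' = g - ?P * f1"
  have e': "?P * f0 = ?Q * g'" using e unfolding f(3) g'_def by (simp add: algebra_simps)
  have g'A: "g' \<in> A" using fg f PQ by (auto simp: g'_def)
  have "g' = 0"
  proof (rule ccontr)
    assume "g' \<noteq> 0"
    then obtain s where s: "s \<in> Poly_Mapping.keys g'"
      "\<And>t. t \<in> Poly_Mapping.keys g' \<Longrightarrow> Poly_Mapping.lookup t 1 \<le> Poly_Mapping.lookup s 1"
      using max_key_exists by blast
    then have "s + ax 1 ?r \<in> Poly_Mapping.keys (?P * f0)" unfolding e' using ev_leading_key[OF q] by blast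
    then obtain i k where k: "s + ax 1 ?r = ax 0 i + k" "k \<in> Poly_Mapping.keys f0" using keys_ev_mult by blast
    have S: "s \<in> S" "k \<in> S" using s k f(2) g'A by (auto simp: mem_A)
    define t where "t = k - ax 1 ?r"
    \<comment> \<open>Comparing second entries shows that the truncated subtraction defining
      \<open>t\<close> is a true one.\<close>
    have le: "Poly_Mapping.lookup (ax 1 ?r) w \<le> Poly_Mapping.lookup k w" for w
      using arg_cong[OF k(1), of "\<lambda>m. Poly_Mapping.lookup m 1"] by (simp add: lookup_add lookup_ax)
    have kt: "k = t + ax 1 ?r"
      using le by (intro poly_mapping_eqI) (simp add: t_def lookup_add lookup_minus)
    have "Poly_Mapping.keys t \<subseteq> {0, 1}" using plane[OF S(2)] unfolding kt keys_plus_nat by blast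
    moreover have "s = ax 0 i + t" using k(1) unfolding kt by (simp flip: add.assoc)
    then have "t + ax 0 i = s" by (simp add: add.commute)
    ultimately have "t \<in> S" using saturated_iterate[OF sat, of t i ?r] S kt by auto
    then show False using red k(2) kt by blast
  qed
  then have "f0 = 0" using e' ev_nonzero[OF p, of 0] by simp
  then show ?thesis using f by auto
qed

subsection \<open>Primes spanned by monomials\<close>

text \<open>For a face \<open>F\<close> of the semigroup this is the kernel of the projection of
  \<open>K[S]\<close> onto the semigroup ring of \<open>F\<close>.\<close>

definition off_face where
  "off_face F = {f\<in>A. Poly_Mapping.keys f \<inter> F = {}}"

text \<open>Split each factor into its part on \<open>F\<close> and the rest. For two elements
  outside the ideal the parts on \<open>F\<close> are nonzero, so their product is nonzero and
  supported on \<open>F\<close>, and all other contributions to \<open>f * g\<close> avoid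
  \<open>F\<close>.\<close>

lemma off_face_prime:
  assumes F: "F \<subseteq> S" "0 \<in> F" "\<And>s t. \<lbrakk>s \<in> S; t \<in> S\<rbrakk> \<Longrightarrow> s + t \<in> F \<longleftrightarrow> s \<in> F \<and> t \<in> F"
  shows "primeideal (off_face F) (ring_on A)"
proof (rule primeidealI)
  show "cring (ring_on A)" by (rule cring_ring_on)
  have key: "Poly_Mapping.keys (f * g) \<inter> F = {}" if fg: "f \<in> A" "g \<in> off_face F" for f g
  proof -
    have "\<kappa> \<notin> F" if "\<kappa> \<in> Poly_Mapping.keys (f * g)" for \<kappa>
    proof -
      obtain s t where "\<kappa> = s + t" "s \<in> Poly_Mapping.keys f" "t \<in> Poly_Mapping.keys g"
        using \<open>\<kappa> \<in> _\<close> keys_mult[of f g] by blast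
      then show ?thesis using fg F(3)[of s t] by (auto simp: off_face_def mem_A)
    qed
    then show ?thesis by blast
  qed
  show "ideal (off_face F) (ring_on A)"
  proof (rule cring.idealI_closed[OF cring_ring_on])
    show "a \<oplus>\<^bsub>ring_on A\<^esub> b \<in> off_face F" if "a \<in> off_face F" "b \<in> off_face F" for a b
      using that keys_add[of a b] by (auto simp: off_face_def)
    show "x \<otimes>\<^bsub>ring_on A\<^esub> a \<in> off_face F" if "a \<in> off_face F" "x \<in> carrier (ring_on A)" for a x
      using that key[of x a] by (auto simp: off_face_def)
  qed (auto simp: off_face_def)
  have "1 \<notin> off_face F" using F by (auto simp: off_face_def)
  then show "carrier (ring_on A) \<noteq> off_face F" by auto
  fix f g assume fg: "f \<in> carrier (ring_on A)" "g \<in> carrier (ring_on A)" "f \<otimes>\<^bsub>ring_on A\<^esub> g \<in> off_face F"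
  define on where "on h = (\<Sum>\<kappa>\<in>Poly_Mapping.keys h \<inter> F. Poly_Mapping.single \<kappa> (Poly_Mapping.lookup h \<kappa>))"
    for h :: "(nat, 'k) mpol"
  have lookup_on: "Poly_Mapping.lookup (on h) \<kappa> = (if \<kappa> \<in> F then Poly_Mapping.lookup h \<kappa> else 0)" for h \<kappa>
  proof -
    have "Poly_Mapping.lookup (on h) \<kappa>
        = (\<Sum>\<mu>\<in>Poly_Mapping.keys h \<inter> F. if \<mu> = \<kappa> then Poly_Mapping.lookup h \<mu> else 0)"
      unfolding on_def lookup_sum by (intro sum.cong) (auto simp: lookup_single)
    then show ?thesis by (auto simp: in_keys_iff)
  qed
  have keys_on: "Poly_Mapping.keys (on h) = Poly_Mapping.keys h \<inter> F" for h
    by (auto simp: in_keys_iff lookup_on split: if_splits)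
  have on_A: "on h \<in> A" for h using F(1) by (auto simp: mem_A keys_on)
  have off: "h - on h \<in> off_face F" if h: "h \<in> A" for h
  proof -
    have "\<kappa> \<notin> Poly_Mapping.keys (h - on h)" if "\<kappa> \<in> F" for \<kappa>
      using that by (simp add: in_keys_iff lookup_minus lookup_on)
    then show ?thesis using h on_A[of h] diff_in[of h "on h"] by (auto simp: off_face_def)
  qed
  show "f \<in> off_face F \<or> g \<in> off_face F"
  proof (rule ccontr)
    assume "\<not> ?thesis"
    then have "Poly_Mapping.keys (on f) \<noteq> {}" "Poly_Mapping.keys (on g) \<noteq> {}"
      using fg(1,2) by (auto simp: off_face_def keys_on)
    then have "on f \<noteq> 0" "on g \<noteq> 0" by auto
    then have "on f * on g \<noteq> 0" by simp
    then obtain \<kappa> where \<kappa>: "\<kappa> \<in> Poly_Mapping.keys (on f * on g)" by (metis all_not_in_conv keys_eq_empty)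
    then obtain s t where st: "\<kappa> = s + t" "s \<in> Poly_Mapping.keys (on f)" "t \<in> Poly_Mapping.keys (on g)"
      using keys_mult[of "on f" "on g"] by blast
    have \<kappa>F: "\<kappa> \<in> F" using st F(1) F(3)[of s t] keys_on by auto
    have "f * g = on f * on g + (on f * (g - on g) + g * (f - on f))" by (simp add: algebra_simps)
    then have "Poly_Mapping.lookup (f * g) \<kappa> = Poly_Mapping.lookup (on f * on g) \<kappa>
        + (Poly_Mapping.lookup (on f * (g - on g)) \<kappa> + Poly_Mapping.lookup (g * (f - on f)) \<kappa>)"
      by (simp only: lookup_add)
    moreover have "Poly_Mapping.lookup (on f * (g - on g)) \<kappa> = 0" "Poly_Mapping.lookup (g * (f - on f)) \<kappa> = 0"
      using key[OF on_A off[of g], of f] key[OF _ off[of f], of g] fg \<kappa>F by (auto simp: in_keys_iff)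
    ultimately show False using \<kappa> fg(3) \<kappa>F by (auto simp: off_face_def in_keys_iff disjoint_iff)
  qed
qed

abbreviation "M0 \<equiv> off_face {0}"

lemma plus_eq_0_iff: "s + t = 0 \<longleftrightarrow> s = 0 \<and> t = 0" for s t :: "nat \<Rightarrow>\<^sub>0 nat"
  by (auto simp: poly_mapping_eq_iff fun_eq_iff lookup_add)

lemma M0_prime: "primeideal M0 (ring_on A)"
  by (rule off_face_prime) (auto simp: plus_eq_0_iff)

text \<open>An element outside \<open>M0\<close> differs from its nonzero constant term by an
  element of \<open>M0\<close>, so an ideal strictly above \<open>M0\<close> contains a nonzero
  constant.\<close>

lemma M0_maximal: "maximalideal M0 (ring_on A)"
proof (rule maximalidealI)
  show "ideal M0 (ring_on A)" by (rule primeideal.axioms(1)[OF M0_prime])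
  show "carrier (ring_on A) \<noteq> M0" by (rule primeideal.I_notcarr[OF M0_prime])
  fix J assume J: "ideal J (ring_on A)" "M0 \<subseteq> J" "J \<subseteq> carrier (ring_on A)"
  interpret J: subalgebra_ideal A mpol_const J by (rule subalgebra_idealI) fact
  have "J = A" if "J \<noteq> M0"
  proof -
    obtain f where f: "f \<in> J" "f \<notin> M0" using J \<open>J \<noteq> M0\<close> by blast
    let ?a = "Poly_Mapping.lookup f 0"
    have fA: "f \<in> A" using f J.I_in by blast
    have a: "?a \<noteq> 0" using f fA by (auto simp: off_face_def in_keys_iff)
    have "f - mpol_const ?a \<in> M0"
      using diff_in[OF fA C_in[of ?a]] by (simp add: off_face_def in_keys_iff lookup_minus mpol_const_def)
    then have "f - mpol_const ?a \<in> J" using J(2) by blast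
    then have "f - (f - mpol_const ?a) \<in> J" by (rule J.I_diff[OF f(1)])
    then show ?thesis using C_notin_proper_ideal[OF J(1) _ a] by auto
  qed
  then show "J = M0 \<or> J = carrier (ring_on A)" by auto
qed

lemma ax_eq_0_iff: "ax v i = 0 \<longleftrightarrow> i = 0"
  using c_pos by (auto simp: poly_mapping_eq_iff fun_eq_iff lookup_ax)

text \<open>The exponents on the second axis form a face strictly between \<open>{0}\<close> and
  \<open>S\<close>; it supplies the middle prime of a chain of length two ending at the irrelevant
  ideal.\<close>

lemma axis_prime: "primeideal (off_face {s\<in>S. Poly_Mapping.lookup s 0 = 0}) (ring_on A)"
  by (rule off_face_prime) (auto simp: lookup_add)

lemma axis_prime_nonzero: "off_face {s\<in>S. Poly_Mapping.lookup s 0 = 0} \<noteq> {0}"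
proof -
  have "mon (ax 0 1) \<in> off_face {s\<in>S. Poly_Mapping.lookup s 0 = 0}"
    using c_pos by (auto simp: off_face_def lookup_ax)
  then show ?thesis using mon_nonzero by blast
qed

lemma axis_prime_psubset: "off_face {s\<in>S. Poly_Mapping.lookup s 0 = 0} \<subset> M0"
proof -
  have "mon (ax 1 1) \<in> M0 - off_face {s\<in>S. Poly_Mapping.lookup s 0 = 0}"
    using c_pos by (auto simp: off_face_def lookup_ax ax_eq_0_iff)
  moreover have "off_face {s\<in>S. Poly_Mapping.lookup s 0 = 0} \<subseteq> M0" by (auto simp: off_face_def)
  ultimately show ?thesis by blast
qed

subsection \<open>The Cohen-Macaulay criterion\<close>

text \<open>The pair is \<open>q\<close> at the second axis monomial followed by \<open>p\<close> at
  the first; the Nullstellensatz, applied once for each axis, puts both into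
  \<open>M\<close>.\<close>

lemma saturated_regular_pair:
  assumes K: "infinite (UNIV :: 'k set)" and sat: saturated and M: "maximalideal M (ring_on A)"
  shows "\<exists>x\<in>M. \<exists>y\<in>M. x \<noteq> 0 \<and> (\<forall>f\<in>A. \<forall>g\<in>A. y * f = x * g \<longrightarrow> (\<exists>h\<in>A. f = x * h))"
proof -
  interpret R: domain "ring_on A" by (rule domain_ring_on)
  interpret M: maximalideal M "ring_on A" by fact
  \<comment> \<open>The Nullstellensatz starts from a nonzero element of \<open>M\<close>; zero is
    not maximal since \<open>M0\<close> lies strictly above it.\<close>
  have "M \<noteq> {0}"
  proof
    assume "M = {0}"
    have I: "ideal M0 (ring_on A)" by (rule primeideal.axioms(1)[OF M0_prime])
    have "M \<subseteq> M0" using \<open>M = {0}\<close> by (auto simp: off_face_def)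
    then have "M0 = M \<or> M0 = A" using M.I_maximal[OF I] ideal.Icarr[OF I] by auto
    moreover have "mon (ax 0 1) \<in> M0" by (simp add: off_face_def ax_eq_0_iff)
    then have "M0 \<noteq> M" using \<open>M = {0}\<close> mon_nonzero by (metis singletonD)
    moreover have "1 \<notin> M0" by (simp add: off_face_def)
    then have "M0 \<noteq> A" using one_in by metis
    ultimately show False by blast
  qed
  moreover have "0 \<in> M" by (rule subalgebra_ideal.I_zero[OF subalgebra_idealI[OF M.is_ideal]])
  ultimately obtain f where f: "f \<in> M" "f \<noteq> 0" by blast
  have fA: "f \<in> A" using f M.Icarr by simp
  obtain H where H: "finite H" "H \<subseteq> A"
    "A \<subseteq> lin_span mpol_const {h * mon (ax 0 1) ^ i * mon (ax 1 1) ^ j | h i j. h \<in> H}"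
    using finite_module_generators by (elim exE conjE)
  have pt: "subalgebra_point A mpol_const M (mon (ax v 1))" if "v \<in> {0, 1}" for v
    using that subalgebra_idealI[OF M.is_ideal]
    by (simp add: subalgebra_point_def subalgebra_point_axioms_def)
  have swap: "{h * mon (ax 0 1) ^ i * mon (ax 1 1) ^ j | h i j. h \<in> H}
      = {h * mon (ax 1 1) ^ i * mon (ax 0 1) ^ j | h i j. h \<in> H}"
    by (subst mult.assoc, subst mult.assoc, subst mult.commute[of "_ ^ _"]) blast
  have pt0: "subalgebra_point A mpol_const M (mon (ax 0 1))"
    and pt1: "subalgebra_point A mpol_const M (mon (ax 1 1))" by (auto intro: pt)
  have axA: "mon (ax 0 1) \<in> A" "mon (ax 1 1) \<in> A" by simp_all
  obtain p where p: "p \<noteq> 0" "ev (mon (ax 0 1)) p \<in> M"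
    using subalgebra_point.maximal_contains_univariate[OF pt0 K M f axA(2) H
        dependent3_A[OF fA axA(1,2)]] by (elim exE conjE)
  obtain q where q: "q \<noteq> 0" "ev (mon (ax 1 1)) q \<in> M"
    using subalgebra_point.maximal_contains_univariate[OF pt1 K M f axA(1) H(1,2) H(3)[unfolded swap]
        dependent3_A[OF fA axA(2,1)]] by (elim exE conjE)
  show ?thesis
    by (intro bexI[OF _ q(2)] bexI[OF _ p(2)] conjI ev_nonzero[OF q(1)] ballI impI
      regular_pair[OF sat p(1) q(1)])
qed

declare sum_constant [simp del]

text \<open>With \<open>g = (u, v)\<close> the sum of \<open>c\<close> copies is
  \<open>u\<alpha> + v\<beta>\<close>, and \<open>u\<close> or \<open>v\<close> is positive, so
  \<open>s + \<alpha>\<close> or \<open>s + \<beta>\<close> can be split off.\<close>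

lemma add_multiple_axes:
  assumes s: "s + ax 0 1 \<in> S" "s + ax 1 1 \<in> S" and g: "g \<in> S" "g \<noteq> 0"
  shows "s + (\<Sum>i<c. g) \<in> S"
proof -
  let ?u = "Poly_Mapping.lookup g 0" and ?v = "Poly_Mapping.lookup g 1"
  define m where "m = (\<Sum>i<c. g)"
  have lookup_m: "Poly_Mapping.lookup m w = c * Poly_Mapping.lookup g w" for w
    unfolding m_def lookup_sum by (simp add: sum_constant)
  have "Poly_Mapping.keys m \<subseteq> Poly_Mapping.keys g" by (auto simp: in_keys_iff lookup_m)
  then have "Poly_Mapping.keys m \<subseteq> {0, 1}" using plane[OF g(1)] by blast
  moreover have "Poly_Mapping.keys (ax 0 ?u + ax 1 ?v) \<subseteq> {0, 1}" by (auto simp: keys_plus_nat ax_def)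
  ultimately have "m = ax 0 ?u + ax 1 ?v"
    by (rule plane_eqI) (simp_all add: lookup_m lookup_add lookup_ax)
  then have e: "(\<Sum>i<c. g) = ax 0 ?u + ax 1 ?v" by (simp only: m_def)
  have "?u \<noteq> 0 \<or> ?v \<noteq> 0"
    using g plane_eqI[of g 0] plane[of g] by auto
  then show ?thesis
  proof
    assume "?u \<noteq> 0"
    then have "ax 0 ?u = ax 0 1 + ax 0 (?u - 1)" using ax_add[of 0 1 "?u - 1"] by simp
    then have "s + (\<Sum>i<c. g) = (s + ax 0 1) + (ax 0 (?u - 1) + ax 1 ?v)" unfolding e by (simp add: ac_simps)
    also have "\<dots> \<in> S" by (rule add_S[OF s(1)]) simp
    finally show ?thesis .
  next
    assume "?v \<noteq> 0"
    then have "ax 1 ?v = ax 1 1 + ax 1 (?v - 1)" using ax_add[of 1 1 "?v - 1"] by simp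
    then have "s + (\<Sum>i<c. g) = (s + ax 1 1) + (ax 0 ?u + ax 1 (?v - 1))" unfolding e by (simp add: ac_simps)
    also have "\<dots> \<in> S" by (rule add_S[OF s(2)]) simp
    finally show ?thesis .
  qed
qed

text \<open>The elements of \<open>G\<close> are treated one at a time: copies of \<open>g\<close>
  are added as long as the result stays outside \<open>S\<close>, which ends within \<open>c\<close>
  copies by \<open>add_multiple_axes\<close>. Conditions already achieved persist, since adding
  elements of \<open>S\<close> preserves membership.\<close>

lemma maximal_translate:
  assumes s: "s + ax 0 1 \<in> S" "s + ax 1 1 \<in> S" "s \<notin> S" and G: "finite G" "G \<subseteq> S - {0}"
  shows "\<exists>e\<in>S. s + e \<notin> S \<and> (\<forall>g\<in>G. s + e + g \<in> S)"
  using G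
proof (induction G rule: finite_induct)
  case empty
  then show ?case using s by (intro bexI[of _ 0]) auto
next
  case (insert g G)
  then obtain e where e: "e \<in> S" "s + e \<notin> S" "\<And>g. g \<in> G \<Longrightarrow> s + e + g \<in> S" by blast
  let ?P = "\<lambda>k::nat. s + e + (\<Sum>i<k. g) \<in> S"
  have "?P c"
    using add_S[OF add_multiple_axes[OF s(1,2), of g] e(1)] insert.prems by (simp add: ac_simps)
  then have L: "?P (LEAST k. ?P k)" by (rule LeastI[of ?P])
  have "(LEAST k. ?P k) \<noteq> 0" using L e(2) by (intro notI) simp
  then obtain k where k: "(LEAST k. ?P k) = Suc k" using not0_implies_Suc by blast
  have nk: "\<not> ?P k" using not_less_Least[of k ?P] k by simp
  have gk: "(\<Sum>i<k. g) \<in> S" using insert.prems by (induction k) auto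
  show ?case
  proof (intro bexI[of _ "e + (\<Sum>i<k. g)"] conjI ballI)
    show "s + (e + (\<Sum>i<k. g)) \<notin> S" using nk by (simp add: add.assoc)
    show "e + (\<Sum>i<k. g) \<in> S" using e gk by simp
    fix g' assume "g' \<in> insert g G"
    then show "s + (e + (\<Sum>i<k. g)) + g' \<in> S"
    proof
      assume "g' = g"
      then show ?thesis using L k by (simp add: ac_simps)
    next
      assume "g' \<in> G"
      then have "s + e + g' + (\<Sum>i<k. g) \<in> S" using e(3) gk by simp
      then show ?thesis by (simp add: ac_simps)
    qed
  qed
qed

text \<open>If \<open>s\<close> is a hole of \<open>S\<close> as in the definition of \<open>saturated\<close>, a hole \<open>t\<close> in \<open>s + S\<close> that is
  maximal for divisibility gives a monomial outside \<open>A\<close> which the irrelevant ideal multiplies into \<open>A\<close>.\<close>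

lemma not_saturated_socle:
  assumes "\<not> saturated"
  shows "\<exists>t. t \<notin> S \<and> (\<forall>g\<in>S - {0}. t + g \<in> S)"
proof -
  obtain s where s: "s + ax 0 1 \<in> S" "s + ax 1 1 \<in> S" "s \<notin> S" using assms by (auto simp: saturated_def)
  obtain G where G: "G \<subseteq> S" "finite G" "\<forall>s\<in>S. \<exists>g\<in>G. \<exists>i j. s = g + ax 0 i + ax 1 j"
    using residue_generators[of S] by blast
  let ?G = "G - {0} \<union> {ax 0 1, ax 1 1}"
  have "?G \<subseteq> S - {0}" using G by (auto simp: ax_eq_0_iff)
  then obtain e where e: "e \<in> S" "s + e \<notin> S" "\<And>g. g \<in> ?G \<Longrightarrow> s + e + g \<in> S"
    using maximal_translate[OF s, of ?G] G(2) by blast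
  have "s + e + t \<in> S" if t: "t \<in> S" "t \<noteq> 0" for t
  proof -
    obtain g i j where g: "g \<in> G" "t = g + ax 0 i + ax 1 j" using G(3) t by blast
    have "g \<noteq> 0 \<or> i \<noteq> 0 \<or> j \<noteq> 0" using t(2) g(2) ax_0[of 0] ax_0[of 1] by (metis add_0)
    then consider "g \<noteq> 0" | "g = 0" "i \<noteq> 0" | "g = 0" "j \<noteq> 0" by blast
    then show ?thesis
    proof cases
      case 1
      then have "(s + e + g) + (ax 0 i + ax 1 j) \<in> S" using g by (intro add_S[OF e(3)]) auto
      then show ?thesis using g by (simp add: ac_simps)
    next
      case 2
      then have "ax 0 i = ax 0 1 + ax 0 (i - 1)" using ax_add[of 0 1 "i - 1"] by simp
      moreover have "(s + e + ax 0 1) + (ax 0 (i - 1) + ax 1 j) \<in> S" by (intro add_S[OF e(3)]) auto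
      ultimately show ?thesis using g 2 by (simp add: ac_simps)
    next
      case 3
      then have "ax 1 j = ax 1 1 + ax 1 (j - 1)" using ax_add[of 1 1 "j - 1"] by simp
      moreover have "(s + e + ax 1 1) + (ax 0 i + ax 1 (j - 1)) \<in> S" by (intro add_S[OF e(3)]) auto
      ultimately show ?thesis using g 3 by (simp add: ac_simps)
    qed
  qed
  then show ?thesis using e(2) by blast
qed

text \<open>The fraction \<open>w / z\<close> is the monomial \<open>x^t\<close> of the maximal hole
  \<open>t\<close>, with \<open>x^\<alpha>\<close> as denominator because
  \<open>t + \<alpha>\<close> is in \<open>S\<close>. An element outside \<open>M0\<close> has a
  nonzero constant term, so its product with \<open>x^t\<close> still has the key \<open>t\<close>,
  which is not in \<open>S\<close>.\<close>

lemma not_saturated_fraction: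
  assumes "\<not> saturated"
  shows "\<exists>w\<in>A. \<exists>z\<in>A. z \<noteq> 0 \<and> (\<forall>m\<in>M0. \<exists>k\<in>A. m * w = z * k) \<and>
    (\<forall>g\<in>A - M0. \<forall>k\<in>A. g * w \<noteq> z * k)"
proof -
  obtain t where t: "t \<notin> S" "\<And>g. g \<in> S - {0} \<Longrightarrow> t + g \<in> S" using not_saturated_socle[OF assms] by blast
  have a: "ax 0 1 \<in> S - {0}" by (simp add: ax_eq_0_iff)
  let ?z = "mon (ax 0 1) :: (nat, 'k) mpol" and ?w = "mon (ax 0 1 + t) :: (nat, 'k) mpol"
  have w: "?w = ?z * mon t" by (simp add: mon_mult)
  have "ax 0 1 + t \<in> S" using t(2)[OF a] by (simp add: ac_simps)
  then have "?w \<in> A" by simp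
  moreover have "\<exists>k\<in>A. m * ?w = ?z * k" if m: "m \<in> M0" for m
  proof (intro bexI[of _ "mon t * m"])
    have "Poly_Mapping.keys (mon t * m) \<subseteq> (\<lambda>s. t + s) ` Poly_Mapping.keys m"
      unfolding mon_def by (rule keys_single_mult)
    also have "\<dots> \<subseteq> S" using t(2) m by (auto simp: off_face_def mem_A)
    finally show "mon t * m \<in> A" by (simp add: mem_A)
  qed (simp add: w mult_ac)
  moreover have "g * ?w \<noteq> ?z * k" if g: "g \<in> A - M0" and k: "k \<in> A" for g k
  proof
    assume "g * ?w = ?z * k"
    then have "?z * (mon t * g) = ?z * k" by (simp add: w mult_ac)
    then have "mon t * g = k" using mon_nonzero by (metis mult_left_cancel)
    moreover have "Poly_Mapping.lookup (mon t * g) (t + 0) = Poly_Mapping.lookup g 0"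
      unfolding mon_def lookup_single_mult by simp
    moreover have "Poly_Mapping.lookup g 0 \<noteq> 0" using g by (auto simp: off_face_def in_keys_iff)
    ultimately have "t \<in> Poly_Mapping.keys k" by (simp add: in_keys_iff)
    then show False using k t(1) by (auto simp: mem_A)
  qed
  moreover have "?z \<in> A" "?z \<noteq> 0" using a by simp_all
  ultimately show ?thesis by (intro bexI[of _ ?w, OF bexI[of _ ?z, OF conjI[OF _ conjI]]] ballI)
qed

end

section \<open>Transfer along isomorphisms\<close>

lemma primeideal_vimage:
  assumes "cring B" "f \<in> ring_hom B A" "primeideal Q A"
  shows "primeideal {b \<in> carrier B. f b \<in> Q} B"
proof -
  interpret B: cring B by fact
  interpret Q: primeideal Q A by fact
  interpret F: ring_hom_ring B A f
    using assms(2) by (intro ring_hom_ringI2 B.ring_axioms Q.ring_axioms)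
  show ?thesis
  proof (rule primeidealI)
    show "ideal {b \<in> carrier B. f b \<in> Q} B" by (rule F.ideal_vimage[OF Q.is_ideal])
    have "\<one>\<^bsub>B\<^esub> \<notin> {b \<in> carrier B. f b \<in> Q}" using Q.one_imp_carrier Q.I_notcarr by auto
    then show "carrier B \<noteq> {b \<in> carrier B. f b \<in> Q}" by blast
    show "a \<in> {b \<in> carrier B. f b \<in> Q} \<or> b \<in> {b \<in> carrier B. f b \<in> Q}"
      if "a \<in> carrier B" "b \<in> carrier B" "a \<otimes>\<^bsub>B\<^esub> b \<in> {b \<in> carrier B. f b \<in> Q}" for a b
      using that Q.I_prime[of "f a" "f b"] by auto
  qed (rule assms)
qed

locale cring_iso = B: cring B + A: cring A
  for B :: "('b, 'm) ring_scheme" and A :: "('a, 'n) ring_scheme" +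
  fixes f g
  assumes f_hom: "f \<in> ring_hom B A" and g_hom: "g \<in> ring_hom A B"
    and gf [simp]: "b \<in> carrier B \<Longrightarrow> g (f b) = b" and fg [simp]: "a \<in> carrier A \<Longrightarrow> f (g a) = a"
begin

sublocale F: ring_hom_ring B A f
  using f_hom by (intro ring_hom_ringI2 B.ring_axioms A.ring_axioms)

sublocale G: ring_hom_ring A B g
  using g_hom by (intro ring_hom_ringI2 B.ring_axioms A.ring_axioms)

lemma sym: "cring_iso A B g f"
  by unfold_locales (simp_all add: f_hom g_hom)

lemma maximal_vimage:
  assumes "maximalideal Q A"
  shows "maximalideal {b \<in> carrier B. f b \<in> Q} B"
proof -
  interpret Q: maximalideal Q A by fact
  show ?thesis
  proof (rule maximalidealI)
    show "ideal {b \<in> carrier B. f b \<in> Q} B" by (rule F.ideal_vimage[OF Q.is_ideal])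
    have "\<one>\<^bsub>B\<^esub> \<notin> {b \<in> carrier B. f b \<in> Q}" using Q.one_imp_carrier Q.I_notcarr by auto
    then show "carrier B \<noteq> {b \<in> carrier B. f b \<in> Q}" by blast
    fix J assume J: "ideal J B" "{b \<in> carrier B. f b \<in> Q} \<subseteq> J" "J \<subseteq> carrier B"
    let ?J = "{a \<in> carrier A. g a \<in> J}"
    have "Q \<subseteq> ?J"
    proof
      fix a assume a: "a \<in> Q"
      then have "a \<in> carrier A" by (rule Q.Icarr)
      then have "g a \<in> {b \<in> carrier B. f b \<in> Q}" using a by simp
      then show "a \<in> ?J" using J(2) \<open>a \<in> carrier A\<close> by blast
    qed
    then have J': "?J = Q \<or> ?J = carrier A" by (rule Q.I_maximal[OF G.ideal_vimage[OF J(1)]]) blast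
    have "f b \<in> ?J \<longleftrightarrow> b \<in> J" if "b \<in> carrier B" for b using that by simp
    then have "J = {b \<in> carrier B. f b \<in> ?J}" using J(3) by blast
    moreover have "{b \<in> carrier B. f b \<in> carrier A} = carrier B" by auto
    ultimately show "J = {b \<in> carrier B. f b \<in> Q} \<or> J = carrier B" using J' by metis
  qed
qed

lemma domain_transfer: "domain B \<Longrightarrow> domain A"
proof -
  assume "domain B"
  then interpret D: domain B .
  show "domain A"
  proof (intro domain.intro domain_axioms.intro A.is_cring)
    show "\<one>\<^bsub>A\<^esub> \<noteq> \<zero>\<^bsub>A\<^esub>" using D.one_not_zero G.hom_one G.hom_zero by metis
    show "a = \<zero>\<^bsub>A\<^esub> \<or> b = \<zero>\<^bsub>A\<^esub>"
      if ab: "a \<otimes>\<^bsub>A\<^esub> b = \<zero>\<^bsub>A\<^esub>" "a \<in> carrier A" "b \<in> carrier A" for a b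
    proof -
      have "g a \<otimes>\<^bsub>B\<^esub> g b = \<zero>\<^bsub>B\<^esub>" using ab by (metis G.hom_mult G.hom_zero)
      then have "g a = \<zero>\<^bsub>B\<^esub> \<or> g b = \<zero>\<^bsub>B\<^esub>" using ab D.integral by simp
      then show ?thesis using ab by (metis F.hom_zero fg)
    qed
  qed
qed

lemma noetherian_transfer:
  assumes "noetherian_ring B"
  shows "noetherian_ring A"
proof (rule A.noetherian_ringI)
  interpret N: noetherian_ring B by fact
  fix I assume I: "ideal I A"
  obtain E where E: "E \<subseteq> carrier B" "finite E" "{b \<in> carrier B. f b \<in> I} = Idl\<^bsub>B\<^esub> E"
    using N.finetely_gen[OF F.ideal_vimage[OF I]] by blast
  have fE: "f ` E \<subseteq> carrier A" using E(1) by auto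
  have "E \<subseteq> {b \<in> carrier B. f b \<in> I}" unfolding E(3) by (rule B.genideal_self[OF E(1)])
  then have "Idl\<^bsub>A\<^esub> (f ` E) \<subseteq> I" by (intro A.genideal_minimal[OF I]) auto
  moreover have "I \<subseteq> Idl\<^bsub>A\<^esub> (f ` E)"
  proof
    fix a assume a: "a \<in> I"
    then have ac: "a \<in> carrier A" by (rule ideal.Icarr[OF I])
    have "E \<subseteq> {b \<in> carrier B. f b \<in> Idl\<^bsub>A\<^esub> (f ` E)}" using A.genideal_self[OF fE] E(1) by auto
    then have "Idl\<^bsub>B\<^esub> E \<subseteq> {b \<in> carrier B. f b \<in> Idl\<^bsub>A\<^esub> (f ` E)}"
      by (intro B.genideal_minimal F.ideal_vimage A.genideal_ideal fE)
    moreover have "g a \<in> Idl\<^bsub>B\<^esub> E" using a ac by (simp flip: E(3))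
    ultimately show "a \<in> Idl\<^bsub>A\<^esub> (f ` E)" using ac by auto
  qed
  ultimately show "\<exists>E\<subseteq>carrier A. finite E \<and> I = Idl\<^bsub>A\<^esub> E" using fE E(2) by blast
qed

text \<open>Localizations of the two rings are not compared. Only the data of the criterion
  \<open>cohen_macaulayI\<close> are carried across: chains of primes, maximal ideals and a pair of
  elements.\<close>

lemma cohen_macaulay_transferI:
  assumes "domain B" and noeth: "noetherian_ring B"
    and dim: "\<nexists>P. (\<forall>i\<le>3. primeideal (P i) B) \<and> (\<forall>i<3::nat. P i \<subset> P (Suc i))"
    and depth: "\<And>M. maximalideal M B \<Longrightarrow> \<exists>x\<in>M. \<exists>y\<in>M. x \<noteq> \<zero>\<^bsub>B\<^esub> \<and>
        (\<forall>p\<in>carrier B. \<forall>q\<in>carrier B. y \<otimes>\<^bsub>B\<^esub> p = x \<otimes>\<^bsub>B\<^esub> q \<longrightarrow> (\<exists>h\<in>carrier B. p = x \<otimes>\<^bsub>B\<^esub> h))"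
  shows "cohen_macaulay A"
proof (rule domain.cohen_macaulayI[OF domain_transfer[OF assms(1)]])
  show "noetherian_ring A" by (rule noetherian_transfer) fact
  show "\<nexists>P. (\<forall>i\<le>3. primeideal (P i) A) \<and> (\<forall>i<3::nat. P i \<subset> P (Suc i))"
  proof
    assume "\<exists>P. (\<forall>i\<le>3. primeideal (P i) A) \<and> (\<forall>i<3::nat. P i \<subset> P (Suc i))"
    then obtain P :: "nat \<Rightarrow> 'a set" where P: "\<And>i. i \<le> 3 \<Longrightarrow> primeideal (P i) A"
      "\<And>i. i < 3 \<Longrightarrow> P i \<subset> P (Suc i)" by blast
    let ?P = "\<lambda>i. {b \<in> carrier B. f b \<in> P i}"
    have "primeideal (?P i) B" if "i \<le> 3" for i
      by (rule primeideal_vimage[OF B.is_cring f_hom P(1)[OF that]])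
    moreover have "?P i \<subset> ?P (Suc i)" if i: "i < 3" for i
    proof -
      obtain a where a: "a \<in> P (Suc i)" "a \<notin> P i" using P(2)[OF i] by blast
      have "primeideal (P (Suc i)) A" using P(1) i by simp
      then have "a \<in> carrier A" using a(1) ideal.Icarr primeideal.axioms(1) by metis
      then have "g a \<in> ?P (Suc i)" "g a \<notin> ?P i" using a by auto
      moreover have "?P i \<subseteq> ?P (Suc i)" using P(2)[OF i] by blast
      ultimately show ?thesis by blast
    qed
    ultimately have "(\<forall>i\<le>3. primeideal (?P i) B) \<and> (\<forall>i<3::nat. ?P i \<subset> ?P (Suc i))" by blast
    with dim show False by (rule notE[OF _ exI[of _ ?P]])
  qed
  fix M assume M: "maximalideal M A"
  obtain x y where xy: "x \<in> carrier B" "f x \<in> M" "y \<in> carrier B" "f y \<in> M" "x \<noteq> \<zero>\<^bsub>B\<^esub>"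
    and reg: "\<And>p q. \<lbrakk>p \<in> carrier B; q \<in> carrier B; y \<otimes>\<^bsub>B\<^esub> p = x \<otimes>\<^bsub>B\<^esub> q\<rbrakk> \<Longrightarrow> \<exists>h\<in>carrier B. p = x \<otimes>\<^bsub>B\<^esub> h"
    using depth[OF maximal_vimage[OF M]] by blast
  have "\<exists>h\<in>carrier A. p = f x \<otimes>\<^bsub>A\<^esub> h"
    if pq: "p \<in> carrier A" "q \<in> carrier A" "f y \<otimes>\<^bsub>A\<^esub> p = f x \<otimes>\<^bsub>A\<^esub> q" for p q
  proof -
    have "y \<otimes>\<^bsub>B\<^esub> g p = g (f y \<otimes>\<^bsub>A\<^esub> p)" using pq(1) xy by simp
    also have "\<dots> = x \<otimes>\<^bsub>B\<^esub> g q" unfolding pq(3) using pq(2) xy by simp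
    finally have "y \<otimes>\<^bsub>B\<^esub> g p = x \<otimes>\<^bsub>B\<^esub> g q" .
    then obtain h where h: "h \<in> carrier B" "g p = x \<otimes>\<^bsub>B\<^esub> h" using reg[of "g p" "g q"] pq by auto
    have "p = f (g p)" using pq(1) by simp
    also have "\<dots> = f x \<otimes>\<^bsub>A\<^esub> f h" unfolding h(2) using h(1) xy by simp
    finally show ?thesis using h(1) by auto
  qed
  moreover have "f x \<noteq> \<zero>\<^bsub>A\<^esub>" using xy by (metis G.hom_zero gf)
  ultimately show "\<exists>x\<in>M. \<exists>y\<in>M. x \<noteq> \<zero>\<^bsub>A\<^esub> \<and>
      (\<forall>p\<in>carrier A. \<forall>q\<in>carrier A. y \<otimes>\<^bsub>A\<^esub> p = x \<otimes>\<^bsub>A\<^esub> q \<longrightarrow> (\<exists>h\<in>carrier A. p = x \<otimes>\<^bsub>A\<^esub> h))"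
    using xy by (intro bexI[OF _ xy(2)] bexI[OF _ xy(4)] conjI ballI impI)
qed

lemma not_cohen_macaulay_transferI:
  assumes "domain B" and M: "maximalideal M B" and P: "primeideal P B" "P \<noteq> {\<zero>\<^bsub>B\<^esub>}" "P \<subset> M"
    and wz: "w \<in> carrier B" "z \<in> carrier B" "z \<noteq> \<zero>\<^bsub>B\<^esub>"
    and in_M: "\<And>m. m \<in> M \<Longrightarrow> \<exists>k\<in>carrier B. m \<otimes>\<^bsub>B\<^esub> w = z \<otimes>\<^bsub>B\<^esub> k"
    and notin_M: "\<And>x k. \<lbrakk>x \<in> carrier B - M; k \<in> carrier B\<rbrakk> \<Longrightarrow> x \<otimes>\<^bsub>B\<^esub> w \<noteq> z \<otimes>\<^bsub>B\<^esub> k"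
  shows "\<not> cohen_macaulay A"
proof -
  interpret inv: cring_iso A B g f by (rule sym)
  let ?v = "\<lambda>I. {a \<in> carrier A. g a \<in> I}"
  interpret P: primeideal P B by fact
  interpret M: maximalideal M B by fact
  show ?thesis
  proof (rule domain.not_cohen_macaulayI[OF domain_transfer[OF assms(1)]])
    show "maximalideal (?v M) A" by (rule inv.maximal_vimage[OF M])
    show "primeideal (?v P) A" by (rule primeideal_vimage[OF A.is_cring g_hom P(1)])
    obtain p where p: "p \<in> P" "p \<noteq> \<zero>\<^bsub>B\<^esub>" using P(2) P.zero_closed by blast
    have pc: "p \<in> carrier B" using p(1) by (rule P.Icarr)
    then have "f p \<in> ?v P" "f p \<noteq> \<zero>\<^bsub>A\<^esub>" using p by (auto, metis G.hom_zero gf)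
    then show "?v P \<noteq> {\<zero>\<^bsub>A\<^esub>}" by blast
    obtain q where q: "q \<in> M" "q \<notin> P" using P(3) by blast
    have "q \<in> carrier B" using q(1) by (rule M.Icarr)
    then have "f q \<in> ?v M" "f q \<notin> ?v P" using q by auto
    then show "?v P \<subset> ?v M" using P(3) by blast
    show "f w \<in> carrier A" "f z \<in> carrier A" using wz by auto
    show "f z \<noteq> \<zero>\<^bsub>A\<^esub>" using wz by (metis G.hom_zero gf)
    show "\<exists>k\<in>carrier A. m \<otimes>\<^bsub>A\<^esub> f w = f z \<otimes>\<^bsub>A\<^esub> k" if m: "m \<in> ?v M" for m
    proof -
      obtain k where k: "k \<in> carrier B" "g m \<otimes>\<^bsub>B\<^esub> w = z \<otimes>\<^bsub>B\<^esub> k" using in_M m by blast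
      have "m \<otimes>\<^bsub>A\<^esub> f w = f (g m \<otimes>\<^bsub>B\<^esub> w)" using m wz by simp
      also have "\<dots> = f z \<otimes>\<^bsub>A\<^esub> f k" unfolding k(2) using k(1) wz by simp
      finally have "m \<otimes>\<^bsub>A\<^esub> f w = f z \<otimes>\<^bsub>A\<^esub> f k" .
      then show ?thesis using k by auto
    qed
    show "x \<otimes>\<^bsub>A\<^esub> f w \<noteq> f z \<otimes>\<^bsub>A\<^esub> k" if x: "x \<in> carrier A - ?v M" "k \<in> carrier A" for x k
    proof
      assume e: "x \<otimes>\<^bsub>A\<^esub> f w = f z \<otimes>\<^bsub>A\<^esub> k"
      have "g x \<otimes>\<^bsub>B\<^esub> w = g (x \<otimes>\<^bsub>A\<^esub> f w)" using x wz by simp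
      also have "\<dots> = z \<otimes>\<^bsub>B\<^esub> g k" unfolding e using x wz by simp
      finally have "g x \<otimes>\<^bsub>B\<^esub> w = z \<otimes>\<^bsub>B\<^esub> g k" .
      then show False using notin_M[of "g x" "g k"] x by auto
    qed
  qed
qed

end

theorem (in plane_semigroup) cohen_macaulay_iff_saturated:
  assumes K: "infinite (UNIV :: 'k set)" and iso: "cring_iso (ring_on A) R f g"
  shows "cohen_macaulay R \<longleftrightarrow> saturated"
proof -
  interpret cring_iso "ring_on A" R f g by (rule iso)
  show ?thesis
  proof
    assume sat: saturated
    show "cohen_macaulay R"
    proof (rule cohen_macaulay_transferI[OF domain_ring_on noetherian no_prime_chain])
      show "dependent3 f0 f1 f2" if "f0 \<in> A" "f1 \<in> A" "f2 \<in> A" for f0 f1 f2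
        using that by (rule dependent3_A)
    qed (use saturated_regular_pair[OF K sat] in simp)
  next
    assume CM: "cohen_macaulay R"
    show saturated
    proof (rule ccontr)
      assume "\<not> saturated"
      then obtain w z where wz: "w \<in> A" "z \<in> A" "z \<noteq> 0"
        and 1: "\<And>m. m \<in> M0 \<Longrightarrow> \<exists>k\<in>A. m * w = z * k"
        and 2: "\<And>x k. \<lbrakk>x \<in> A - M0; k \<in> A\<rbrakk> \<Longrightarrow> x * w \<noteq> z * k"
        using not_saturated_fraction by blast
      have "\<not> cohen_macaulay R"
        by (rule not_cohen_macaulay_transferI[OF domain_ring_on M0_maximal axis_prime _ axis_prime_psubset, of w z])
          (use wz 1 2 axis_prime_nonzero in simp_all)
      then show False using CM by simp
    qed
  qed
qed

section \<open>Monomial substitutions\<close>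

definition weight :: "('v \<Rightarrow> nat) \<Rightarrow> ('v \<Rightarrow>\<^sub>0 nat) \<Rightarrow> nat" where
  "weight a \<mu> = (\<Sum>i\<in>Poly_Mapping.keys \<mu>. Poly_Mapping.lookup \<mu> i * a i)"

lemma weight_superset:
  assumes "finite I" "Poly_Mapping.keys \<mu> \<subseteq> I"
  shows "weight a \<mu> = (\<Sum>i\<in>I. Poly_Mapping.lookup \<mu> i * a i)"
  unfolding weight_def using assms by (intro sum.mono_neutral_left) (auto simp: in_keys_iff)

lemma weight_0 [simp]: "weight a 0 = 0"
  by (simp add: weight_def)

lemma weight_single [simp]: "weight a (Poly_Mapping.single i k) = k * a i"
  by (simp add: weight_def)

lemma weight_add: "weight a (\<mu> + \<nu>) = weight a \<mu> + weight a \<nu>"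
proof -
  let ?I = "Poly_Mapping.keys \<mu> \<union> Poly_Mapping.keys \<nu>"
  have "weight a (\<mu> + \<nu>) = (\<Sum>i\<in>?I. Poly_Mapping.lookup (\<mu> + \<nu>) i * a i)"
    by (rule weight_superset) (auto simp: keys_plus_nat)
  also have "\<dots> = (\<Sum>i\<in>?I. Poly_Mapping.lookup \<mu> i * a i) + (\<Sum>i\<in>?I. Poly_Mapping.lookup \<nu> i * a i)"
    by (simp add: lookup_add add_mult_distrib sum.distrib)
  also have "\<dots> = weight a \<mu> + weight a \<nu>"
    using weight_superset[of ?I \<mu> a] weight_superset[of ?I \<nu> a] by simp
  finally show ?thesis .
qed

text \<open>With \<open>0 * 0\<close> as second summand this also covers the scaling of a single
  weight, which is why that summand appears in later weights.\<close>

lemma weight_linear: "weight (\<lambda>i. p * a i + q * b i) \<mu> = p * weight a \<mu> + q * weight b \<mu>"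
  unfolding weight_def by (simp add: sum.distrib sum_distrib_left algebra_simps)

lemma weight_mono: "(\<And>i. i \<in> Poly_Mapping.keys \<mu> \<Longrightarrow> a i \<le> b i) \<Longrightarrow> weight a \<mu> \<le> weight b \<mu>"
  unfolding weight_def by (intro sum_mono) auto

lemma weight_cong: "(\<And>i. i \<in> Poly_Mapping.keys \<mu> \<Longrightarrow> a i = b i) \<Longrightarrow> weight a \<mu> = weight b \<mu>"
  unfolding weight_def by (intro sum.cong) auto

lemma weight_ge: "i \<in> Poly_Mapping.keys \<mu> \<Longrightarrow> a i \<le> weight a \<mu>"
proof -
  assume i: "i \<in> Poly_Mapping.keys \<mu>"
  then have "a i \<le> Poly_Mapping.lookup \<mu> i * a i" by (cases "Poly_Mapping.lookup \<mu> i") (auto simp: in_keys_iff)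
  also have "\<dots> \<le> weight a \<mu>" unfolding weight_def using i by (intro member_le_sum) auto
  finally show ?thesis .
qed

definition pt :: "nat \<Rightarrow> nat \<Rightarrow> nat \<Rightarrow>\<^sub>0 nat" where
  "pt x y = Poly_Mapping.single 0 x + Poly_Mapping.single 1 y"

lemma pt_add: "pt x y + pt x' y' = pt (x + x') (y + y')"
  by (simp add: pt_def single_add ac_simps)

lemma lookup_pt [simp]: "Poly_Mapping.lookup (pt x y) 0 = x" "Poly_Mapping.lookup (pt x y) (Suc 0) = y"
  by (simp_all add: pt_def lookup_add lookup_single)

lemma pt_0 [simp]: "pt 0 0 = 0"
  by (simp add: pt_def)

lemma keys_pt: "Poly_Mapping.keys (pt x y) \<subseteq> {0, 1}"
  by (auto simp: pt_def keys_plus_nat split: if_splits)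

lemma pt_cases:
  assumes "Poly_Mapping.keys s \<subseteq> {0, 1}"
  shows "s = pt (Poly_Mapping.lookup s 0) (Poly_Mapping.lookup s 1)"
  using assms keys_pt by (intro plane_eqI) simp_all

lemma pt_eq_iff: "pt x y = pt x' y' \<longleftrightarrow> x = x' \<and> y = y'"
  by (metis lookup_pt)

lemma mon_power_pt: "mon (pt x y) ^ k = mon (pt (k * x) (k * y))"
  by (induction k) (auto simp: mon_mult pt_add)

lemma prod_mon_pt: "(\<Prod>i\<in>I. mon (pt (p i) (q i))) = mon (pt (\<Sum>i\<in>I. p i) (\<Sum>i\<in>I. q i))"
  by (induction I rule: infinite_finite_induct) (auto simp: mon_mult pt_add)

lemma mpol_var_power: "mpol_var i ^ k = mon (Poly_Mapping.single i k)"
  by (induction k) (auto simp: mpol_var_def mon_def mult_single simp flip: single_add)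

lemma mpol_subst_mon:
  assumes "\<And>i. t i = mon (pt (a i) (b i))"
  shows "mpol_subst t p = (\<Sum>\<mu>\<in>Poly_Mapping.keys p. mpol_const (Poly_Mapping.lookup p \<mu>) * mon (pt (weight a \<mu>) (weight b \<mu>)))"
  unfolding mpol_subst_def assms mon_power_pt prod_mon_pt weight_def ..

locale monomial_subst =
  fixes t :: "nat \<Rightarrow> (nat, 'k::field) mpol" and a b :: "nat \<Rightarrow> nat"
  assumes t: "t i = mon (pt (a i) (b i))"
begin

definition expo where "expo \<mu> = pt (weight a \<mu>) (weight b \<mu>)"

lemma expo_add: "expo (\<mu> + \<nu>) = expo \<mu> + expo \<nu>"
  by (simp add: expo_def weight_add pt_add)

lemma expo_0 [simp]: "expo 0 = 0"
  by (simp add: expo_def)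

lemma subst_superset:
  assumes "finite I" "Poly_Mapping.keys p \<subseteq> I"
  shows "mpol_subst t p = (\<Sum>\<mu>\<in>I. mpol_const (Poly_Mapping.lookup p \<mu>) * mon (expo \<mu>))"
  unfolding mpol_subst_mon[of t a b, OF t] expo_def[symmetric] using assms
  by (intro sum.mono_neutral_left) (auto simp: in_keys_iff mpol_const_def)

lemma subst_0 [simp]: "mpol_subst t 0 = 0"
  by (simp add: mpol_subst_def)

lemma subst_add: "mpol_subst t (p + q) = mpol_subst t p + mpol_subst t q"
proof -
  let ?I = "Poly_Mapping.keys p \<union> Poly_Mapping.keys q"
  have "mpol_subst t (p + q) = (\<Sum>\<mu>\<in>?I. mpol_const (Poly_Mapping.lookup (p + q) \<mu>) * mon (expo \<mu>))"
    using keys_add[of p q] by (intro subst_superset) auto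
  also have "\<dots> = (\<Sum>\<mu>\<in>?I. mpol_const (Poly_Mapping.lookup p \<mu>) * mon (expo \<mu>))
      + (\<Sum>\<mu>\<in>?I. mpol_const (Poly_Mapping.lookup q \<mu>) * mon (expo \<mu>))"
    by (simp add: lookup_add mpol_const_def single_add distrib_right sum.distrib)
  also have "\<dots> = mpol_subst t p + mpol_subst t q"
    using subst_superset[of ?I p] subst_superset[of ?I q] by simp
  finally show ?thesis .
qed

lemma subst_term: "mpol_subst t (mpol_const c * mon \<mu>) = mpol_const c * mon (expo \<mu>)"
  using subst_superset[of "{\<mu>}" "mpol_const c * mon \<mu>"] by (simp add: const_mult_mon)

lemma in_span: "p \<in> lin_span mpol_const (range mon)"
  using monomial_algebra_span[of UNIV] by (auto simp: monomial_algebra_def)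

lemma term_mult_term: "(mpol_const c * mon \<mu>) * (mpol_const d * mon \<nu>) = mpol_const (c * d) * mon (\<mu> + \<nu>)"
  by (simp add: const_mult_mon mult_single)

lemma subst_mult: "mpol_subst t (p * q) = mpol_subst t p * mpol_subst t q"
  using in_span[of p]
proof (induction rule: lin_span.induct)
  case (step x v c)
  then obtain \<mu> where \<mu>: "x = mon \<mu>" by blast
  have "mpol_subst t (mpol_const c * mon \<mu> * q) = mpol_const c * mon (expo \<mu>) * mpol_subst t q"
    using in_span[of q]
  proof (induction rule: lin_span.induct)
    case (step y w d)
    then obtain \<nu> where \<nu>: "y = mon \<nu>" by blast
    show ?case
      unfolding \<nu> distrib_left subst_add step.IH term_mult_term subst_term expo_add ..
  qed simp
  then show ?case unfolding \<mu> distrib_right subst_add step.IH subst_term by simp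
qed simp

lemma subst_1: "mpol_subst t 1 = 1"
  using subst_term[of 1 0] by (simp add: mpol_const_def)

text \<open>Terms go to terms, and each term with exponent in the image lifts; linearity does the
  rest.\<close>

lemma image_subst:
  "mpol_subst t ` monomial_algebra W = monomial_algebra (expo ` W)"
proof (intro equalityI subsetI)
  fix q assume "q \<in> mpol_subst t ` monomial_algebra W"
  then obtain p where p: "Poly_Mapping.keys p \<subseteq> W" "q = mpol_subst t p" by (auto simp: monomial_algebra_def)
  have "Poly_Mapping.keys (mpol_const c * mon (expo \<mu>)) \<subseteq> expo ` W" if "\<mu> \<in> W" for \<mu> and c :: 'k
    using that by (auto simp: const_mult_mon split: if_splits)
  then have "Poly_Mapping.keys q \<subseteq> expo ` W"
    unfolding p(2) subst_superset[OF finite_keys order_refl] using p(1) by (intro keys_sum_subset) blast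
  then show "q \<in> monomial_algebra (expo ` W)" by (simp add: monomial_algebra_def)
next
  fix q :: "(nat, 'k) mpol" assume "q \<in> monomial_algebra (expo ` W)"
  then have "q \<in> lin_span mpol_const (mon ` expo ` W)" using monomial_algebra_span by blast
  then show "q \<in> mpol_subst t ` monomial_algebra W"
  proof (induction rule: lin_span.induct)
    case zero
    show ?case using subst_0 by (intro image_eqI[of _ _ 0]) (auto simp: monomial_algebra_def)
  next
    case (step x v c)
    then obtain \<mu> p where \<mu>: "\<mu> \<in> W" "x = mon (expo \<mu>)" and p: "p \<in> monomial_algebra W" "v = mpol_subst t p"
      by blast
    have "mpol_const c * mon \<mu> + p \<in> monomial_algebra W"
      using p \<mu> keys_add[of "mpol_const c * mon \<mu>" p]
      by (auto simp: monomial_algebra_def const_mult_mon split: if_splits)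
    then show ?case using p(2) \<mu>(2) by (intro image_eqI) (auto simp: subst_add subst_term)
  qed
qed

end

lemma mpol_ring_conv: "mpol_ring V = ring_on (monomial_algebra {\<mu>. Poly_Mapping.keys \<mu> \<subseteq> V})"
  by (auto simp: mpol_ring_def ring_on_def monomial_algebra_def)

lemma cring_mpol_ring: "cring (mpol_ring V :: ('v::linorder, 'k::field) mpol ring)"
proof -
  interpret subalgebra "monomial_algebra {\<mu>. Poly_Mapping.keys \<mu> \<subseteq> V} :: ('v, 'k) mpol set" mpol_const
    by (rule subalgebra_monomial_algebra) (auto simp: keys_plus_nat)
  show ?thesis unfolding mpol_ring_conv by (rule cring_ring_on)
qed

section \<open>The semigroup of a projective monomial curve\<close>

locale projective_monomial_curve =
  fixes n :: nat and m :: "nat \<Rightarrow> nat" and K :: "'k::field itself"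
  assumes n_pos: "0 < n" and m_pos: "\<And>i. i \<in> {1..n} \<Longrightarrow> 0 < m i"
    and m_le: "\<And>i. i \<in> {1..n} \<Longrightarrow> m i \<le> m n"
begin

definition u_deg where "u_deg i = (if i = n + 1 then 0 else m i)"
definition v_deg where "v_deg i = (if i = n + 1 then m n else m n - m i)"

sublocale sub: monomial_subst "curve_param n m :: nat \<Rightarrow> (nat, 'k) mpol" u_deg v_deg
proof
  fix i
  show "(curve_param n m i :: (nat, 'k) mpol) = mon (pt (u_deg i) (v_deg i))"
    by (simp add: curve_param_def u_deg_def v_deg_def mpol_var_power mon_mult pt_def)
qed

definition S where "S = sub.expo ` {\<mu>. Poly_Mapping.keys \<mu> \<subseteq> {1..n + 1}}"

lemma mem_S_iff:
  "pt x y \<in> S \<longleftrightarrow> (\<exists>\<mu>. Poly_Mapping.keys \<mu> \<subseteq> {1..n + 1} \<and> x = weight u_deg \<mu> \<and> y = weight v_deg \<mu>)"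
  by (auto simp: S_def sub.expo_def pt_eq_iff)

lemma weight_in_S: "Poly_Mapping.keys \<mu> \<subseteq> {1..n + 1} \<Longrightarrow> pt (weight u_deg \<mu>) (weight v_deg \<mu>) \<in> S"
  using mem_S_iff by blast

lemma generator_in_S: "i \<in> {1..n} \<Longrightarrow> pt (m i) (m n - m i) \<in> S"
  using weight_in_S[of "Poly_Mapping.single i 1"] by (simp add: u_deg_def v_deg_def)

sublocale plane_semigroup S "m n" K
proof
  show "Poly_Mapping.keys s \<subseteq> {0, 1}" if "s \<in> S" for s
    using that keys_pt by (auto simp: S_def sub.expo_def)
  show "0 \<in> S" using sub.expo_0 unfolding S_def by (intro image_eqI[of _ _ 0]) auto
  show "s + t \<in> S" if "s \<in> S" "t \<in> S" for s t
  proof -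
    obtain \<mu> \<nu> where "s = sub.expo \<mu>" "t = sub.expo \<nu>" "Poly_Mapping.keys \<mu> \<subseteq> {1..n + 1}" "Poly_Mapping.keys \<nu> \<subseteq> {1..n + 1}"
      using \<open>s \<in> S\<close> \<open>t \<in> S\<close> by (auto simp: S_def)
    then show ?thesis unfolding S_def
      by (intro image_eqI[of _ _ "\<mu> + \<nu>"]) (auto simp: sub.expo_add keys_plus_nat)
  qed
  show "0 < m n" using m_pos[of n] n_pos by simp
  show "Poly_Mapping.single 0 (m n) \<in> S"
    using generator_in_S[of n] n_pos by (simp add: pt_def)
  show "Poly_Mapping.single 1 (m n) \<in> S"
    using weight_in_S[of "Poly_Mapping.single (n + 1) 1"] by (simp add: u_deg_def v_deg_def pt_def)
qed

lemma ax_pt: "ax 0 i = pt (i * m n) 0" "ax 1 i = pt 0 (i * m n)"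
  by (simp_all add: ax_def pt_def)

text \<open>The first isomorphism theorem for the substitution, whose image in
  \<open>K[u, v]\<close> is exactly \<open>A\<close>. The isomorphism is then inverted, since the
  criteria are transferred from \<open>A\<close> to the quotient.\<close>

lemma coordinate_ring_iso:
  "\<exists>f g. cring_iso (ring_on A) (coordinate_ring n m :: (nat, 'k) mpol set ring) f g"
proof -
  let ?R = "mpol_ring {1..n + 1} :: (nat, 'k) mpol ring" and ?T = "mpol_ring {0, 1} :: (nat, 'k) mpol ring"
  let ?h = "mpol_subst (curve_param n m) :: (nat, 'k) mpol \<Rightarrow> (nat, 'k) mpol"
  have carr: "carrier ?R = monomial_algebra {\<mu>. Poly_Mapping.keys \<mu> \<subseteq> {1..n + 1}}" by (simp add: mpol_ring_conv)
  have img: "?h ` carrier ?R = A" unfolding carr sub.image_subst S_def ..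
  have "A \<subseteq> carrier ?T"
  proof
    fix p :: "(nat, 'k) mpol" assume "p \<in> A"
    then have "Poly_Mapping.keys \<mu> \<subseteq> {0, 1}" if "\<mu> \<in> Poly_Mapping.keys p" for \<mu>
      using that plane[of \<mu>] by (auto simp: mem_A)
    then show "p \<in> carrier ?T" by (simp add: mpol_ring_def)
  qed
  then have hom: "?h \<in> ring_hom ?R ?T"
    using img by (intro ring_hom_memI) (auto simp: mpol_ring_def sub.subst_mult sub.subst_add sub.subst_1)
  interpret R: cring ?R by (rule cring_mpol_ring)
  interpret T: cring ?T by (rule cring_mpol_ring)
  interpret H: ring_hom_ring ?R ?T ?h by (rule ring_hom_ringI2[OF R.ring_axioms T.ring_axioms hom])
  have "?T\<lparr>carrier := ?h ` carrier ?R\<rparr> = ring_on A" unfolding img by (simp add: mpol_ring_def ring_on_def)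
  then have iso: "(\<lambda>Y. the_elem (?h ` Y)) \<in> ring_iso (coordinate_ring n m) (ring_on A)"
    using H.FactRing_iso_set_aux unfolding coordinate_ring_def vanishing_ideal_def by simp
  have Q: "cring (coordinate_ring n m :: (nat, 'k) mpol set ring)"
    unfolding coordinate_ring_def vanishing_ideal_def
    by (rule ideal.quotient_is_cring[OF H.kernel_is_ideal R.is_cring])
  let ?g = "\<lambda>Y. the_elem (?h ` Y)"
  let ?Q = "coordinate_ring n m :: (nat, 'k) mpol set ring"
  let ?f = "inv_into (carrier ?Q) ?g"
  have bij: "bij_betw ?g (carrier ?Q) (carrier (ring_on A))" by (rule ring_iso_memE(5)[OF iso])
  have "?f \<in> ring_iso (ring_on A) ?Q" by (rule ring_iso_set_sym[OF cring.axioms(1)[OF Q] iso])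
  then have "?f \<in> ring_hom (ring_on A) ?Q" "?g \<in> ring_hom ?Q (ring_on A)"
    using iso by (simp_all only: ring_iso_def mem_Collect_eq)
  then have "cring_iso (ring_on A) ?Q ?f ?g"
    using bij_betw_inv_into_left[OF bij] bij_betw_inv_into_right[OF bij]
    by (intro cring_iso.intro cring_iso_axioms.intro cring_ring_on Q)
  then show ?thesis by blast
qed

theorem cohen_macaulay_coordinate_ring_iff:
  assumes "infinite (UNIV :: 'k set)"
  shows "cohen_macaulay (coordinate_ring n m :: (nat, 'k) mpol set ring) \<longleftrightarrow> saturated"
  using coordinate_ring_iso cohen_macaulay_iff_saturated[OF assms] by blast

section \<open>Holes in terms of sums of the numbers \<open>m i\<close>\<close>

lemma saturated_alt:
  "saturated \<longleftrightarrow> (\<forall>x y. pt (x + m n) y \<in> S \<longrightarrow> pt x (y + m n) \<in> S \<longrightarrow> pt x y \<in> S)"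
proof
  assume saturated
  then show "\<forall>x y. pt (x + m n) y \<in> S \<longrightarrow> pt x (y + m n) \<in> S \<longrightarrow> pt x y \<in> S"
    using keys_pt by (simp add: saturated_def ax_pt pt_add)
next
  assume *: "\<forall>x y. pt (x + m n) y \<in> S \<longrightarrow> pt x (y + m n) \<in> S \<longrightarrow> pt x y \<in> S"
  show saturated unfolding saturated_def
  proof (intro allI impI)
    fix s assume s: "Poly_Mapping.keys s \<subseteq> {0, 1}" "s + ax 0 1 \<in> S" "s + ax 1 1 \<in> S"
    obtain x y where "s = pt x y" using pt_cases[OF s(1)] by blast
    then show "s \<in> S" using s * by (simp add: ax_pt pt_add)
  qed
qed

text \<open>Every variable, the last included, has total degree \<open>m n\<close>, so a point of
  \<open>S\<close> determines the number of factors of each monomial above it.\<close>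

lemma total_degree:
  assumes "Poly_Mapping.keys \<mu> \<subseteq> {1..n + 1}"
  shows "weight u_deg \<mu> + weight v_deg \<mu> = m n * weight (\<lambda>_. 1) \<mu>"
proof -
  have "weight u_deg \<mu> + weight v_deg \<mu> = weight (\<lambda>i. u_deg i + v_deg i) \<mu>"
    using weight_linear[of 1 u_deg 1 v_deg \<mu>] by simp
  also have "\<dots> = weight (\<lambda>i. m n * 1 + 0 * 0) \<mu>"
  proof (rule weight_cong)
    fix i assume "i \<in> Poly_Mapping.keys \<mu>"
    then have "i \<in> {1..n + 1}" using assms by blast
    then show "u_deg i + v_deg i = m n * 1 + 0 * 0" using m_le[of i] by (auto simp: u_deg_def v_deg_def)
  qed
  finally show ?thesis using weight_linear[of "m n" "\<lambda>_. 1" 0 "\<lambda>_. 0" \<mu>] by simp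
qed

text \<open>A product of \<open>l\<close> of the variables \<open>x_1, ..., x_n\<close> has
  \<open>x = l m_1 + j d\<close>, where \<open>j\<close> adds up \<open>l\<close> numbers between 0
  and \<open>n - 1\<close> and so can be anything from 0 to \<open>l (n - 1)\<close>. The remaining
  \<open>N - l\<close> factors are the last variable, which does not affect
  \<open>x\<close>.\<close>

lemma mem_S_arithmetic_iff:
  assumes m: "\<And>i. i \<in> {1..n} \<Longrightarrow> m i = m 1 + (i - 1) * d" and deg: "x + y = m n * N"
  shows "pt x y \<in> S \<longleftrightarrow> (\<exists>l j. x = l * m 1 + j * d \<and> j \<le> l * (n - 1) \<and> l \<le> N)"
proof
  assume "pt x y \<in> S"
  then obtain \<mu> where \<mu>: "Poly_Mapping.keys \<mu> \<subseteq> {1..n + 1}" "x = weight u_deg \<mu>" "y = weight v_deg \<mu>"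
    by (auto simp: mem_S_iff)
  \<comment> \<open>\<open>e\<close> counts the factors other than the last variable,
    \<open>k\<close> the multiples of \<open>d\<close> that they contribute.\<close>
  define e where "e i = (if i = n + 1 then 0 else 1::nat)" for i
  define k where "k i = (if i = n + 1 then 0 else i - 1)" for i
  have "x = weight (\<lambda>i. m 1 * e i + d * k i) \<mu>"
    unfolding \<mu>(2)
  proof (rule weight_cong)
    fix i assume "i \<in> Poly_Mapping.keys \<mu>"
    then have "i \<in> {1..n + 1}" using \<mu> by blast
    then show "u_deg i = m 1 * e i + d * k i" using m[of i] by (auto simp: u_deg_def e_def k_def mult_ac)
  qed
  then have "x = weight e \<mu> * m 1 + weight k \<mu> * d" unfolding weight_linear by (simp add: mult_ac)
  moreover have "weight k \<mu> \<le> weight (\<lambda>i. (n - 1) * e i + 0 * 0) \<mu>"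
  proof (rule weight_mono)
    fix i assume "i \<in> Poly_Mapping.keys \<mu>"
    then have "i \<in> {1..n + 1}" using \<mu>(1) by blast
    then show "k i \<le> (n - 1) * e i + 0 * 0" by (auto simp: e_def k_def)
  qed
  then have "weight k \<mu> \<le> weight e \<mu> * (n - 1)" unfolding weight_linear by (simp add: mult_ac)
  moreover have "m n * N = m n * weight (\<lambda>_. 1) \<mu>" using total_degree[OF \<mu>(1)] deg unfolding \<mu>(2,3) by metis
  then have "N = weight (\<lambda>_. 1) \<mu>" using c_pos by simp
  then have "weight e \<mu> \<le> N" using weight_mono[of \<mu> e "\<lambda>_. 1"] by (simp add: e_def)
  ultimately show "\<exists>l j. x = l * m 1 + j * d \<and> j \<le> l * (n - 1) \<and> l \<le> N" by blast
next
  assume "\<exists>l j. x = l * m 1 + j * d \<and> j \<le> l * (n - 1) \<and> l \<le> N"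
  then obtain l j where lj: "x = l * m 1 + j * d" "j \<le> l * (n - 1)" "l \<le> N" by blast
  have mn: "m n = m 1 + (n - 1) * d" using m[of n] n_pos by simp
  have "l * m 1 + j * d \<le> l * m n \<and> pt (l * m 1 + j * d) (l * m n - (l * m 1 + j * d)) \<in> S"
    if "j \<le> l * (n - 1)" for l j
    using that
  proof (induction l arbitrary: j)
    case (Suc l)
    \<comment> \<open>The split of \<open>j\<close> is greedy: one factor takes as much as it can,
      up to \<open>n - 1\<close>, and the rest fits into the other \<open>l\<close> factors.\<close>
    define k where "k = min j (n - 1)"
    have k: "k \<le> j" "k \<le> n - 1" "j - k \<le> l * (n - 1)" using Suc.prems by (auto simp: k_def)
    have i: "k + 1 \<in> {1..n}" using k(2) n_pos by auto
    have mk: "m (k + 1) = m 1 + k * d" "m (k + 1) \<le> m n" using m[OF i] m_le[OF i] by simp_all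
    obtain j' where j': "j = k + j'" using k(1) le_Suc_ex by blast
    have IH: "l * m 1 + j' * d \<le> l * m n" "pt (l * m 1 + j' * d) (l * m n - (l * m 1 + j' * d)) \<in> S"
      using Suc.IH[of j'] k(3) j' by auto
    have "pt (m (k + 1)) (m n - m (k + 1)) + pt (l * m 1 + j' * d) (l * m n - (l * m 1 + j' * d)) \<in> S"
      by (intro add_S generator_in_S i IH)
    moreover have "m (k + 1) + (l * m 1 + j' * d) = Suc l * m 1 + j * d"
      unfolding mk(1) j' by (simp add: algebra_simps)
    moreover have "(m n - m (k + 1)) + (l * m n - (l * m 1 + j' * d)) = Suc l * m n - (Suc l * m 1 + j * d)"
      "Suc l * m 1 + j * d \<le> Suc l * m n"
      using IH(1) mk(2) calculation(2) by simp_all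
    ultimately show ?case unfolding pt_add by simp
  qed simp
  then have "l * m 1 + j * d \<le> l * m n" "pt (l * m 1 + j * d) (l * m n - (l * m 1 + j * d)) \<in> S"
    using lj(2) by blast+
  then have "pt x (l * m n - x) + ax 1 (N - l) \<in> S" "x \<le> l * m n"
    using lj(1) by (auto intro!: add_S ax_in)
  moreover have "l * m n - x + (N - l) * m n = y"
  proof -
    obtain r where r: "N = l + r" using lj(3) le_Suc_ex by blast
    show ?thesis using deg \<open>x \<le> l * m n\<close> unfolding r by (simp add: algebra_simps)
  qed
  ultimately show "pt x y \<in> S" by (simp add: ax_pt pt_add)
qed

text \<open>Let \<open>x + m_n\<close> be a sum of \<open>l \<le> N + 1\<close> terms. If its
  \<open>j\<close> is at least \<open>n - 1\<close>, one term \<open>m_n\<close> can be removed.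
  Otherwise the second membership represents \<open>x\<close> by \<open>l'\<close> terms, and
  \<open>l' < l\<close>, as \<open>l' \<ge> l\<close> would make \<open>x + m_n\<close> too
  large.\<close>

lemma arithmetic_saturated:
  assumes m: "\<And>i. i \<in> {1..n} \<Longrightarrow> m i = m 1 + (i - 1) * d"
  shows saturated
  unfolding saturated_alt
proof (intro allI impI)
  fix x y assume 1: "pt (x + m n) y \<in> S" and 2: "pt x (y + m n) \<in> S"
  have mn: "m n = m 1 + (n - 1) * d" using m[of n] n_pos by simp
  obtain \<mu> where "Poly_Mapping.keys \<mu> \<subseteq> {1..n + 1}" "x + m n = weight u_deg \<mu>" "y = weight v_deg \<mu>"
    using 1 unfolding mem_S_iff by blast
  then have "x + m n + y = m n * weight (\<lambda>_. 1) \<mu>" using total_degree by metis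
  then obtain N' where N': "x + m n + y = m n * N'" by blast
  have "N' \<noteq> 0" using N' c_pos by (intro notI) simp
  then obtain N where N: "N' = Suc N" using not0_implies_Suc by blast
  have deg: "x + y = m n * N" using N' by (simp add: N)
  obtain l j where lj: "x + m n = l * m 1 + j * d" "j \<le> l * (n - 1)" "l \<le> Suc N"
    using 1 mem_S_arithmetic_iff[OF m, of "x + m n" y "Suc N"] N' N by auto
  obtain l' j' where lj': "x = l' * m 1 + j' * d" "j' \<le> l' * (n - 1)"
    using 2 mem_S_arithmetic_iff[OF m, of x "y + m n" "Suc N"] N' N by (auto simp: ac_simps)
  have "l \<noteq> 0" using lj c_pos by (intro notI) simp
  then obtain k where k: "l = Suc k" using not0_implies_Suc by blast
  have "\<exists>l j. x = l * m 1 + j * d \<and> j \<le> l * (n - 1) \<and> l \<le> N"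
  proof (cases "n - 1 \<le> j")
    case True
    then obtain i where i: "j = n - 1 + i" using le_Suc_ex by blast
    have "x = k * m 1 + i * d" using lj(1) unfolding mn k i by (simp add: algebra_simps)
    then show ?thesis using lj k i by (intro exI[of _ k] exI[of _ i]) auto
  next
    case False
    have "l' < l"
    proof (rule ccontr)
      assume "\<not> l' < l"
      then have "l * m 1 \<le> l' * m 1" by (intro mult_le_mono1) simp
      then have "l * m 1 + m 1 + (n - 1) * d \<le> x + m n" using lj'(1) mn by linarith
      moreover have "j * d \<le> (n - 1) * d" using False by (intro mult_le_mono1) simp
      moreover have "0 < m 1" using m_pos[of 1] n_pos by simp
      ultimately show False using lj(1) by linarith
    qed
    then show ?thesis using lj' lj(3) by (intro exI[of _ l'] exI[of _ j']) auto
  qed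
  then show "pt x y \<in> S" using mem_S_arithmetic_iff[OF m deg] by blast
qed

text \<open>The hole is \<open>h\<close> times the first generator, lowered by one degree: \<open>2 h m\<^sub>1 + (n - 1) d\<close> is both
  \<open>h m\<^sub>1 + m\<^sub>n\<close> and \<open>m\<^sub>2 + m\<^sub>n\<^sub>-\<^sub>1\<close>, and the latter sum has fewer terms.\<close>

lemma generalized_arithmetic_not_saturated:
  assumes n: "3 \<le> n" and h: "2 \<le> h" and d: "0 < d"
    and m: "\<And>i. i \<in> {2..n} \<Longrightarrow> m i = h * m 1 + (i - 1) * d"
  shows "\<not> saturated"
proof -
  have mn: "m n = h * m 1 + (n - 1) * d" using m[of n] n by simp
  obtain r where r: "h = r + 2" using h le_Suc_ex by (metis add.commute)
  obtain q where q: "m n = h * m 1 + q" using mn by blast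
  define x where "x = h * m 1"
  \<comment> \<open>Here \<open>q\<close> is \<open>(n - 1) * d\<close>. The degree of
    \<open>(x, y)\<close> becomes \<open>r + 1 = h - 1\<close>, one less than the number of copies
    of \<open>m 1\<close> in \<open>x\<close>.\<close>
  define y where "y = r * m n + q"
  have y: "x + y = (r + 1) * m n" unfolding x_def y_def using q by (simp add: algebra_simps)
  have "pt (x + m n) y \<in> S"
  proof -
    \<comment> \<open>Two generators and \<open>r\<close> copies of the last variable make
      \<open>r + 2 = h\<close> factors, the degree of \<open>(x + m_n, y)\<close>.\<close>
    have "pt (m 2) (m n - m 2) + pt (m (n - 1)) (m n - m (n - 1)) + ax 1 r \<in> S"
      using n by (intro add_S generator_in_S ax_in) auto
    moreover have s: "m 2 + m (n - 1) = x + m n"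
    proof -
      obtain p where "n = p + 3" using n le_Suc_ex by (metis add.commute)
      then show ?thesis using m[of 2] m[of "n - 1"] mn by (simp add: x_def algebra_simps)
    qed
    moreover have "(m n - m 2) + (m n - m (n - 1)) + r * m n = y"
    proof -
      have "m 2 \<le> m n" "m (n - 1) \<le> m n" using m_le[of 2] m_le[of "n - 1"] n by auto
      then have "(m n - m 2) + (m n - m (n - 1)) = q" using s q by (simp add: x_def)
      then show ?thesis by (simp add: y_def)
    qed
    ultimately show ?thesis by (simp add: ax_pt pt_add)
  qed
  moreover have "pt x (y + m n) \<in> S"
  proof -
    have "weight v_deg (Poly_Mapping.single 1 h) = h * (m n - m 1)" "weight u_deg (Poly_Mapping.single 1 h) = x"
      using n by (simp_all add: u_deg_def v_deg_def x_def)
    moreover have "h * (m n - m 1) = y + m n"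
    proof -
      have "x + h * (m n - m 1) = h * m n"
        using m_le[of 1] n by (simp add: x_def diff_mult_distrib2)
      moreover have "x + (y + m n) = h * m n" using y r by (simp add: algebra_simps)
      ultimately show ?thesis by linarith
    qed
    ultimately show ?thesis using weight_in_S[of "Poly_Mapping.single 1 h"] n by simp
  qed
  moreover have "pt x y \<notin> S"
  proof
    assume "pt x y \<in> S"
    then obtain \<mu> where \<mu>: "Poly_Mapping.keys \<mu> \<subseteq> {1..n + 1}" "x = weight u_deg \<mu>" "y = weight v_deg \<mu>"
      by (auto simp: mem_S_iff)
    have "m n * weight (\<lambda>_. 1) \<mu> = m n * (r + 1)" using total_degree[OF \<mu>(1)] y \<mu> by (simp add: mult.commute)
    then have tot: "weight (\<lambda>_. 1) \<mu> = r + 1" using c_pos by simp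
    \<comment> \<open>Each of \<open>m_2, ..., m_n\<close> exceeds \<open>x\<close>, so only the
      first and the last variable can occur; \<open>r + 1\<close> factors then give at most
      \<open>(h - 1) m_1 < x\<close>.\<close>
    have "weight u_deg \<mu> \<le> weight (\<lambda>i. m 1 * 1 + 0 * 0) \<mu>"
    proof (rule weight_mono)
      fix i assume i: "i \<in> Poly_Mapping.keys \<mu>"
      then have le: "u_deg i \<le> x" unfolding \<mu>(2) by (rule weight_ge)
      have "i \<notin> {2..n}"
      proof
        assume i2: "i \<in> {2..n}"
        then have "0 < (i - 1) * d" using d by simp
        then show False using le m[OF i2] i2 by (simp add: u_deg_def x_def)
      qed
      then have "i = 1 \<or> i = n + 1" using i \<mu>(1) by fastforce
      then show "u_deg i \<le> m 1 * 1 + 0 * 0" by (auto simp: u_deg_def)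
    qed
    then have "x \<le> m 1 * (r + 1)" unfolding weight_linear using \<mu>(2) tot by simp
    moreover have "0 < m 1" using m_pos[of 1] n by simp
    ultimately show False by (simp add: x_def r algebra_simps)
  qed
  ultimately show ?thesis unfolding saturated_alt by blast
qed

end

theorem corollary3p2:
  fixes n :: nat and m :: "nat \<Rightarrow> nat"
  assumes "infinite (UNIV :: 'k::field set)"
    and "n \<ge> 3"
    and "\<forall>i \<in> {1..n}. 0 < m i"
    and "strict_mono_on {1..n} m"
    and "generalized_arithmetic_sequence n m"
  shows "cohen_macaulay (coordinate_ring n m :: (nat, 'k) mpol set ring)
           \<longleftrightarrow> arithmetic_sequence n m"
proof -
  interpret projective_monomial_curve n m "TYPE('k)"
  proof
    show "m i \<le> m n" if "i \<in> {1..n}" for i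
      using strict_mono_on_leD[OF assms(4), of i n] that by auto
  qed (use assms in auto)
  obtain h d where h: "0 < h" and d: "0 < d" and m: "\<And>i. i \<in> {2..n} \<Longrightarrow> m i = h * m 1 + (i - 1) * d"
    using assms(5) by (auto simp: generalized_arithmetic_sequence_def)
  have "saturated \<longleftrightarrow> arithmetic_sequence n m"
  proof
    assume sat: saturated
    have "\<not> 2 \<le> h" using generalized_arithmetic_not_saturated[OF assms(2) _ d m] sat by blast
    then have "h = 1" using h by simp
    \<comment> \<open>The index 1 is not covered by the generalized formula, and there
      \<open>i - 1\<close> is 0.\<close>
    then have "m i = m 1 + (i - 1) * d" if "i \<in> {1..n}" for i
      using that m[of i] by (cases "i = 1") auto
    then have "\<forall>i\<in>{1..n}. m i = m 1 + (i - 1) * d" by (intro ballI)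
    then show "arithmetic_sequence n m" using d unfolding arithmetic_sequence_def by (intro exI[of _ d] conjI)
  next
    assume "arithmetic_sequence n m"
    then obtain e where "\<forall>i\<in>{1..n}. m i = m 1 + (i - 1) * e"
      unfolding arithmetic_sequence_def by (elim exE conjE)
    then show saturated by (intro arithmetic_saturated) (rule bspec)
  qed
  then show ?thesis using cohen_macaulay_coordinate_ring_iff[OF assms(1)] by simp
qed

end
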